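(* Let $0<\alpha<1$ and let $f\in\mathring{C}^{0,\alpha}(\mathbb{R}^2)$ be $m$-fold rotationally symmetric for some integer $m\ge3$. Then $\nabla^2(-\Delta)^{-1}f\in\mathring{C}^{0,\alpha}(\mathbb{R}^2)$.
   Context: A function $f$ on $\mathbb{R}^2$ is $m$-fold rotationally symmetric if $f(O_{2\pi/m}x)=f(x)$ for all $x$, where $O_\theta$ is the counterclockwise rotation by angle $\theta$. The space $\mathring{C}^{0,\alpha}(\mathbb{R}^2)$ is defined by finiteness of the norm $$\|f\|_{\mathring{C}^{0,\alpha}}:=\|f\|_{L^\infty}+\sup_{x\ne x'}\frac{\big||x|^\alpha f(x)-|x'|^\alpha f(x')\big|}{|x-x'|^\alpha}.$$ No decay at infinity or compact support is assumed on $f$. For bounded $m$-fold symmetric $f$ with $m\ge3$, $(-\Delta)^{-1}f$ denotes the function $\Psi$, unique up to an additive constant, with $-\Delta\Psi=f$, $\Psi$ $m$-fold symmetric, and at most quadratic growth at infinity (with the constant normalized by $\Psi(0)=0$, $|\Psi(x)|\le C|x|^2$). $\nabla^2$ denotes the matrix of all second derivatives; membership is entrywise. *)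

theory Defs
  imports "HOL-Analysis.Analysis" "HOL-Probability.Essential_Supremum"
begin

definition rotation :: "real \<Rightarrow> real^2 \<Rightarrow> real^2" where
  "rotation \<theta> x = vector [cos \<theta> * x$1 - sin \<theta> * x$2, sin \<theta> * x$1 + cos \<theta> * x$2]"

definition rot_symmetric :: "nat \<Rightarrow> (real^2 \<Rightarrow> real) \<Rightarrow> bool" where
  "rot_symmetric m f \<longleftrightarrow> (\<forall>x. f (rotation (2 * pi / real m) x) = f x)"

definition cring_seminorm :: "real \<Rightarrow> (real^2 \<Rightarrow> real) \<Rightarrow> ereal" where
  "cring_seminorm \<alpha> f =
     (SUP (x, x') \<in> {(x, x'). x \<noteq> x'}.
        ereal (\<bar>norm x powr \<alpha> * f x - norm x' powr \<alpha> * f x'\<bar> / norm (x - x') powr \<alpha>))"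

definition cring_norm :: "real \<Rightarrow> (real^2 \<Rightarrow> real) \<Rightarrow> ereal" where
  "cring_norm \<alpha> f = esssup lborel (\<lambda>x. ereal \<bar>f x\<bar>) + cring_seminorm \<alpha> f"

text \<open>The weight vanishes at the origin, so the value of a member at \<^term>\<open>0 :: real^2\<close> is
  unconstrained and members need not be continuous there.\<close>

definition cring :: "real \<Rightarrow> (real^2 \<Rightarrow> real) set" where
  "cring \<alpha> = {f \<in> borel_measurable lborel. cring_norm \<alpha> f < \<infinity>}"

definition partial :: "2 \<Rightarrow> (real^2 \<Rightarrow> real) \<Rightarrow> real^2 \<Rightarrow> real" where
  "partial i \<phi> x = frechet_derivative \<phi> (at x) (axis i 1)"

primrec C_k :: "nat \<Rightarrow> (real^2 \<Rightarrow> real) \<Rightarrow> bool" where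
  "C_k 0 \<phi> \<longleftrightarrow> continuous_on UNIV \<phi>"
| "C_k (Suc k) \<phi> \<longleftrightarrow> (\<forall>x. \<phi> differentiable (at x)) \<and> (\<forall>i. C_k k (partial i \<phi>))"

definition test_function :: "(real^2 \<Rightarrow> real) \<Rightarrow> bool" where
  "test_function \<phi> \<longleftrightarrow> (\<forall>k. C_k k \<phi>) \<and> compact (closure {x. \<phi> x \<noteq> 0})"

definition locally_integrable :: "(real^2 \<Rightarrow> real) \<Rightarrow> bool" where
  "locally_integrable g \<longleftrightarrow> (\<forall>K. compact K \<longrightarrow> set_integrable lborel K g)"

text \<open>Derivatives are distributional: a member of \<^term>\<open>cring \<alpha>\<close> may be discontinuous at the
  origin, so the Poisson equation need not have a classical solution on the whole plane.\<close>

definition weak_hessian :: "(real^2 \<Rightarrow> real) \<Rightarrow> (real^2 \<Rightarrow> real^2^2) \<Rightarrow> bool" where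
  "weak_hessian \<Psi> H \<longleftrightarrow> locally_integrable \<Psi> \<and>
     (\<forall>i j. locally_integrable (\<lambda>x. H x $ i $ j) \<and>
       (\<forall>\<phi>. test_function \<phi> \<longrightarrow>
         (LINT x|lborel. \<Psi> x * partial i (partial j \<phi>) x) = (LINT x|lborel. H x $ i $ j * \<phi> x)))"

definition weak_neg_laplacian :: "(real^2 \<Rightarrow> real) \<Rightarrow> (real^2 \<Rightarrow> real) \<Rightarrow> bool" where
  "weak_neg_laplacian \<Psi> f \<longleftrightarrow> locally_integrable \<Psi> \<and> locally_integrable f \<and>
     (\<forall>\<phi>. test_function \<phi> \<longrightarrow>
       (LINT x|lborel. \<Psi> x * - (\<Sum>i\<in>UNIV. partial i (partial i \<phi>) x)) = (LINT x|lborel. f x * \<phi> x))"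

text \<open>Continuity selects the pointwise representative of the distributional solution, so that the
  solution is unique as a function and its value at the origin is meaningful.\<close>

definition poisson_solution :: "nat \<Rightarrow> (real^2 \<Rightarrow> real) \<Rightarrow> (real^2 \<Rightarrow> real) \<Rightarrow> bool" where
  "poisson_solution m f \<Psi> \<longleftrightarrow>
     continuous_on UNIV \<Psi> \<and> weak_neg_laplacian \<Psi> f \<and> rot_symmetric m \<Psi> \<and>
     \<Psi> 0 = 0 \<and> (\<exists>C. \<forall>x. \<bar>\<Psi> x\<bar> \<le> C * (norm x)\<^sup>2)"

text \<open>For bounded measurable \<open>m\<close>-fold symmetric \<open>f\<close> with \<open>m \<ge> 3\<close> there is exactly one such
  solution.\<close>

definition inv_neg_laplacian :: "nat \<Rightarrow> (real^2 \<Rightarrow> real) \<Rightarrow> real^2 \<Rightarrow> real" where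
  "inv_neg_laplacian m f = (THE \<Psi>. poisson_solution m f \<Psi>)"

end

theory Submission
  imports Defs
begin

text \<open>
  The solution is built from dyadic blocks. Let \<open>g\<close> be a radial bump of mass one and \<open>\<Gamma>\<close> a radial
  test function with \<open>\<Delta>\<Gamma> = g(z/2)/4 - g(z)\<close>. Averaging \<open>f\<close> against \<open>g\<close> and \<open>\<Gamma>\<close> at scale
  \<open>l = 2^k\<close> gives \<open>u_k\<close> and \<open>w_k = l^2 (f * \<Gamma>_l)\<close> with \<open>\<Delta>w_k = u_(k+1) - u_k\<close>, so that
  \<open>\<Sum>(w_k(x) - w_k(0)) - |x|^2 u_N(0) / 4\<close>, summed over \<open>-N \<le> k < N\<close>, has negative Laplacian
  \<open>u_(-N)(x) - u_N(x) + u_N(0)\<close>, which tends to \<open>f\<close>. For \<open>m \<ge> 3\<close> the symmetry removes the angular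
  modes of order one and two at the origin. Hence the Taylor polynomial of a block at the origin is
  purely radial, which makes the sum converge with quadratic growth, and the off-diagonal and
  traceless second derivatives \<open>p_k\<close> of \<open>w_k\<close> vanish at the origin. They satisfy
  \<open>|p_k(x)| \<le> C min((l/|x|)^\<alpha>, |x|/l)\<close> and
  \<open>|x|^\<alpha> |p_k(x) - p_k(y)| \<le> C d^\<alpha> min((l/d)^\<alpha>, (l/d)^(\<alpha>-1))\<close> for \<open>d = |x-y|\<close> and \<open>|x| \<le> |y|\<close>;
  both are summable over dyadic \<open>l\<close>, and the trace of the Hessian is \<open>-f\<close>.

  For uniqueness, a weakly harmonic \<open>h\<close> equals its averages against \<open>g\<close> at every scale. Expanding
  \<open>g\<close> to third order, the lower order terms vanish by symmetry and harmonicity, and quadratic growth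
  leaves \<open>|h(x)| \<le> C |x|^3 / l\<close> for every \<open>l\<close>.
\<close>

section \<open>Test functions\<close>

text \<open>The Newtonian potential of a merely bounded f need not converge, and the kernel of its
  Hessian, of size |z|^(-2), is integrable neither at 0 nor at infinity. Dyadic blocks replace
  principal values by absolutely convergent integrals against smooth kernels, so every derivative
  falls on a kernel and never on f. The cancellation comes from two sources: kernels of mean zero
  exploit the Hoelder bound at scales below |x|, and the symmetry at the origin takes over at scales
  above |x|. Symmetry cannot remove the radial quadratic part of a block. Its coefficient is a
  quarter of u_(k+1)(0) - u_k(0), so over the large scales it telescopes to u_N(0), which is bounded
  but may have no limit. This drift is what the term |x|^2 u_N(0) / 4 cancels. For the same reason
  the blocks of a single diagonal entry need not vanish at the origin, and the diagonal is recovered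
  from trace and difference. In the Hoelder estimate the geometric rates are \<alpha> below the
  scale d and 1 - \<alpha> above it, which is where both ends of 0 < \<alpha> < 1 enter. Uniqueness
  is part of the claim, because \<open>inv_neg_laplacian\<close> is a definite description.\<close>

lemma partial_eq: "(\<phi> has_derivative \<phi>') (at x) \<Longrightarrow> partial i \<phi> x = \<phi>' (axis i 1)"
  unfolding partial_def using frechet_derivative_at by metis

lemma has_derivative_partial:
  assumes "\<phi> differentiable (at x)"
  shows "(\<phi> has_derivative (\<lambda>h. \<Sum>i\<in>UNIV. h$i * partial i \<phi> x)) (at x)"
proof -
  have *: "(\<phi> has_derivative frechet_derivative \<phi> (at x)) (at x)"
    using assms frechet_derivative_works by blast
  then have lin: "linear (frechet_derivative \<phi> (at x))"
    by (simp add: has_derivative_linear)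
  have "frechet_derivative \<phi> (at x) = (\<lambda>h. \<Sum>i\<in>UNIV. h$i * partial i \<phi> x)"
  proof
    fix h :: "real^2"
    have "frechet_derivative \<phi> (at x) h = frechet_derivative \<phi> (at x) (\<Sum>i\<in>UNIV. h$i *\<^sub>R axis i 1)"
      by (simp only: basis_expansion flip: scalar_mult_eq_scaleR)
    also have "\<dots> = (\<Sum>i\<in>UNIV. h$i * partial i \<phi> x)"
      by (simp add: linear_sum[OF lin] linear_cmul[OF lin] partial_def)
    finally show "frechet_derivative \<phi> (at x) h = (\<Sum>i\<in>UNIV. h$i * partial i \<phi> x)" .
  qed
  with * show ?thesis by simp
qed

lemma partial_eqI:
  assumes "\<And>x. (\<phi> has_derivative (\<lambda>h. \<Sum>i\<in>UNIV. h$i * D i x)) (at x)"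
  shows "partial i \<phi> = D i"
proof
  fix x
  have "partial i \<phi> x = (\<Sum>j\<in>UNIV. axis i (1::real) $ j * D j x)"
    by (rule partial_eq[OF assms])
  also have "\<dots> = (\<Sum>j\<in>UNIV. if j = i then D j x else 0)"
    by (rule sum.cong) (auto simp: axis_def)
  finally show "partial i \<phi> x = D i x" by simp
qed

text \<open>Naming the gradient explicitly lets inductions on k run over closed expressions
  \<open>D i\<close> instead of over \<open>partial\<close>, which is defined through
  \<open>frechet_derivative\<close>.\<close>

lemma C_k_SucI:
  assumes "\<And>x. (\<phi> has_derivative (\<lambda>h. \<Sum>i\<in>UNIV. h$i * D i x)) (at x)" and "\<And>i. C_k k (D i)"
  shows "C_k (Suc k) \<phi>"
  using assms partial_eqI[of \<phi> D] by (auto simp: differentiable_def)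

lemma C_k_continuous: "C_k k \<phi> \<Longrightarrow> continuous_on UNIV \<phi>"
  by (cases k) (auto intro: differentiable_imp_continuous_within continuous_at_imp_continuous_on)

lemma C_k_SucD: "C_k (Suc k) \<phi> \<Longrightarrow> C_k k \<phi>"
proof (induction k arbitrary: \<phi>)
  case 0 then show ?case using C_k_continuous[of "Suc 0" \<phi>] by simp
next
  case (Suc k) then show ?case by (metis C_k.simps(2))
qed

lemma C_k_deriv:
  assumes "C_k (Suc k) \<phi>"
  shows "(\<phi> has_derivative (\<lambda>h. \<Sum>i\<in>UNIV. h$i * partial i \<phi> x)) (at x)"
  using assms by (auto intro: has_derivative_partial)

lemma C_k_add: "C_k k \<phi> \<Longrightarrow> C_k k \<psi> \<Longrightarrow> C_k k (\<lambda>x. \<phi> x + \<psi> x)"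
proof (induction k arbitrary: \<phi> \<psi>)
  case 0 then show ?case by (auto intro: continuous_intros)
next
  case (Suc k)
  show ?case
  proof (rule C_k_SucI)
    show "((\<lambda>x. \<phi> x + \<psi> x) has_derivative (\<lambda>h. \<Sum>i\<in>UNIV. h$i * (partial i \<phi> x + partial i \<psi> x))) (at x)" for x
      by (rule has_derivative_eq_rhs[OF has_derivative_add[OF C_k_deriv[OF Suc.prems(1)] C_k_deriv[OF Suc.prems(2)]]])
        (simp add: algebra_simps sum.distrib)
    show "C_k k (\<lambda>x. partial i \<phi> x + partial i \<psi> x)" for i
      using Suc by simp
  qed
qed

lemma C_k_cmult: "C_k k \<phi> \<Longrightarrow> C_k k (\<lambda>x. c * \<phi> x)"
proof (induction k arbitrary: \<phi>)
  case 0 then show ?case by (auto intro: continuous_intros)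
next
  case (Suc k)
  show ?case
  proof (rule C_k_SucI)
    show "((\<lambda>x. c * \<phi> x) has_derivative (\<lambda>h. \<Sum>i\<in>UNIV. h$i * (c * partial i \<phi> x))) (at x)" for x
      by (rule has_derivative_eq_rhs[OF has_derivative_mult_right[OF C_k_deriv[OF Suc.prems(1)]]])
        (simp add: algebra_simps sum_distrib_left)
    show "C_k k (\<lambda>x. c * partial i \<phi> x)" for i
      using Suc by simp
  qed
qed

lemma has_derivative_affine_arg:
  fixes \<phi> :: "real^2 \<Rightarrow> real"
  assumes "C_k (Suc k) \<phi>"
  shows "((\<lambda>x. \<phi> (c *\<^sub>R x + b)) has_derivative
    (\<lambda>h. \<Sum>i\<in>UNIV. h$i * (c * partial i \<phi> (c *\<^sub>R x + b)))) (at x)"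
proof -
  have "((\<lambda>x. c *\<^sub>R x + b) has_derivative (\<lambda>h. c *\<^sub>R h)) (at x)"
    by (auto intro!: derivative_eq_intros)
  from has_derivative_compose[OF this C_k_deriv[OF assms]]
  show ?thesis by (rule has_derivative_eq_rhs) (simp add: algebra_simps)
qed

lemma partial_affine:
  assumes "C_k (Suc k) \<phi>"
  shows "partial i (\<lambda>x. \<phi> (c *\<^sub>R x + b)) = (\<lambda>x. c * partial i \<phi> (c *\<^sub>R x + b))"
  using partial_eqI[OF has_derivative_affine_arg[OF assms], of i] by simp

lemma C_k_affine: "C_k k \<phi> \<Longrightarrow> C_k k (\<lambda>x. \<phi> (c *\<^sub>R x + b))"
proof (induction k arbitrary: \<phi>)
  case 0
  then show ?case by (auto intro!: continuous_on_compose2[of UNIV \<phi>] continuous_intros)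
next
  case (Suc k)
  show ?case
  proof (rule C_k_SucI)
    show "((\<lambda>x. \<phi> (c *\<^sub>R x + b)) has_derivative
      (\<lambda>h. \<Sum>i\<in>UNIV. h$i * (c * partial i \<phi> (c *\<^sub>R x + b)))) (at x)" for x
      by (rule has_derivative_affine_arg[OF Suc.prems])
    show "C_k k (\<lambda>x. c * partial i \<phi> (c *\<^sub>R x + b))" for i
      using Suc C_k_cmult by simp
  qed
qed

lemma test_function_C_k: "test_function \<phi> \<Longrightarrow> C_k k \<phi>"
  by (simp add: test_function_def)

lemma test_function_continuous: "test_function \<phi> \<Longrightarrow> continuous_on UNIV \<phi>"
  using test_function_C_k C_k_continuous by blast

lemma test_function_deriv:
  "test_function \<phi> \<Longrightarrow> (\<phi> has_derivative (\<lambda>h. \<Sum>i\<in>UNIV. h$i * partial i \<phi> x)) (at x)"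
  using C_k_deriv test_function_C_k by blast

lemma test_functionI:
  assumes "\<And>k. C_k k \<phi>" "\<And>x. norm x > R \<Longrightarrow> \<phi> x = 0"
  shows "test_function \<phi>"
proof -
  have "{x. \<phi> x \<noteq> 0} \<subseteq> cball 0 R"
    using assms(2) by (force simp: dist_norm)
  then have "bounded {x. \<phi> x \<noteq> 0}" using bounded_cball bounded_subset by blast
  then show ?thesis using assms(1) by (auto simp: test_function_def)
qed

lemma test_function_support:
  assumes "test_function \<phi>"
  obtains R where "R > 0" "\<And>x. norm x > R \<Longrightarrow> \<phi> x = 0"
proof -
  have "bounded {x. \<phi> x \<noteq> 0}"
    using assms bounded_closure_image compact_imp_bounded bounded_subset closure_subset
    unfolding test_function_def by metis
  then obtain R where "R > 0" "\<forall>x\<in>{x. \<phi> x \<noteq> 0}. norm x \<le> R" using bounded_pos by metis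
  then show ?thesis using that[of R] by force
qed

text \<open>The strict inequality makes the exterior region open, so all derivatives vanish there
  with the same radius \<open>R\<close>.\<close>

lemma partial_zero_outside:
  assumes "\<And>x. norm x > R \<Longrightarrow> \<phi> x = 0" "norm x > R"
  shows "partial i \<phi> x = 0"
proof -
  have "open {y::real^2. norm y > R}"
    by (intro open_Collect_less continuous_intros)
  then have "(\<phi> has_derivative (\<lambda>_. 0)) (at x)"
    by (rule has_derivative_transform_within_open[OF has_derivative_const[of 0]]) (simp_all add: assms)
  from partial_eq[OF this] show ?thesis by simp
qed

lemma test_function_partial:
  assumes "test_function \<phi>"
  shows "test_function (partial i \<phi>)"
proof -
  obtain R where "\<And>x. norm x > R \<Longrightarrow> \<phi> x = 0" using test_function_support[OF assms] by metis
  moreover have "C_k k (partial i \<phi>)" for k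
    using test_function_C_k[OF assms, of "Suc k"] by simp
  ultimately show ?thesis
    by (intro test_functionI[of _ R]) (auto intro: partial_zero_outside)
qed

lemma test_function_affine:
  assumes "test_function \<phi>" "c \<noteq> 0"
  shows "test_function (\<lambda>x. \<phi> (c *\<^sub>R x + b))"
proof -
  obtain R where R: "R > 0" "\<And>x. norm x > R \<Longrightarrow> \<phi> x = 0" using test_function_support[OF assms(1)] by metis
  show ?thesis
  proof (rule test_functionI[of _ "(R + norm b) / \<bar>c\<bar>"])
    fix x :: "real^2" assume "norm x > (R + norm b) / \<bar>c\<bar>"
    then have "norm (c *\<^sub>R x) > R + norm b"
      using assms(2) by (simp add: field_simps)
    moreover have "norm (c *\<^sub>R x) \<le> norm (c *\<^sub>R x + b) + norm b"
      by (metis add_diff_cancel_right' norm_triangle_ineq4)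
    ultimately show "\<phi> (c *\<^sub>R x + b) = 0" using R(2) by simp
  qed (rule C_k_affine[OF test_function_C_k[OF assms(1)]])
qed

lemma compact_support_bounded:
  fixes \<phi> :: "real^2 \<Rightarrow> real"
  assumes "continuous_on UNIV \<phi>" "\<And>x. norm x > R \<Longrightarrow> \<phi> x = 0"
  obtains c where "c > 0" "\<And>x. \<bar>\<phi> x\<bar> \<le> c"
proof -
  have "compact (\<phi> ` cball 0 R)"
    by (intro compact_continuous_image continuous_on_subset[OF assms(1)]) auto
  then obtain c where c: "c > 0" "\<And>y. y \<in> \<phi> ` cball 0 R \<Longrightarrow> \<bar>y\<bar> \<le> c"
    using compact_imp_bounded bounded_pos real_norm_def by metis
  have "\<bar>\<phi> x\<bar> \<le> c" for x
    using c assms(2)[of x] by (cases "norm x > R") (auto simp: dist_norm)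
  with c that show ?thesis by blast
qed

lemma test_function_bounded:
  assumes "test_function \<phi>"
  obtains c where "c > 0" "\<And>x. \<bar>\<phi> x\<bar> \<le> c"
proof -
  obtain R where "\<And>x. norm x > R \<Longrightarrow> \<phi> x = 0" using test_function_support[OF assms] by metis
  from compact_support_bounded[OF test_function_continuous[OF assms] this] that show ?thesis by blast
qed

lemma test_function_Lipschitz:
  assumes "test_function \<phi>"
  obtains L where "L > 0" "\<And>x y. \<bar>\<phi> x - \<phi> y\<bar> \<le> L * norm (x - y)"
proof -
  have "\<exists>c>0. \<forall>x. \<bar>partial i \<phi> x\<bar> \<le> c" for i
    by (rule test_function_bounded[OF test_function_partial[OF assms, of i]]) blast
  then have "\<exists>c. \<forall>i. c i > 0 \<and> (\<forall>x. \<bar>partial i \<phi> x\<bar> \<le> c i)"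
    by (intro choice allI)
  then obtain c where c: "\<And>i. c i > 0" "\<And>i x. \<bar>partial i \<phi> x\<bar> \<le> c i" by blast
  define L where "L = (\<Sum>i\<in>UNIV. c i)"
  have "norm (\<phi> x - \<phi> y) \<le> L * norm (x - y)" for x y
  proof (rule differentiable_bound[of UNIV \<phi> "\<lambda>x h. \<Sum>i\<in>UNIV. h$i * partial i \<phi> x"])
    fix x :: "real^2"
    show "(\<phi> has_derivative (\<lambda>h. \<Sum>i\<in>UNIV. h $ i * partial i \<phi> x)) (at x within UNIV)"
      using test_function_deriv[OF assms] by simp
    show "onorm (\<lambda>h. \<Sum>i\<in>UNIV. h $ i * partial i \<phi> x) \<le> L"
    proof (rule onorm_le)
      fix h :: "real^2"
      have "norm (\<Sum>i\<in>UNIV. h $ i * partial i \<phi> x) \<le> (\<Sum>i\<in>UNIV. norm h * c i)"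
        by (rule sum_norm_le) (auto simp: abs_mult intro!: mult_mono component_le_norm_cart c)
      then show "norm (\<Sum>i\<in>UNIV. h $ i * partial i \<phi> x) \<le> L * norm h"
        by (simp add: L_def sum_distrib_left mult.commute)
    qed
  qed auto
  moreover have "L > 0" unfolding L_def using c by (intro sum_pos) auto
  ultimately show ?thesis using that by auto
qed

text \<open>Maclaurin's formula of order three along the segment from p to p + w. The constant is
  uniform in p because the third derivatives are again test functions, hence bounded.\<close>

lemma test_function_Taylor:
  assumes "test_function \<phi>"
  obtains C where "C > 0" "\<And>p w. \<bar>\<phi> (p + w) - \<phi> p - (\<Sum>i\<in>UNIV. w$i * partial i \<phi> p)
     - (\<Sum>i\<in>UNIV. \<Sum>j\<in>UNIV. w$i * w$j * partial j (partial i \<phi>) p) / 2\<bar> \<le> C * norm w ^ 3"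
proof -
  note t = test_function_partial
  have "\<exists>c>0. \<forall>x. \<bar>partial k (partial j (partial i \<phi>)) x\<bar> \<le> c" for i j k
    by (rule test_function_bounded[OF t[OF t[OF t[OF assms]]], of k j i]) blast
  then have "\<exists>c. \<forall>i j k. c i j k > 0 \<and> (\<forall>x. \<bar>partial k (partial j (partial i \<phi>)) x\<bar> \<le> c i j k)"
    by (intro choice allI)
  then obtain c where c: "\<And>i j k. c i j k > 0" "\<And>i j k x. \<bar>partial k (partial j (partial i \<phi>)) x\<bar> \<le> c i j k"
    by blast
  define L where "L = (\<Sum>i\<in>UNIV. \<Sum>j\<in>UNIV. \<Sum>k\<in>UNIV. c i j k)"
  have "\<bar>\<phi> (p + w) - \<phi> p - (\<Sum>i\<in>UNIV. w$i * partial i \<phi> p)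
     - (\<Sum>i\<in>UNIV. \<Sum>j\<in>UNIV. w$i * w$j * partial j (partial i \<phi>) p) / 2\<bar> \<le> L / 6 * norm w ^ 3" for p w
  proof -
    \<comment> \<open>For n up to 3, \<open>d n\<close> is the n-th derivative of s -> \<phi>(p + s
      w). The sums are nested one index at a time so that each differentiation reduces to
      \<open>chain\<close> on the innermost factor.\<close>
    define d where "d n s = (if n = 0 then \<phi> (p + s *\<^sub>R w)
      else if n = 1 then (\<Sum>i\<in>UNIV. w$i * partial i \<phi> (p + s *\<^sub>R w))
      else if n = 2 then (\<Sum>i\<in>UNIV. w$i * (\<Sum>j\<in>UNIV. w$j * partial j (partial i \<phi>) (p + s *\<^sub>R w)))
      else (\<Sum>i\<in>UNIV. w$i * (\<Sum>j\<in>UNIV. w$j * (\<Sum>k\<in>UNIV. w$k * partial k (partial j (partial i \<phi>)) (p + s *\<^sub>R w)))))"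
      for n :: nat and s :: real
    have chain: "((\<lambda>s. \<psi> (p + s *\<^sub>R w)) has_real_derivative (\<Sum>i\<in>UNIV. w$i * partial i \<psi> (p + s *\<^sub>R w))) (at s)"
      if "test_function \<psi>" for \<psi> s
    proof -
      have "((\<lambda>s. p + s *\<^sub>R w) has_derivative (\<lambda>h. h *\<^sub>R w)) (at s)"
        by (auto intro!: derivative_eq_intros)
      from has_derivative_compose[OF this test_function_deriv[OF that]]
      show ?thesis unfolding has_field_derivative_def
        by (rule has_derivative_eq_rhs) (simp add: algebra_simps sum_distrib_left fun_eq_iff)
    qed
    have D: "DERIV (d m) s :> d (Suc m) s" if "m < 3" for m s
    proof -
      consider "m = 0" | "m = 1" | "m = 2" using \<open>m < 3\<close> by linarith
      then show ?thesis
      proof cases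
        case 1
        then show ?thesis using chain[OF assms] by (simp add: d_def[abs_def])
      next
        case 2
        then show ?thesis
          by (simp add: d_def[abs_def]) (intro DERIV_sum DERIV_cmult chain t assms)
      next
        case 3
        then show ?thesis
          by (simp add: d_def[abs_def]) (intro DERIV_sum DERIV_cmult chain t assms)
      qed
    qed
    have "\<exists>s>0. s < 1 \<and> d 0 1 = (\<Sum>m<3. (d m 0 / fact m) * 1 ^ m) + (d 3 s / fact 3) * 1 ^ 3"
      by (rule Maclaurin) (use D in auto)
    then obtain s where s: "d 0 1 = (\<Sum>m<3. d m 0 / fact m) + d 3 s / fact 3" by auto
    have weighted: "\<bar>\<Sum>i\<in>UNIV. w$i * a i\<bar> \<le> (\<Sum>i\<in>UNIV. norm w * b i)" if "\<And>i. \<bar>a i\<bar> \<le> b i" for a b :: "2 \<Rightarrow> real"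
      by (rule order_trans[OF sum_abs], rule sum_mono)
        (simp add: abs_mult mult_mono component_le_norm_cart that)
    have "\<bar>d 3 s\<bar> \<le> (\<Sum>i\<in>UNIV. norm w * (\<Sum>j\<in>UNIV. norm w * (\<Sum>k\<in>UNIV. norm w * c i j k)))"
    proof -
      have "d 3 s = (\<Sum>i\<in>UNIV. w$i * (\<Sum>j\<in>UNIV. w$j * (\<Sum>k\<in>UNIV. w$k * partial k (partial j (partial i \<phi>)) (p + s *\<^sub>R w))))"
        by (simp add: d_def)
      then show ?thesis by (simp only:) (intro weighted c)
    qed
    also have "\<dots> = L * norm w ^ 3"
      by (simp add: L_def sum_distrib_left sum_distrib_right power3_eq_cube mult_ac)
    finally have "\<bar>d 3 s\<bar> \<le> L * norm w ^ 3" .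
    moreover have "\<phi> (p + w) - \<phi> p - (\<Sum>i\<in>UNIV. w$i * partial i \<phi> p)
     - (\<Sum>i\<in>UNIV. \<Sum>j\<in>UNIV. w$i * w$j * partial j (partial i \<phi>) p) / 2 = d 3 s / 6"
      using s by (simp add: eval_nat_numeral) (simp add: d_def sum_distrib_left mult.assoc)
    ultimately show ?thesis by (simp only: abs_divide)
  qed
  moreover have "L > 0" unfolding L_def using c by (intro sum_pos) auto
  ultimately show ?thesis using that[of "L/6"] by auto
qed

section \<open>Products with smooth functions, constants and coordinates\<close>

lemma C_k_mult: "C_k k \<phi> \<Longrightarrow> C_k k \<psi> \<Longrightarrow> C_k k (\<lambda>x. \<phi> x * \<psi> x)"
proof (induction k arbitrary: \<phi> \<psi>)
  case 0 then show ?case by (auto intro: continuous_intros)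
next
  case (Suc k)
  show ?case
  proof (rule C_k_SucI)
    show "((\<lambda>x. \<phi> x * \<psi> x) has_derivative (\<lambda>h. \<Sum>i\<in>UNIV. h$i * (\<phi> x * partial i \<psi> x + partial i \<phi> x * \<psi> x))) (at x)" for x
      by (rule has_derivative_eq_rhs[OF has_derivative_mult[OF C_k_deriv[OF Suc.prems(1)] C_k_deriv[OF Suc.prems(2)]]])
        (simp add: algebra_simps sum.distrib sum_distrib_left)
    show "C_k k (\<lambda>x. \<phi> x * partial i \<psi> x + partial i \<phi> x * \<psi> x)" for i
    proof -
      have "C_k k (partial i \<phi>)" "C_k k (partial i \<psi>)" using Suc.prems by simp_all
      with C_k_SucD[OF Suc.prems(1)] C_k_SucD[OF Suc.prems(2)] show ?thesis
        by (intro C_k_add Suc.IH)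
    qed
  qed
qed

lemma partial_mult:
  assumes "C_k (Suc k) \<phi>" "C_k (Suc k) \<psi>"
  shows "partial i (\<lambda>x. \<phi> x * \<psi> x) x = \<phi> x * partial i \<psi> x + partial i \<phi> x * \<psi> x"
proof -
  have "((\<lambda>x. \<phi> x * \<psi> x) has_derivative (\<lambda>h. \<Sum>i\<in>UNIV. h$i * (\<phi> x * partial i \<psi> x + partial i \<phi> x * \<psi> x))) (at x)" for x
    by (rule has_derivative_eq_rhs[OF has_derivative_mult[OF C_k_deriv[OF assms(1)] C_k_deriv[OF assms(2)]]])
      (simp add: algebra_simps sum.distrib sum_distrib_left)
  from partial_eqI[of _ "\<lambda>i x. \<phi> x * partial i \<psi> x + partial i \<phi> x * \<psi> x", OF this]
  show ?thesis by simp
qed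

lemma test_function_mult:
  assumes "test_function \<phi>" "\<And>k. C_k k \<psi>"
  shows "test_function (\<lambda>x. \<psi> x * \<phi> x)"
proof -
  obtain R where "\<And>x. norm x > R \<Longrightarrow> \<phi> x = 0" using test_function_support[OF assms(1)] by metis
  then show ?thesis
    by (intro test_functionI[of _ R] C_k_mult assms(2) test_function_C_k[OF assms(1)]) simp
qed

lemma C_k_const: "C_k k (\<lambda>x. c)"
proof (induction k arbitrary: c)
  case (Suc k)
  show ?case by (rule C_k_SucI[where D = "\<lambda>_ _. 0"]) (auto simp: Suc.IH)
qed simp

lemma has_derivative_component: "((\<lambda>x::real^2. x $ j) has_derivative (\<lambda>h. \<Sum>i\<in>UNIV. h$i * (if i = j then 1 else 0))) (at x)"
proof -
  have "((\<lambda>x::real^2. x $ j) has_derivative (\<lambda>h. h $ j)) (at x)"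
    by (rule bounded_linear_imp_has_derivative[OF bounded_linear_vec_nth])
  moreover have "(\<Sum>i\<in>UNIV. h$i * (if i = j then 1 else 0)) = h $ j" for h :: "real^2"
    by (subst sum.cong[OF refl, of _ _ "\<lambda>i. if i = j then h $ i else 0"]) auto
  ultimately show ?thesis by simp
qed

lemma partial_component: "partial i (\<lambda>x. x $ j) = (\<lambda>x. if i = j then 1 else 0)"
  by (rule partial_eqI) (rule has_derivative_component)

lemma C_k_component: "C_k k (\<lambda>x. x $ j)"
proof (cases k)
  case (Suc k)
  then show ?thesis
    by (auto intro!: C_k_SucI[OF has_derivative_component] C_k_const simp del: C_k.simps)
qed (auto intro: continuous_intros)

section \<open>Integration in the plane\<close>

abbreviation disc_area :: "real \<Rightarrow> real" where
  "disc_area r \<equiv> measure lborel (cball (0::real^2) r)"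

lemma measure_cball_eq: "measure lborel (cball (a::real^2) r) = disc_area r"
  by (cases "r \<ge> 0") (simp_all add: content_cball)

lemma integrable_indicator_cball: "integrable lborel (\<lambda>v. c * indicator (cball a r) v :: real)"
  for a :: "real^2"
  using emeasure_lborel_cball_finite[of a r]
  by (intro integrable_mult_right integrable_real_indicator) (auto simp: less_top)

lemma integrable_bounded_support:
  fixes F :: "real^2 \<Rightarrow> real"
  assumes "F \<in> borel_measurable borel" "\<And>v. v \<in> cball a r \<Longrightarrow> \<bar>F v\<bar> \<le> c" "\<And>v. v \<notin> cball a r \<Longrightarrow> F v = 0"
  shows "integrable lborel F"
proof (rule Bochner_Integration.integrable_bound)
  show "integrable lborel (\<lambda>v. c * indicator (cball a r) v)"
    by (rule integrable_indicator_cball)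
  show "AE v in lborel. norm (F v) \<le> norm (c * indicator (cball a r) v :: real)"
  proof (rule AE_I2)
    show "norm (F v) \<le> norm (c * indicator (cball a r) v :: real)" for v
      using assms(2,3)[of v] by (cases "v \<in> cball a r") (simp_all del: mem_cball)
  qed
qed (use assms in simp)

lemma integral_bound_cball:
  fixes F :: "real^2 \<Rightarrow> real"
  assumes "c \<ge> 0" "\<And>v. v \<in> cball a r \<Longrightarrow> \<bar>F v\<bar> \<le> c" "\<And>v. v \<notin> cball a r \<Longrightarrow> F v = 0"
  shows "\<bar>LINT v|lborel. F v\<bar> \<le> c * disc_area r"
proof (cases "integrable lborel F")
  case True
  have "\<bar>LINT v|lborel. F v\<bar> \<le> (LINT v|lborel. \<bar>F v\<bar>)" by (rule integral_abs_bound)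
  also have "\<dots> \<le> (LINT v|lborel. c * indicator (cball a r) v)"
  proof (intro integral_mono integrable_indicator_cball)
    show "\<bar>F v\<bar> \<le> c * indicator (cball a r) v" for v
      using assms(2,3)[of v] by (cases "v \<in> cball a r") (simp_all del: mem_cball)
  qed (use True in simp)
  also have "\<dots> = c * disc_area r" by (simp add: measure_cball_eq[of a])
  finally show ?thesis .
next
  \<comment> \<open>A function that is not integrable has Bochner integral 0 by convention.\<close>
  case False
  then show ?thesis using assms(1) by (simp add: not_integrable_integral_eq)
qed

lemma integral_affine:
  fixes F :: "real^2 \<Rightarrow> real"
  assumes "F \<in> borel_measurable borel" "c \<noteq> 0"
  shows "(LINT v|lborel. F (t + c *\<^sub>R v)) = (LINT v|lborel. F v) / c\<^sup>2"
proof -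
  have "(LINT v|lborel. F v) = (LINT v|density (distr lborel borel (\<lambda>x. t + c *\<^sub>R x)) (\<lambda>_. \<bar>c\<bar> ^ DIM(real^2)). F v)"
    using lborel_affine[OF assms(2), of t] by simp
  also have "\<dots> = \<bar>c\<bar> ^ 2 * (LINT v|lborel. F (t + c *\<^sub>R v))"
    using assms by (simp add: integral_density integral_distr)
  finally show ?thesis using assms by (simp add: field_simps)
qed

section \<open>Rotations of the plane and their action on Lebesgue measure\<close>

lemma rotation_component: "rotation \<theta> x $ 1 = cos \<theta> * x$1 - sin \<theta> * x$2" "rotation \<theta> x $ 2 = sin \<theta> * x$1 + cos \<theta> * x$2"
  by (simp_all add: rotation_def)

lemma rotation_linear: "linear (rotation \<theta>)"
  by (rule linearI) (simp_all add: vec_eq_iff forall_2 rotation_component algebra_simps)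

lemma norm_eq_sqrt_2: "norm (x::real^2) = sqrt ((x$1)\<^sup>2 + (x$2)\<^sup>2)"
  by (simp add: norm_vec_def L2_set_def sum_2)

lemma norm_power2_eq: "(norm (x::real^2))\<^sup>2 = (x$1)\<^sup>2 + (x$2)\<^sup>2"
  by (simp add: norm_eq_sqrt_2)

lemma norm_rotation: "norm (rotation \<theta> x) = norm x"
proof -
  have alg: "(c * a - s * b)\<^sup>2 + (s * a + c * b)\<^sup>2 = (c\<^sup>2 + s\<^sup>2) * (a\<^sup>2 + b\<^sup>2)" for a b c s :: real
    by algebra
  have "(norm (rotation \<theta> x))\<^sup>2 = ((cos \<theta>)\<^sup>2 + (sin \<theta>)\<^sup>2) * ((x$1)\<^sup>2 + (x$2)\<^sup>2)"
    by (simp only: norm_power2_eq rotation_component alg)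
  also have "\<dots> = (norm x)\<^sup>2" by (simp add: norm_power2_eq)
  finally show ?thesis by simp
qed

lemma rotation_rotation_neg: "rotation \<theta> (rotation (-\<theta>) x) = x"
proof -
  have *: "cos \<theta> * cos \<theta> + sin \<theta> * sin \<theta> = 1"
    using sin_cos_squared_add3[of \<theta>] by simp
  have "c * (c * a + s * b) - s * (c * b - s * a) = (c * c + s * s) * a"
    "s * (c * a + s * b) + c * (c * b - s * a) = (c * c + s * s) * b" for a b c s :: real
    by (simp_all add: algebra_simps)
  from this(1)[of "cos \<theta>" _ "sin \<theta>"] this(2)[of "sin \<theta>" "cos \<theta>"] * show ?thesis
    by (simp add: vec_eq_iff forall_2 rotation_component)
qed

text \<open>Lebesgue measure is determined by the volumes of boxes. The preimage of a box is its
  image under the inverse rotation, and orthogonal maps preserve volume.\<close>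

lemma distr_rotation: "distr lborel borel (rotation \<theta>) = (lborel :: (real^2) measure)"
proof (rule lborel_eqI[symmetric])
  fix l u :: "real^2" assume lu: "\<And>b. b \<in> Basis \<Longrightarrow> l \<bullet> b \<le> u \<bullet> b"
  have orth: "orthogonal_transformation (rotation (-\<theta>))"
    by (simp add: orthogonal_transformation rotation_linear norm_rotation)
  have meas: "rotation \<theta> \<in> borel_measurable borel"
    by (intro borel_measurable_continuous_onI linear_continuous_on linear_conv_bounded_linear[THEN iffD1] rotation_linear)
  have eq: "rotation \<theta> -` box l u = rotation (-\<theta>) ` box l u"
    using rotation_rotation_neg[of \<theta>] rotation_rotation_neg[of "-\<theta>"] by (auto simp: image_iff) metis
  have ms: "rotation \<theta> -` box l u \<in> sets borel"
    using measurable_sets[OF meas, of "box l u"] by simp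
  have lm: "rotation (-\<theta>) ` box l u \<in> lmeasurable"
    by (rule measurable_orthogonal_image[OF orth]) simp
  have "emeasure (distr lborel borel (rotation \<theta>)) (box l u) = emeasure lborel (rotation \<theta> -` box l u)"
    using meas by (subst emeasure_distr) auto
  also have "\<dots> = emeasure lebesgue (rotation \<theta> -` box l u)"
    using ms by simp
  also have "\<dots> = ennreal (measure lebesgue (rotation (-\<theta>) ` box l u))"
    using lm by (simp add: eq emeasure_eq_measure2)
  also have "\<dots> = ennreal (measure lebesgue (box l u))"
    using measure_orthogonal_image[OF orth, of "box l u"] by simp
  also have "\<dots> = emeasure lborel (box l u)"
    using emeasure_lborel_box_finite[of l u] by (simp add: emeasure_eq_ennreal_measure less_top[symmetric])
  also have "\<dots> = ennreal (\<Prod>b\<in>Basis. (u - l) \<bullet> b)"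
    using lu by (rule emeasure_lborel_box)
  finally show "emeasure (distr lborel borel (rotation \<theta>)) (box l u) = ennreal (\<Prod>b\<in>Basis. (u - l) \<bullet> b)" .
qed simp

lemma integral_rotation:
  fixes F :: "real^2 \<Rightarrow> real"
  assumes "F \<in> borel_measurable borel"
  shows "(LINT v|lborel. F (rotation \<theta> v)) = (LINT v|lborel. F v)"
proof -
  have meas: "rotation \<theta> \<in> borel_measurable borel"
    by (intro borel_measurable_continuous_onI linear_continuous_on linear_conv_bounded_linear[THEN iffD1] rotation_linear)
  have "(LINT v|lborel. F v) = (LINT v|distr lborel borel (rotation \<theta>). F v)"
    by (simp add: distr_rotation)
  also have "\<dots> = (LINT v|lborel. F (rotation \<theta> v))"
    using assms meas by (intro integral_distr) auto
  finally show ?thesis by simp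
qed

text \<open>By translation invariance the difference quotients of a test function have integral zero.\<close>

lemma integral_partial_test_function:
  assumes "test_function \<phi>"
  shows "(LINT x|lborel. partial i \<phi> x) = 0"
proof -
  obtain R where R: "R > 0" "\<And>x. norm x > R \<Longrightarrow> \<phi> x = 0" using test_function_support[OF assms] by metis
  obtain L where L: "L > 0" "\<And>x y. \<bar>\<phi> x - \<phi> y\<bar> \<le> L * norm (x - y)" using test_function_Lipschitz[OF assms] by metis
  define h where "h n = 1 / real (Suc n)" for n
  have h: "0 < h n" "h n \<le> 1" for n by (auto simp: h_def)
  define D where "D n x = (\<phi> (x + h n *\<^sub>R axis i 1) - \<phi> x) / h n" for n x
  have meas: "\<phi> \<in> borel_measurable borel" "partial i \<phi> \<in> borel_measurable borel"
    using test_function_continuous[OF assms] test_function_continuous[OF test_function_partial[OF assms]]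
    by (auto intro: borel_measurable_continuous_onI)
  have shift: "(\<lambda>x. \<phi> (x + b)) \<in> borel_measurable borel" for b
    using test_function_continuous[OF test_function_affine[OF assms, of 1 b]]
    by (auto intro: borel_measurable_continuous_onI)
  obtain c where c: "\<And>x. \<bar>\<phi> x\<bar> \<le> c" using test_function_bounded[OF assms] by metis
  have int: "integrable lborel (\<lambda>x. \<phi> (x + b))" for b
  proof (rule integrable_bounded_support[of _ "-b" R])
    fix v assume "v \<notin> cball (- b) R"
    then show "\<phi> (v + b) = 0" by (intro R) (simp add: dist_norm norm_minus_commute add.commute)
  qed (use shift c in auto)
  have zero: "(LINT x|lborel. D n x) = 0" for n
  proof -
    have "(LINT x|lborel. D n x) = ((LINT x|lborel. \<phi> (x + h n *\<^sub>R axis i 1)) - (LINT x|lborel. \<phi> x)) / h n"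
      unfolding D_def using int[of "h n *\<^sub>R axis i 1"] int[of 0] by simp
    also have "(LINT x|lborel. \<phi> (x + h n *\<^sub>R axis i 1)) = (LINT x|lborel. \<phi> x)"
      using integral_affine[OF meas(1), of 1 "h n *\<^sub>R axis i 1"] by (simp add: add.commute)
    finally show ?thesis by simp
  qed
  \<comment> \<open>Dominated convergence: the Lipschitz constant bounds all quotients, and since
    the steps \<open>h n\<close> are at most 1 they vanish outside the ball of radius
    \<open>R + 1\<close>.\<close>
  have "(\<lambda>n. LINT x|lborel. D n x) \<longlonglongrightarrow> (LINT x|lborel. partial i \<phi> x)"
  proof (rule integral_dominated_convergence[where w = "\<lambda>x. L * indicator (cball 0 (R + 1)) x"])
    show "AE x in lborel. (\<lambda>n. D n x) \<longlonglongrightarrow> partial i \<phi> x"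
    proof (rule AE_I2)
      fix x :: "real^2"
      have "((\<lambda>s. x + s *\<^sub>R axis i 1) has_derivative (\<lambda>s. s *\<^sub>R axis i 1)) (at 0)"
        by (auto intro!: derivative_eq_intros)
      from has_derivative_compose[OF this test_function_deriv[OF assms]]
      have "((\<lambda>s. \<phi> (x + s *\<^sub>R axis i 1)) has_derivative (\<lambda>s. \<Sum>j\<in>UNIV. (s *\<^sub>R axis i 1) $ j * partial j \<phi> x)) (at 0)"
        by simp
      moreover have "(\<lambda>s. \<Sum>j\<in>UNIV. (s *\<^sub>R axis i 1) $ j * partial j \<phi> x) = (\<lambda>s. partial i \<phi> x * s)"
      proof
        fix s
        have "(\<Sum>j\<in>UNIV. (s *\<^sub>R axis i 1) $ j * partial j \<phi> x) = (\<Sum>j\<in>UNIV. if j = i then s * partial j \<phi> x else 0)"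
          by (rule sum.cong) (auto simp: axis_def)
        then show "(\<Sum>j\<in>UNIV. (s *\<^sub>R axis i 1) $ j * partial j \<phi> x) = partial i \<phi> x * s" by simp
      qed
      ultimately have "((\<lambda>s. \<phi> (x + s *\<^sub>R axis i 1)) has_field_derivative partial i \<phi> x) (at 0)"
        by (simp add: has_field_derivative_def)
      then have "((\<lambda>s. (\<phi> (x + s *\<^sub>R axis i 1) - \<phi> x) / s) \<longlongrightarrow> partial i \<phi> x) (at 0)"
        by (simp add: DERIV_def)
      moreover have "filterlim h (at 0) sequentially"
        unfolding filterlim_at
      proof
        show "eventually (\<lambda>n. h n \<in> UNIV \<and> h n \<noteq> 0) sequentially"
          by (simp add: h_def)
        show "h \<longlonglongrightarrow> 0"
          unfolding h_def using LIMSEQ_inverse_real_of_nat by (simp add: inverse_eq_divide)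
      qed
      ultimately show "(\<lambda>n. D n x) \<longlonglongrightarrow> partial i \<phi> x"
        unfolding D_def by (rule filterlim_compose)
    qed
    show "AE x in lborel. norm (D n x) \<le> L * indicator (cball 0 (R + 1)) x" for n
    proof (rule AE_I2)
      fix x :: "real^2"
      have ne: "norm (h n *\<^sub>R (axis i 1::real^2)) = h n" using h[of n] by (simp add: norm_axis_1)
      show "norm (D n x) \<le> L * indicator (cball 0 (R + 1)) x"
      proof (cases "norm x \<le> R + 1")
        case True
        have "\<bar>\<phi> (x + h n *\<^sub>R axis i 1) - \<phi> x\<bar> \<le> L * h n"
          using L(2)[of "x + h n *\<^sub>R axis i 1" x] ne by simp
        then show ?thesis using True h[of n] by (simp add: D_def indicator_def dist_norm field_simps)
      next
        case False
        have "norm x \<le> norm (x + h n *\<^sub>R axis i 1) + h n"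
          using ne by (metis add_diff_cancel_right' norm_triangle_ineq4)
        then have "\<phi> (x + h n *\<^sub>R axis i 1) = 0" "\<phi> x = 0" using False h[of n] by (auto intro!: R)
        then show ?thesis using False by (simp add: D_def indicator_def dist_norm)
      qed
    qed
    show "D n \<in> borel_measurable lborel" for n
      unfolding D_def[abs_def] using shift meas by simp
  qed (use meas integrable_indicator_cball[of L 0 "R + 1"] in simp_all)
  then show ?thesis using zero by (simp add: LIMSEQ_const_iff)
qed

lemma test_function_integrable:
  assumes "test_function \<phi>"
  shows "integrable lborel \<phi>"
proof -
  obtain R where R: "\<And>x. norm x > R \<Longrightarrow> \<phi> x = 0" using test_function_support[OF assms] by metis
  obtain c where "\<And>x. \<bar>\<phi> x\<bar> \<le> c" using test_function_bounded[OF assms] by metis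
  with R show ?thesis
    by (intro integrable_bounded_support[of _ 0 R c] borel_measurable_continuous_onI test_function_continuous assms)
      (auto simp: dist_norm)
qed

text \<open>The product is a test function, so its derivative integrates to zero. The other factor
  only has to be smooth, which admits coordinates and the squared norm.\<close>

lemma integral_by_parts_test_function:
  assumes "test_function \<phi>" "\<And>k. C_k k \<psi>"
  shows "(LINT x|lborel. \<psi> x * partial i \<phi> x) = - (LINT x|lborel. partial i \<psi> x * \<phi> x)"
proof -
  have p: "partial i (\<lambda>x. \<psi> x * \<phi> x) x = \<psi> x * partial i \<phi> x + partial i \<psi> x * \<phi> x" for x
    using partial_mult assms(2) test_function_C_k[OF assms(1)] by blast
  have "C_k k (partial i \<psi>)" for k using assms(2)[of "Suc k"] by simp
  then have "integrable lborel (\<lambda>x. \<psi> x * partial i \<phi> x)" "integrable lborel (\<lambda>x. partial i \<psi> x * \<phi> x)"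
    using assms by (auto intro!: test_function_integrable test_function_mult test_function_partial)
  moreover have "(LINT x|lborel. \<psi> x * partial i \<phi> x + partial i \<psi> x * \<phi> x) = 0"
    using integral_partial_test_function[OF test_function_mult[OF assms], of i] p by simp
  ultimately show ?thesis by simp
qed

section \<open>Averages at a given scale\<close>

lemma test_function_add: "test_function \<phi> \<Longrightarrow> test_function \<psi> \<Longrightarrow> test_function (\<lambda>x. \<phi> x + \<psi> x)"
proof -
  assume \<phi>: "test_function \<phi>" and \<psi>: "test_function \<psi>"
  obtain R where R: "\<And>x. norm x > R \<Longrightarrow> \<phi> x = 0" using test_function_support[OF \<phi>] by metis
  obtain S where S: "\<And>x. norm x > S \<Longrightarrow> \<psi> x = 0" using test_function_support[OF \<psi>] by metis
  show ?thesis
    by (rule test_functionI[of _ "max R S"]) (simp_all add: C_k_add test_function_C_k \<phi> \<psi> R S)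
qed

lemma test_function_cmult: "test_function \<phi> \<Longrightarrow> test_function (\<lambda>x. c * \<phi> x)"
  using test_function_mult[of \<phi> "\<lambda>_. c"] C_k_const by blast

lemma test_function_measurable: "test_function \<phi> \<Longrightarrow> \<phi> \<in> borel_measurable borel"
  by (intro borel_measurable_continuous_onI test_function_continuous)

text \<open>A common home for f, which may be discontinuous at the origin, and for continuous
  functions of quadratic growth. The lemmas on averages thus serve both existence and
  uniqueness.\<close>

definition locally_bounded :: "(real^2 \<Rightarrow> real) \<Rightarrow> bool" where
  "locally_bounded F \<longleftrightarrow> F \<in> borel_measurable borel \<and> (\<forall>r. \<exists>c. \<forall>x. norm x \<le> r \<longrightarrow> \<bar>F x\<bar> \<le> c)"

lemma locally_bounded_measurable: "locally_bounded F \<Longrightarrow> F \<in> borel_measurable borel"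
  by (simp add: locally_bounded_def)

lemma locally_boundedE:
  assumes "locally_bounded F"
  obtains c where "c > 0" "\<And>x. norm x \<le> r \<Longrightarrow> \<bar>F x\<bar> \<le> c"
proof -
  obtain c where "\<And>x. norm x \<le> r \<Longrightarrow> \<bar>F x\<bar> \<le> c" using assms unfolding locally_bounded_def by metis
  then show ?thesis by (intro that[of "max c 1"]) (auto simp: le_max_iff_disj)
qed

lemma continuous_locally_bounded:
  assumes "continuous_on UNIV F"
  shows "locally_bounded F"
  unfolding locally_bounded_def
proof (intro conjI allI)
  fix r
  have "compact (F ` cball 0 r)"
    by (intro compact_continuous_image continuous_on_subset[OF assms]) auto
  then have "bounded (F ` cball 0 r)" by (rule compact_imp_bounded)
  then obtain c where "\<forall>y\<in>F ` cball 0 r. norm y \<le> c" by (auto simp: bounded_iff)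
  then show "\<exists>c. \<forall>x. norm x \<le> r \<longrightarrow> \<bar>F x\<bar> \<le> c" by (intro exI[of _ c]) simp
qed (rule borel_measurable_continuous_onI[OF assms])

lemma locally_bounded_affine:
  assumes "locally_bounded F"
  shows "locally_bounded (\<lambda>v. F (b + c *\<^sub>R v))"
  unfolding locally_bounded_def
proof (intro conjI allI)
  fix r
  obtain C where C: "\<And>x. norm x \<le> norm b + \<bar>c\<bar> * r \<Longrightarrow> \<bar>F x\<bar> \<le> C"
    using locally_boundedE[OF assms] by metis
  have "\<bar>F (b + c *\<^sub>R x)\<bar> \<le> C" if "norm x \<le> r" for x
  proof (rule C)
    have "norm (b + c *\<^sub>R x) \<le> norm b + norm (c *\<^sub>R x)" by (rule norm_triangle_ineq)
    also have "\<dots> \<le> norm b + \<bar>c\<bar> * r" using that by (simp add: mult_left_mono)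
    finally show "norm (b + c *\<^sub>R x) \<le> norm b + \<bar>c\<bar> * r" .
  qed
  then show "\<exists>C. \<forall>x. norm x \<le> r \<longrightarrow> \<bar>F (b + c *\<^sub>R x)\<bar> \<le> C" by blast
qed (use locally_bounded_measurable[OF assms] in measurable)

lemma integrable_locally_bounded_test:
  assumes "locally_bounded F" "test_function K"
  shows "integrable lborel (\<lambda>v. F v * K v)"
proof -
  obtain R where R: "\<And>x. norm x > R \<Longrightarrow> K x = 0" using test_function_support[OF assms(2)] by metis
  obtain c where c: "c > 0" "\<And>x. \<bar>K x\<bar> \<le> c" using test_function_bounded[OF assms(2)] by metis
  obtain d where d: "d > 0" "\<And>x. norm x \<le> R \<Longrightarrow> \<bar>F x\<bar> \<le> d" using locally_boundedE[OF assms(1)] by metis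
  show ?thesis
  proof (rule integrable_bounded_support[of _ 0 R "d * c"])
    show "\<bar>F v * K v\<bar> \<le> d * c" if "v \<in> cball 0 R" for v
      using that c d by (auto simp: abs_mult dist_norm intro!: mult_mono)
  qed (use R locally_bounded_measurable[OF assms(1)] test_function_measurable[OF assms(2)] in \<open>auto simp: dist_norm\<close>)
qed

text \<open>This is \<open>\<integral> F (x - l z) K z dz\<close> after substituting \<open>v = x/l - z\<close>, so that only the kernel depends on \<open>x\<close>.\<close>

definition average :: "(real^2 \<Rightarrow> real) \<Rightarrow> (real^2 \<Rightarrow> real) \<Rightarrow> real \<Rightarrow> real^2 \<Rightarrow> real" where
  "average F K l x = (LINT v|lborel. F (l *\<^sub>R v) * K ((1/l) *\<^sub>R x - v))"

lemma test_function_reflect: "test_function K \<Longrightarrow> test_function (\<lambda>v. K (a - v))"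
  using test_function_affine[of K "-1" a] by simp

lemma average_integrable:
  assumes "locally_bounded F" "test_function K"
  shows "integrable lborel (\<lambda>v. F (l *\<^sub>R v) * K (a - v))"
  using integrable_locally_bounded_test[OF locally_bounded_affine[OF assms(1), of 0 l] test_function_reflect[OF assms(2), of a]]
  by simp

lemma average_alt:
  assumes "locally_bounded F" "test_function K" "l > 0"
  shows "average F K l x = (LINT z|lborel. F (x - l *\<^sub>R z) * K z)"
proof -
  let ?G = "\<lambda>v. F (l *\<^sub>R v) * K ((1/l) *\<^sub>R x - v)"
  have "?G \<in> borel_measurable borel"
    using average_integrable[OF assms(1,2), of l "(1/l) *\<^sub>R x"] by auto
  from integral_affine[OF this, of "-1" "(1/l) *\<^sub>R x"]
  have "average F K l x = (LINT v|lborel. ?G ((1/l) *\<^sub>R x + (-1) *\<^sub>R v))"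
    by (simp add: average_def)
  also have "\<dots> = (LINT z|lborel. F (x - l *\<^sub>R z) * K z)"
    using assms(3) by (simp add: algebra_simps)
  finally show ?thesis .
qed

text \<open>The factor 1/4 is the Jacobian of z -> z/2 in the plane: doubling the width of the
  kernel at fixed mass is the same as doubling the scale.\<close>

lemma average_dilate:
  assumes "locally_bounded F" "test_function K" "l > 0"
  shows "average F (\<lambda>z. K ((1/2) *\<^sub>R z) / 4) l x = average F K (2 * l) x"
proof -
  have t: "test_function (\<lambda>z. K ((1/2) *\<^sub>R z) / 4)"
    using test_function_cmult[OF test_function_affine[OF assms(2), of "1/2" 0], of "1/4"] by simp
  have "(\<lambda>z. F (x - l *\<^sub>R z) * (K ((1/2) *\<^sub>R z) / 4)) \<in> borel_measurable borel"
    using integrable_locally_bounded_test[OF locally_bounded_affine[OF assms(1), of x "-l"] t] by auto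
  from integral_affine[OF this, of 2 0] show ?thesis
    using assms by (simp add: average_alt t mult.commute)
qed

lemma average_add:
  assumes "locally_bounded F" "test_function K" "test_function J"
  shows "average F (\<lambda>z. K z + J z) l x = average F K l x + average F J l x"
  unfolding average_def using average_integrable[OF assms(1,2)] average_integrable[OF assms(1,3)]
  by (simp add: distrib_left)

lemma average_cmult: "average F (\<lambda>z. c * K z) l x = c * average F K l x"
proof -
  have "(\<lambda>v. F (l *\<^sub>R v) * (c * K ((1 / l) *\<^sub>R x - v))) = (\<lambda>v. c * (F (l *\<^sub>R v) * K ((1 / l) *\<^sub>R x - v)))"
    by (auto simp: algebra_simps)
  then show ?thesis by (simp add: average_def)
qed

lemma average_const:
  assumes "test_function K" "l > 0"
  shows "average (\<lambda>_. c) K l x = c * (LINT z|lborel. K z)"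
  using average_alt[of "\<lambda>_. c" K l x] assms by (simp add: continuous_locally_bounded)

text \<open>With c = F x this exposes the oscillation of F around x, on which the Hoelder bound
  acts. For kernels of mean zero the correction disappears.\<close>

lemma average_shift:
  assumes "locally_bounded F" "test_function K" "l > 0"
  shows "average (\<lambda>v. F v - c) K l x = average F K l x - c * (LINT z|lborel. K z)"
proof -
  have "average (\<lambda>v. F v - c) K l x = average F K l x - average (\<lambda>_. c) K l x"
    unfolding average_def using average_integrable[OF assms(1,2), of l "(1/l) *\<^sub>R x"]
      average_integrable[OF continuous_locally_bounded assms(2), of "\<lambda>_. c" l "(1/l) *\<^sub>R x"]
    by (simp add: left_diff_distrib)
  with average_const[OF assms(2,3)] show ?thesis by simp
qed

text \<open>Both bounds see F only on the ball of radius \<open>R * l\<close> about x, so they can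
  be applied to F minus a constant that depends on x. In \<open>average\<close> the point enters
  only through the kernel at x/l, so the Lipschitz constant of K yields the factor |x - y| / l
  without any regularity of F.\<close>

lemma average_bounds:
  assumes "test_function K"
  obtains C R where "C > 0" "R > 0"
    "\<And>F c l x. \<lbrakk>l > 0; c \<ge> 0; \<And>w. norm (w - x) \<le> R * l \<Longrightarrow> \<bar>F w\<bar> \<le> c\<rbrakk> \<Longrightarrow> \<bar>average F K l x\<bar> \<le> C * c"
    "\<And>F c l x y. \<lbrakk>locally_bounded F; l > 0; c \<ge> 0; norm (x - y) \<le> l; \<And>w. norm (w - x) \<le> R * l \<Longrightarrow> \<bar>F w\<bar> \<le> c\<rbrakk>
      \<Longrightarrow> \<bar>average F K l x - average F K l y\<bar> \<le> C * c * (norm (x - y) / l)"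
proof -
  obtain R where R: "R > 0" "\<And>x. norm x > R \<Longrightarrow> K x = 0" using test_function_support[OF assms] by metis
  obtain b where b: "b > 0" "\<And>x. \<bar>K x\<bar> \<le> b" using test_function_bounded[OF assms] by metis
  obtain L where L: "L > 0" "\<And>x y. \<bar>K x - K y\<bar> \<le> L * norm (x - y)" using test_function_Lipschitz[OF assms] by metis
  \<comment> \<open>The summand 1 makes the constant positive whatever the area is.\<close>
  define C where "C = (b + L) * disc_area (R + 1) + 1"
  have C: "b * disc_area (R + 1) \<le> C" "L * disc_area (R + 1) \<le> C" "C > 0"
  proof -
    have "b * disc_area (R + 1) \<ge> 0" "L * disc_area (R + 1) \<ge> 0" using b L by simp_all
    then show "b * disc_area (R + 1) \<le> C" "L * disc_area (R + 1) \<le> C" "C > 0"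
      by (simp_all add: C_def distrib_right)
  qed
  show ?thesis
  \<comment> \<open>As |x - y| is at most l, the points x/l and y/l are at distance at most 1.
    Radius \<open>R + 1\<close> around x/l therefore covers the supports of both translated
    kernels.\<close>
  proof (rule that[of C "R + 1"])
    fix F :: "real^2 \<Rightarrow> real" and c l :: real and x y :: "real^2"
    assume l: "l > 0" and c: "c \<ge> 0" and F: "\<And>w. norm (w - x) \<le> (R + 1) * l \<Longrightarrow> \<bar>F w\<bar> \<le> c"
    have Fb: "\<bar>F (l *\<^sub>R v)\<bar> \<le> c" if "v \<in> cball ((1/l) *\<^sub>R x) (R + 1)" for v
    proof (rule F)
      have "norm (l *\<^sub>R v - x) = l * norm ((1/l) *\<^sub>R x - v)"
      proof -
        have "x - l *\<^sub>R v = l *\<^sub>R ((1/l) *\<^sub>R x - v)" using l by (simp add: algebra_simps)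
        then show ?thesis using l by (simp add: norm_minus_commute)
      qed
      also have "\<dots> \<le> (R + 1) * l" using that l by (simp add: dist_norm)
      finally show "norm (l *\<^sub>R v - x) \<le> (R + 1) * l" .
    qed
    have K0: "K ((1/l) *\<^sub>R x - v) = 0" if "v \<notin> cball ((1/l) *\<^sub>R x) (R + 1)" for v
      using that by (intro R(2)) (simp add: dist_norm)
    have "\<bar>average F K l x\<bar> \<le> (c * b) * disc_area (R + 1)"
      unfolding average_def
    proof (rule integral_bound_cball[where a = "(1/l) *\<^sub>R x"])
      show "\<bar>F (l *\<^sub>R v) * K ((1/l) *\<^sub>R x - v)\<bar> \<le> c * b" if "v \<in> cball ((1/l) *\<^sub>R x) (R + 1)" for v
        unfolding abs_mult by (rule mult_mono[OF Fb[OF that] b(2) c]) simp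
    qed (use c b K0 in simp_all)
    also have "\<dots> \<le> C * c" using mult_left_mono[OF C(1) c] by (simp add: mult_ac)
    finally show "\<bar>average F K l x\<bar> \<le> C * c" .
    assume lb: "locally_bounded F" and xy: "norm (x - y) \<le> l"
    have d: "norm ((1/l) *\<^sub>R x - (1/l) *\<^sub>R y) = norm (x - y) / l"
      using l by (simp flip: scaleR_diff_right)
    have K0': "K ((1/l) *\<^sub>R y - v) = 0" if "v \<notin> cball ((1/l) *\<^sub>R x) (R + 1)" for v
    proof (rule R(2))
      have "norm ((1/l) *\<^sub>R x - v) \<le> norm ((1/l) *\<^sub>R x - (1/l) *\<^sub>R y) + norm ((1/l) *\<^sub>R y - v)"
        using norm_triangle_ineq[of "(1/l) *\<^sub>R x - (1/l) *\<^sub>R y" "(1/l) *\<^sub>R y - v"] by simp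
      moreover have "norm (x - y) / l \<le> 1" using xy l by simp
      ultimately show "norm ((1/l) *\<^sub>R y - v) > R" using that d by (simp add: dist_norm)
    qed
    have "average F K l x - average F K l y =
      (LINT v|lborel. F (l *\<^sub>R v) * (K ((1/l) *\<^sub>R x - v) - K ((1/l) *\<^sub>R y - v)))"
      unfolding average_def using average_integrable[OF lb assms] by (simp add: right_diff_distrib)
    also have "\<bar>\<dots>\<bar> \<le> (c * (L * (norm (x - y) / l))) * disc_area (R + 1)"
    proof (rule integral_bound_cball[where a = "(1/l) *\<^sub>R x"])
      show "\<bar>F (l *\<^sub>R v) * (K ((1/l) *\<^sub>R x - v) - K ((1/l) *\<^sub>R y - v))\<bar> \<le> c * (L * (norm (x - y) / l))"
        if "v \<in> cball ((1/l) *\<^sub>R x) (R + 1)" for v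
        unfolding abs_mult using L(2)[of "(1/l) *\<^sub>R x - v" "(1/l) *\<^sub>R y - v"] d
        by (intro mult_mono[OF Fb[OF that] _ c]) simp_all
      show "c * (L * (norm (x - y) / l)) \<ge> 0" using c L l by simp
    qed (use K0 K0' in simp)
    also have "\<dots> = (L * disc_area (R + 1)) * (c * (norm (x - y) / l))" by (simp add: mult_ac)
    also have "\<dots> \<le> C * (c * (norm (x - y) / l))"
      using c l by (intro mult_right_mono C) simp
    finally show "\<bar>average F K l x - average F K l y\<bar> \<le> C * c * (norm (x - y) / l)" by (simp add: mult.assoc)
  qed (use C R in auto)
qed

lemma average_continuous:
  assumes "locally_bounded F" "test_function K" "l > 0"
  shows "continuous_on UNIV (average F K l)"
proof (rule continuous_at_imp_continuous_on, rule ballI)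
  fix x :: "real^2"
  obtain C R where CR: "C > 0" "R > 0"
    and D: "\<And>F c l x y. \<lbrakk>locally_bounded F; l > 0; c \<ge> 0; norm (x - y) \<le> l; \<And>w. norm (w - x) \<le> R * l \<Longrightarrow> \<bar>F w\<bar> \<le> c\<rbrakk>
      \<Longrightarrow> \<bar>average F K l x - average F K l y\<bar> \<le> C * c * (norm (x - y) / l)"
    using average_bounds[OF assms(2)] by metis
  obtain c where c: "c > 0" "\<And>w. norm w \<le> norm x + R * l \<Longrightarrow> \<bar>F w\<bar> \<le> c"
    using locally_boundedE[OF assms(1)] by metis
  have F: "\<bar>F w\<bar> \<le> c" if "norm (w - x) \<le> R * l" for w
    using that norm_triangle_ineq2[of w x] by (intro c) simp
  have "(average F K l \<longlongrightarrow> average F K l x) (at x)"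
  proof (rule Lim_transform_bound[where g = "\<lambda>y. C * c * (norm (x - y) / l)" and f = "\<lambda>y. average F K l y - average F K l x", THEN LIM_zero_cancel])
    have "\<forall>\<^sub>F y in at x. dist y x < l"
      using assms(3) by (simp add: eventually_at) (metis)
    then show "\<forall>\<^sub>F y in at x. norm (average F K l y - average F K l x) \<le> norm (C * c * (norm (x - y) / l))"
    proof (rule eventually_mono)
      fix y assume "dist y x < l"
      then have "\<bar>average F K l x - average F K l y\<bar> \<le> C * c * (norm (x - y) / l)"
        using assms c F by (intro D) (auto simp: dist_norm norm_minus_commute)
      then show "norm (average F K l y - average F K l x) \<le> norm (C * c * (norm (x - y) / l))"
        by (metis abs_ge_self abs_minus_commute order_trans real_norm_def)
    qed
    show "((\<lambda>y. C * c * (norm (x - y) / l)) \<longlongrightarrow> 0) (at x)"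
    proof -
      have "((\<lambda>y. C * c * (norm (x - y) / l)) \<longlongrightarrow> C * c * (norm (x - x) / l)) (at x)"
        by (intro tendsto_intros) (use assms(3) in simp)
      then show ?thesis by simp
    qed
  qed
  then show "isCont (average F K l) x" by (simp add: isCont_def)
qed

text \<open>Fubini puts the x-integral on the kernel alone, so that integration by parts never meets
  F.\<close>

lemma integral_average_swap:
  assumes "locally_bounded F" "test_function K" "test_function \<psi>" "l > 0"
  shows "(LINT x|lborel. average F K l x * \<psi> x) =
    (LINT v|lborel. F (l *\<^sub>R v) * (LINT x|lborel. K ((1/l) *\<^sub>R x - v) * \<psi> x))"
proof -
  interpret lborel_pair: pair_sigma_finite "lborel :: (real^2) measure" "lborel :: (real^2) measure" ..
  obtain R where R: "R > 0" "\<And>x. norm x > R \<Longrightarrow> K x = 0" using test_function_support[OF assms(2)] by metis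
  obtain b where b: "b > 0" "\<And>x. \<bar>K x\<bar> \<le> b" using test_function_bounded[OF assms(2)] by metis
  obtain S where S: "S > 0" "\<And>x. norm x > S \<Longrightarrow> \<psi> x = 0" using test_function_support[OF assms(3)] by metis
  obtain d where d: "d > 0" "\<And>x. \<bar>\<psi> x\<bar> \<le> d" using test_function_bounded[OF assms(3)] by metis
  \<comment> \<open>If |x| is at most \<open>S\<close> and K does not vanish at x/l - v, then |v| is
    at most \<open>T\<close>. The double integrand therefore has bounded support.\<close>
  define T where "T = S / l + R"
  obtain c where c: "c > 0" "\<And>w. norm w \<le> l * T \<Longrightarrow> \<bar>F w\<bar> \<le> c"
    using locally_boundedE[OF assms(1)] by metis
  let ?G = "\<lambda>x v. F (l *\<^sub>R v) * K ((1/l) *\<^sub>R x - v) * \<psi> x"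
  have [measurable]: "F \<in> borel_measurable borel" "K \<in> borel_measurable borel" "\<psi> \<in> borel_measurable borel"
    using assms by (auto intro: locally_bounded_measurable test_function_measurable)
  have "integrable (lborel \<Otimes>\<^sub>M lborel) (\<lambda>p. case_prod ?G p)"
  proof (rule Bochner_Integration.integrable_bound)
    have "emeasure (lborel \<Otimes>\<^sub>M lborel) (cball (0::real^2) S \<times> cball (0::real^2) T) < \<infinity>"
      using emeasure_lborel_cball_finite[of "0::real^2" S] emeasure_lborel_cball_finite[of "0::real^2" T]
      by (simp add: lborel.emeasure_pair_measure_Times ennreal_mult_less_top less_top)
    then show "integrable (lborel \<Otimes>\<^sub>M lborel) (\<lambda>p. c * b * d * indicator (cball (0::real^2) S \<times> cball (0::real^2) T) p)"
      by (intro integrable_mult_right integrable_real_indicator) auto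
    show "AE p in lborel \<Otimes>\<^sub>M lborel. norm (case_prod ?G p) \<le> norm (c * b * d * indicator (cball (0::real^2) S \<times> cball (0::real^2) T) p :: real)"
    proof (rule AE_I2, clarify)
      fix x v :: "real^2"
      show "norm (?G x v) \<le> norm (c * b * d * indicator (cball (0::real^2) S \<times> cball (0::real^2) T) (x, v) :: real)"
      proof (cases "norm x > S \<or> norm v > T")
        case False
        then have "\<bar>F (l *\<^sub>R v)\<bar> \<le> c" using assms(4) by (intro c) simp
        then have "\<bar>F (l *\<^sub>R v)\<bar> * \<bar>K ((1/l) *\<^sub>R x - v)\<bar> * \<bar>\<psi> x\<bar> \<le> c * b * d"
          using b c d by (intro mult_mono) auto
        with False show ?thesis using b c d by (simp add: abs_mult)
      next
        case True
        have "?G x v = 0"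
        proof (cases "norm x > S")
          case False
          with True have *: "norm v > T" by simp
          have "norm v \<le> norm ((1/l) *\<^sub>R x) + norm ((1/l) *\<^sub>R x - v)"
            using norm_triangle_ineq4[of "(1/l) *\<^sub>R x" "(1/l) *\<^sub>R x - v"] by simp
          moreover have "norm ((1/l) *\<^sub>R x) \<le> S / l" using False assms(4) by (simp add: divide_right_mono)
          ultimately have "K ((1/l) *\<^sub>R x - v) = 0" using * by (intro R) (simp add: T_def)
          then show ?thesis by simp
        qed (simp add: S)
        then show ?thesis by (simp only: norm_zero norm_ge_zero)
      qed
    qed
  qed measurable
  from lborel_pair.Fubini_integral[OF this]
  have "(LINT v|lborel. LINT x|lborel. ?G x v) = (LINT x|lborel. LINT v|lborel. ?G x v)" .
  moreover have "(LINT x|lborel. LINT v|lborel. ?G x v) = (LINT x|lborel. average F K l x * \<psi> x)"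
    by (simp add: average_def)
  moreover have "(LINT v|lborel. LINT x|lborel. ?G x v) =
    (LINT v|lborel. F (l *\<^sub>R v) * (LINT x|lborel. K ((1/l) *\<^sub>R x - v) * \<psi> x))"
    by (simp add: mult.assoc)
  ultimately show ?thesis by simp
qed

text \<open>Weak differentiation of an average: each derivative moves to the kernel at the price of
  a factor 1/l.\<close>

lemma integral_average_partial:
  assumes "locally_bounded F" "test_function K" "test_function \<phi>" "l > 0"
  shows "(LINT x|lborel. average F K l x * partial i \<phi> x) = - (1/l) * (LINT x|lborel. average F (partial i K) l x * \<phi> x)"
proof -
  have "(LINT x|lborel. K ((1/l) *\<^sub>R x - v) * partial i \<phi> x) = - (1/l) * (LINT x|lborel. partial i K ((1/l) *\<^sub>R x - v) * \<phi> x)" for v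
  proof -
    have K: "C_k k (\<lambda>x. K ((1/l) *\<^sub>R x + - v))" for k
      by (intro C_k_affine test_function_C_k assms)
    have p: "partial i (\<lambda>x. K ((1/l) *\<^sub>R x + - v)) = (\<lambda>x. (1/l) * partial i K ((1/l) *\<^sub>R x + - v))"
      by (rule partial_affine[OF test_function_C_k[OF assms(2)]])
    show ?thesis
      using integral_by_parts_test_function[OF assms(3) K, of i] unfolding p by (simp add: mult.assoc)
  qed
  then show ?thesis
    using assms by (simp add: integral_average_swap test_function_partial mult.left_commute)
qed

section \<open>Rotational modes\<close>

lemma rot_symmetric_scale:
  assumes "rot_symmetric m F"
  shows "rot_symmetric m (\<lambda>v. F (l *\<^sub>R v))"
  using assms linear_cmul[OF rotation_linear] unfolding rot_symmetric_def by metis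

text \<open>A nonzero sine keeps both the angle and its double away from full turns. This is where m
  = 2 fails: there the double angle is a full turn.\<close>

lemma rotation_angle:
  assumes "m \<ge> 3"
  shows "sin (2 * pi / real m) \<noteq> 0"
proof -
  have "0 < 2 * pi / real m" "2 * pi / real m < pi"
    using assms by (simp_all add: field_simps)
  then show ?thesis using sin_gt_zero by force
qed

text \<open>The identity minus the matrix with rows (c, -s) and (s, c) has determinant (1 - c)^2 +
  s^2.\<close>

lemma linear_system_trivial:
  fixes a b c s :: real
  assumes "a = c * a - s * b" "b = s * a + c * b" "c \<noteq> 1"
  shows "a = 0" "b = 0"
proof -
  have "((1 - c)\<^sup>2 + s\<^sup>2) * a = 0" "((1 - c)\<^sup>2 + s\<^sup>2) * b = 0"
    using assms by algebra+
  moreover have "(1 - c)\<^sup>2 + s\<^sup>2 > 0"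
    using assms(3) by (intro add_pos_nonneg) auto
  ultimately show "a = 0" "b = 0" by auto
qed

context
  fixes F W :: "real^2 \<Rightarrow> real" and m :: nat
  assumes F: "locally_bounded F" "rot_symmetric m F" and m: "m \<ge> 3"
    and W: "test_function W" "\<And>\<theta> v. W (rotation \<theta> v) = W v"
begin

lemma symmetric_mode_integrable:
  "integrable lborel (\<lambda>v. F v * (v$i * W v))" "integrable lborel (\<lambda>v. F v * (v$i * (v$j * W v)))"
  by (intro integrable_locally_bounded_test test_function_mult C_k_component F W)+

lemma integral_symmetric_rotate:
  assumes "(\<lambda>v. F v * H v) \<in> borel_measurable borel"
  shows "(LINT v|lborel. F v * H v) = (LINT v|lborel. F v * H (rotation (2 * pi / real m) v))"
  using integral_rotation[OF assms, of "2 * pi / real m"] F(2) by (simp add: rot_symmetric_def)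

text \<open>Rotation by \<open>2\<pi>/m\<close> acts on the pair of moments of \<open>(v1, v2)\<close> as the rotation by that angle, and on
  those of \<open>(v1^2 - v2^2, 2 v1 v2)\<close> as the rotation by twice it; for \<open>m \<ge> 3\<close> neither fixes a nonzero vector.\<close>

lemma first_mode_zero: "(LINT v|lborel. F v * (v$i * W v)) = 0"
proof -
  define c s where "c = cos (2 * pi / real m)" and "s = sin (2 * pi / real m)"
  have s: "s \<noteq> 0" using rotation_angle[OF m] by (simp add: s_def)
  moreover have "c * c + s * s = 1" by (simp add: c_def s_def)
  ultimately have c: "c \<noteq> 1" by auto
  define I where "I i = (LINT v|lborel. F v * (v$i * W v))" for i
  note int = symmetric_mode_integrable(1)
  have meas: "(\<lambda>v. F v * (v$i * W v)) \<in> borel_measurable borel" for i using int[of i] by auto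
  have "I 1 = (LINT v|lborel. c * (F v * (v$1 * W v)) - s * (F v * (v$2 * W v)))"
    unfolding I_def integral_symmetric_rotate[OF meas] by (simp add: W rotation_component c_def s_def algebra_simps)
  also have "\<dots> = c * I 1 - s * I 2" unfolding I_def using int by simp
  finally have 1: "I 1 = c * I 1 - s * I 2" .
  have "I 2 = (LINT v|lborel. s * (F v * (v$1 * W v)) + c * (F v * (v$2 * W v)))"
    unfolding I_def integral_symmetric_rotate[OF meas] by (simp add: W rotation_component c_def s_def algebra_simps)
  also have "\<dots> = s * I 1 + c * I 2" unfolding I_def using int by simp
  finally have 2: "I 2 = s * I 1 + c * I 2" .
  have "I 1 = 0" "I 2 = 0" using linear_system_trivial[OF 1 2 c] by auto
  then have "\<forall>i. I i = 0" by (simp add: forall_2)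
  then show ?thesis by (simp add: I_def)
qed

lemma second_mode_zero:
  "(LINT v|lborel. F v * (v$1 * (v$1 * W v))) = (LINT v|lborel. F v * (v$2 * (v$2 * W v)))"
  "(LINT v|lborel. F v * (v$1 * (v$2 * W v))) = 0"
proof -
  define c s where "c = cos (2 * pi / real m)" and "s = sin (2 * pi / real m)"
  have s: "s \<noteq> 0" using rotation_angle[OF m] by (simp add: s_def)
  have "c * c + s * s = 1" by (simp add: c_def s_def)
  moreover have "s * s \<noteq> 0" using s by simp
  ultimately have c: "c * c - s * s \<noteq> 1" by linarith
  define I where "I i j = (LINT v|lborel. F v * (v$i * (v$j * W v)))" for i j
  note int = symmetric_mode_integrable(2)
  have meas: "(\<lambda>v. F v * (v$i * (v$j * W v))) \<in> borel_measurable borel" for i j using int[of i j] by auto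
  have "I 1 1 = (LINT v|lborel. c * c * (F v * (v$1 * (v$1 * W v))) - 2 * c * s * (F v * (v$1 * (v$2 * W v)))
      + s * s * (F v * (v$2 * (v$2 * W v))))"
    unfolding I_def integral_symmetric_rotate[OF meas] by (simp add: W rotation_component c_def s_def algebra_simps)
  also have "\<dots> = c * c * I 1 1 - 2 * c * s * I 1 2 + s * s * I 2 2"
    unfolding I_def using int by simp
  finally have 11: "I 1 1 = c * c * I 1 1 - 2 * c * s * I 1 2 + s * s * I 2 2" .
  have "I 2 2 = (LINT v|lborel. s * s * (F v * (v$1 * (v$1 * W v))) + 2 * c * s * (F v * (v$1 * (v$2 * W v)))
      + c * c * (F v * (v$2 * (v$2 * W v))))"
    unfolding I_def integral_symmetric_rotate[OF meas] by (simp add: W rotation_component c_def s_def algebra_simps)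
  also have "\<dots> = s * s * I 1 1 + 2 * c * s * I 1 2 + c * c * I 2 2"
    unfolding I_def using int by simp
  finally have 22: "I 2 2 = s * s * I 1 1 + 2 * c * s * I 1 2 + c * c * I 2 2" .
  have "I 1 2 = (LINT v|lborel. c * s * (F v * (v$1 * (v$1 * W v))) + (c * c - s * s) * (F v * (v$1 * (v$2 * W v)))
      - c * s * (F v * (v$2 * (v$2 * W v))))"
    unfolding I_def integral_symmetric_rotate[OF meas] by (simp add: W rotation_component c_def s_def algebra_simps)
  also have "\<dots> = c * s * I 1 1 + (c * c - s * s) * I 1 2 - c * s * I 2 2"
    unfolding I_def using int by simp
  finally have 12: "I 1 2 = c * s * I 1 1 + (c * c - s * s) * I 1 2 - c * s * I 2 2" .
  have "I 1 1 - I 2 2 = (c * c - s * s) * (I 1 1 - I 2 2) - 2 * c * s * (2 * I 1 2)"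
    using 11 22 by algebra
  moreover have "2 * I 1 2 = 2 * c * s * (I 1 1 - I 2 2) + (c * c - s * s) * (2 * I 1 2)"
    using 12 by algebra
  ultimately have "I 1 1 - I 2 2 = 0" "2 * I 1 2 = 0"
    by (rule linear_system_trivial[OF _ _ c])+
  then show "(LINT v|lborel. F v * (v$1 * (v$1 * W v))) = (LINT v|lborel. F v * (v$2 * (v$2 * W v)))"
    "(LINT v|lborel. F v * (v$1 * (v$2 * W v))) = 0" by (simp_all add: I_def)
qed

end

lemma average_at_0: "average F K l 0 = (LINT v|lborel. F (l *\<^sub>R v) * K (- v))"
  by (simp add: average_def)

text \<open>Since x enters \<open>average\<close> only through the kernel, expanding K around -v
  with increment x/l expands the average, and the coefficients are averages at 0 against derivatives
  of K. The mode conditions erase the linear and mixed terms and merge the two pure ones into a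
  radial quadratic.\<close>

lemma average_Taylor:
  assumes "test_function K"
  obtains C R where "C > 0" "R > 0"
    "\<And>F c l x. \<lbrakk>locally_bounded F; l > 0; c \<ge> 0; norm x \<le> l; \<And>w. norm w \<le> R * l \<Longrightarrow> \<bar>F w\<bar> \<le> c;
       \<And>i. average F (partial i K) l 0 = 0;
       average F (partial 1 (partial 2 K)) l 0 = 0; average F (partial 2 (partial 1 K)) l 0 = 0;
       average F (partial 1 (partial 1 K)) l 0 = average F (partial 2 (partial 2 K)) l 0\<rbrakk>
     \<Longrightarrow> \<bar>average F K l x - average F K l 0 - (norm x / l)\<^sup>2 / 2 * average F (partial 1 (partial 1 K)) l 0\<bar>
        \<le> C * c * (norm x / l) ^ 3"
proof -
  obtain R where R: "R > 0" "\<And>x. norm x > R \<Longrightarrow> K x = 0" using test_function_support[OF assms] by metis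
  obtain C where C: "C > 0" "\<And>p w. \<bar>K (p + w) - K p - (\<Sum>i\<in>UNIV. w$i * partial i K p)
     - (\<Sum>i\<in>UNIV. \<Sum>j\<in>UNIV. w$i * w$j * partial j (partial i K) p) / 2\<bar> \<le> C * norm w ^ 3"
    by (rule test_function_Taylor[OF assms]) (rule that)
  note t = test_function_partial
  have p0: "partial i K x = 0" if "norm x > R" for i x
    using partial_zero_outside[OF R(2) that] .
  have pp0: "partial j (partial i K) x = 0" if "norm x > R" for i j x
    using partial_zero_outside[OF p0 that] .
  show ?thesis
  proof (rule that[of "C * disc_area (R + 1) + 1" "R + 1"])
    fix F :: "real^2 \<Rightarrow> real" and c l :: real and x :: "real^2"
    assume F: "locally_bounded F" and l: "l > 0" and c: "c \<ge> 0" and x: "norm x \<le> l"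
      and Fb: "\<And>w. norm w \<le> (R + 1) * l \<Longrightarrow> \<bar>F w\<bar> \<le> c"
      and first: "\<And>i. average F (partial i K) l 0 = 0"
      and mixed: "average F (partial 1 (partial 2 K)) l 0 = 0" "average F (partial 2 (partial 1 K)) l 0 = 0"
      and pure: "average F (partial 1 (partial 1 K)) l 0 = average F (partial 2 (partial 2 K)) l 0"
    define w where "w = (1/l) *\<^sub>R x"
    have nw: "norm w = norm x / l" using l by (simp add: w_def)
    have w1: "norm w \<le> 1" using x l by (simp add: nw)
    define T where "T v = K (-v + w) - K (-v) - (\<Sum>i\<in>UNIV. w$i * partial i K (-v))
     - (\<Sum>i\<in>UNIV. \<Sum>j\<in>UNIV. w$i * w$j * partial j (partial i K) (-v)) / 2" for v
    have i0: "integrable lborel (\<lambda>v. F (l *\<^sub>R v) * J (-v))" if "test_function J" for J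
      using average_integrable[OF F that, of l 0] by simp
    have iw: "integrable lborel (\<lambda>v. F (l *\<^sub>R v) * K (-v + w))"
      using average_integrable[OF F assms, of l w] by simp
    have "(LINT v|lborel. F (l *\<^sub>R v) * T v) = (LINT v|lborel. F (l *\<^sub>R v) * K (-v + w) - F (l *\<^sub>R v) * K (-v)
       - (\<Sum>i\<in>UNIV. w$i * (F (l *\<^sub>R v) * partial i K (-v)))
       - (\<Sum>i\<in>UNIV. \<Sum>j\<in>UNIV. w$i * w$j * (F (l *\<^sub>R v) * partial j (partial i K) (-v))) / 2)"
      by (rule Bochner_Integration.integral_cong) (auto simp: T_def sum_2 algebra_simps)
    also have "\<dots> = average F K l x - average F K l 0 - (\<Sum>i\<in>UNIV. w$i * average F (partial i K) l 0)
       - (\<Sum>i\<in>UNIV. \<Sum>j\<in>UNIV. w$i * w$j * average F (partial j (partial i K)) l 0) / 2"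
      using i0[OF assms] i0[OF t[OF assms]] i0[OF t[OF t[OF assms]]] iw
      by (simp add: average_def w_def)
    also have "\<dots> = average F K l x - average F K l 0 - ((w$1)\<^sup>2 + (w$2)\<^sup>2) / 2 * average F (partial 1 (partial 1 K)) l 0"
      by (simp add: first sum_2 mixed pure[symmetric] power2_eq_square algebra_simps)
    also have "(w$1)\<^sup>2 + (w$2)\<^sup>2 = (norm x / l)\<^sup>2" by (simp add: nw flip: norm_power2_eq)
    finally have eq: "average F K l x - average F K l 0 - (norm x / l)\<^sup>2 / 2 * average F (partial 1 (partial 1 K)) l 0
      = (LINT v|lborel. F (l *\<^sub>R v) * T v)" by simp
    have "\<bar>LINT v|lborel. F (l *\<^sub>R v) * T v\<bar> \<le> (c * (C * norm w ^ 3)) * disc_area (R + 1)"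
    proof (rule integral_bound_cball[where a = 0])
      show "0 \<le> c * (C * norm w ^ 3)" using c C by simp
      fix v :: "real^2"
      show "\<bar>F (l *\<^sub>R v) * T v\<bar> \<le> c * (C * norm w ^ 3)" if "v \<in> cball 0 (R + 1)"
        unfolding abs_mult
      proof (rule mult_mono)
        show "\<bar>F (l *\<^sub>R v)\<bar> \<le> c" using that l by (intro Fb) (simp add: dist_norm mult.commute)
        show "\<bar>T v\<bar> \<le> C * norm w ^ 3" unfolding T_def by (rule C)
      qed (use c in auto)
      \<comment> \<open>The increment has length at most 1, so beyond radius \<open>R + 1\<close>
        both the shifted and the unshifted kernel vanish, and with them all derivatives in the
        remainder.\<close>
      show "F (l *\<^sub>R v) * T v = 0" if "v \<notin> cball 0 (R + 1)"
      proof -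
        have v: "norm (-v) > R + 1" using that by (simp add: dist_norm)
        have "norm (-v) \<le> norm (-v + w) + norm w" by (metis add_diff_cancel_right' norm_triangle_ineq4)
        with v w1 have "norm (-v + w) > R" by simp
        moreover have "norm (-v) > R" using v by simp
        ultimately have "T v = 0" unfolding T_def by (simp only: R p0 pp0) simp
        then show ?thesis by simp
      qed
    qed
    also have "\<dots> = (C * disc_area (R + 1)) * (c * norm w ^ 3)" by (simp add: mult_ac)
    also have "\<dots> \<le> (C * disc_area (R + 1) + 1) * (c * norm w ^ 3)"
      using c by (intro mult_right_mono) auto
    finally show "\<bar>average F K l x - average F K l 0 - (norm x / l)\<^sup>2 / 2 * average F (partial 1 (partial 1 K)) l 0\<bar>
        \<le> (C * disc_area (R + 1) + 1) * c * (norm x / l) ^ 3"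
      unfolding eq nw by (simp add: mult.assoc)
  next
    show "C * disc_area (R + 1) + 1 > 0" using C by (intro add_nonneg_pos) auto
  qed (use R in auto)
qed

section \<open>Smooth radial kernels\<close>

text \<open>Level 0 asks for nothing, so level k means k times differentiable. The intersection over
  all k is still the class of smooth functions.\<close>

primrec C_k_line :: "nat \<Rightarrow> (real \<Rightarrow> real) \<Rightarrow> bool" where
  "C_k_line 0 f \<longleftrightarrow> True"
| "C_k_line (Suc k) f \<longleftrightarrow> (\<exists>f'. (\<forall>x. DERIV f x :> f' x) \<and> C_k_line k f')"

definition smooth_line :: "(real \<Rightarrow> real) \<Rightarrow> bool" where
  "smooth_line f \<longleftrightarrow> (\<forall>k. C_k_line k f)"

lemma C_k_line_SucI: "(\<And>x. DERIV f x :> f' x) \<Longrightarrow> C_k_line k f' \<Longrightarrow> C_k_line (Suc k) f"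
  by auto

lemma C_k_line_SucD: "C_k_line (Suc k) f \<Longrightarrow> C_k_line k f"
proof (induction k arbitrary: f)
  case (Suc k)
  then show ?case by (metis C_k_line.simps(2))
qed simp

lemma smooth_lineI: "(\<And>x. DERIV f x :> f' x) \<Longrightarrow> smooth_line f' \<Longrightarrow> smooth_line f"
  unfolding smooth_line_def
proof
  fix k assume "\<And>x. DERIV f x :> f' x" "\<forall>k. C_k_line k f'"
  then show "C_k_line k f" by (cases k) auto
qed

lemma smooth_line_deriv:
  assumes "smooth_line f" "\<And>x. DERIV f x :> f' x"
  shows "smooth_line f'"
  unfolding smooth_line_def
proof
  fix k
  have "C_k_line (Suc k) f" using assms(1) by (simp only: smooth_line_def)
  then obtain g where g: "\<forall>x. DERIV f x :> g x" "C_k_line k g" by auto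
  have "g = f'" using g(1) assms(2) DERIV_unique by blast
  with g show "C_k_line k f'" by simp
qed

lemma smooth_line_obtain:
  assumes "smooth_line f"
  obtains f' where "\<And>x. DERIV f x :> f' x" "smooth_line f'"
proof -
  have "C_k_line (Suc 0) f" using assms by (simp only: smooth_line_def)
  then obtain g where "\<And>x. DERIV f x :> g x" by auto
  with smooth_line_deriv[OF assms] that show ?thesis by blast
qed

lemma smooth_line_continuous: "smooth_line f \<Longrightarrow> continuous_on S f"
  by (rule smooth_line_obtain, assumption) (auto intro: DERIV_isCont continuous_at_imp_continuous_on)

lemma C_k_line_const: "C_k_line k (\<lambda>x. c)"
proof (induction k arbitrary: c)
  case (Suc k)
  show ?case by (simp, rule exI[of _ "\<lambda>_. 0"]) (simp add: Suc.IH)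
qed simp

lemma C_k_line_add: "C_k_line k f \<Longrightarrow> C_k_line k g \<Longrightarrow> C_k_line k (\<lambda>x. f x + g x)"
proof (induction k arbitrary: f g)
  case (Suc k)
  obtain f' where f: "\<forall>x. DERIV f x :> f' x" "C_k_line k f'" using Suc.prems(1) by auto
  obtain g' where g: "\<forall>x. DERIV g x :> g' x" "C_k_line k g'" using Suc.prems(2) by auto
  have "\<forall>x. DERIV (\<lambda>x. f x + g x) x :> f' x + g' x" using f g by (auto intro: DERIV_add)
  then show ?case using Suc.IH[OF f(2) g(2)] by auto
qed simp

lemma C_k_line_mult: "C_k_line k f \<Longrightarrow> C_k_line k g \<Longrightarrow> C_k_line k (\<lambda>x. f x * g x)"
proof (induction k arbitrary: f g)
  case (Suc k)
  obtain f' where f: "\<forall>x. DERIV f x :> f' x" "C_k_line k f'" using Suc.prems(1) by auto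
  obtain g' where g: "\<forall>x. DERIV g x :> g' x" "C_k_line k g'" using Suc.prems(2) by auto
  have "DERIV (\<lambda>x. f x * g x) x :> f' x * g x + g' x * f x" for x using f g by (auto intro: DERIV_mult)
  moreover have "C_k_line k (\<lambda>x. f' x * g x + g' x * f x)"
    using C_k_line_SucD[OF Suc.prems(1)] C_k_line_SucD[OF Suc.prems(2)] f g by (intro C_k_line_add Suc.IH)
  ultimately show ?case by (rule C_k_line_SucI)
qed simp

lemma C_k_line_affine: "C_k_line k f \<Longrightarrow> C_k_line k (\<lambda>x. f (a * x + b))"
proof (induction k arbitrary: f)
  case (Suc k)
  obtain f' where f: "\<forall>x. DERIV f x :> f' x" "C_k_line k f'" using Suc.prems(1) by auto
  have "DERIV (\<lambda>x. f (a * x + b)) x :> f' (a * x + b) * a" for x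
    by (rule DERIV_chain2[OF f(1)[rule_format]]) (auto intro!: derivative_eq_intros)
  moreover have "C_k_line k (\<lambda>x. f' (a * x + b) * a)"
    using Suc.IH[OF f(2)] by (intro C_k_line_mult C_k_line_const)
  ultimately show ?case by (rule C_k_line_SucI)
qed simp

lemma smooth_line_mult: "smooth_line f \<Longrightarrow> smooth_line g \<Longrightarrow> smooth_line (\<lambda>x. f x * g x)"
  by (simp add: smooth_line_def C_k_line_mult)

lemma smooth_line_add: "smooth_line f \<Longrightarrow> smooth_line g \<Longrightarrow> smooth_line (\<lambda>x. f x + g x)"
  by (simp add: smooth_line_def C_k_line_add)

lemma smooth_line_cmult: "smooth_line f \<Longrightarrow> smooth_line (\<lambda>x. c * f x)"
  by (simp add: smooth_line_def C_k_line_mult C_k_line_const)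

lemma smooth_line_affine: "smooth_line f \<Longrightarrow> smooth_line (\<lambda>x. f (a * x + b))"
  by (simp add: smooth_line_def C_k_line_affine)

text \<open>The pole at 0 lies where f vanishes. The induction runs over f and n at once, because
  the derivative consists of f'/x^n and f/x^(n+1), and f' again vanishes below 1.\<close>

lemma smooth_line_divide_power:
  assumes "smooth_line f" "\<And>x. x < 1 \<Longrightarrow> f x = 0"
  shows "smooth_line (\<lambda>x. f x / x ^ n)"
proof -
  have "C_k_line k (\<lambda>x. f x / x ^ n)" if "smooth_line f" "\<And>x. x < 1 \<Longrightarrow> f x = 0" for k f n
    using that
  proof (induction k arbitrary: f n)
    case (Suc k)
    obtain f' where f: "\<And>x. DERIV f x :> f' x" "smooth_line f'" using smooth_line_obtain[OF Suc.prems(1)] by metis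
    have f'0: "f' x = 0" if "x < 1" for x
    proof -
      have "DERIV f x :> 0"
        by (rule has_field_derivative_transform_within_open[of "\<lambda>_. 0" _ _ "{..<1}"]) (use that Suc.prems(2) in auto)
      then show ?thesis using f(1) DERIV_unique by blast
    qed
    have "DERIV (\<lambda>x. f x / x ^ n) x :> f' x / x ^ n + (- real n) * (f x / x ^ Suc n)" for x
    proof (cases "x < 1")
      case True
      have "DERIV (\<lambda>x. f x / x ^ n) x :> 0"
        by (rule has_field_derivative_transform_within_open[of "\<lambda>_. 0" _ _ "{..<1}"]) (use True Suc.prems(2) in auto)
      then show ?thesis using True f'0 Suc.prems(2) by simp
    next
      case False
      have "DERIV (\<lambda>x. f x / x ^ n) x :> (f' x * x ^ n - f x * (real n * x ^ (n - 1))) / (x ^ n * x ^ n)"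
        using False by (auto intro!: derivative_eq_intros f simp: mult_ac)
      moreover have "(f' x * x ^ n - f x * (real n * x ^ (n - 1))) / (x ^ n * x ^ n) = f' x / x ^ n + (- real n) * (f x / x ^ Suc n)"
        using False by (cases n) (auto simp: field_simps)
      ultimately show ?thesis by simp
    qed
    moreover have "C_k_line k (\<lambda>x. f' x / x ^ n + (- real n) * (f x / x ^ Suc n))"
      by (intro C_k_line_add C_k_line_mult C_k_line_const Suc.IH f f'0 Suc.prems)
    ultimately show ?case by (rule C_k_line_SucI)
  qed simp
  with assms show ?thesis by (simp add: smooth_line_def)
qed

text \<open>The classical flat function exp(-1/x), with a power of x divided out so that the family
  is closed under differentiation.\<close>

definition flat_exp :: "nat \<Rightarrow> real \<Rightarrow> real" where
  "flat_exp n x = (if x > 0 then exp (- 1 / x) / x ^ n else 0)"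

text \<open>With t = 1/x the right-hand limit is that of t^n / exp t at infinity.\<close>

lemma flat_exp_tendsto: "(flat_exp n \<longlongrightarrow> 0) (at 0)"
proof -
  have "((\<lambda>t::real. t ^ n / exp t) \<longlongrightarrow> 0) at_top" by (rule tendsto_power_div_exp_0)
  from filterlim_compose[OF this filterlim_inverse_at_top_right]
  have "((\<lambda>x::real. inverse x ^ n / exp (inverse x)) \<longlongrightarrow> 0) (at_right 0)" .
  then have "(flat_exp n \<longlongrightarrow> 0) (at_right 0)"
    by (rule Lim_transform_eventually)
      (auto simp: eventually_at_right_less flat_exp_def exp_minus divide_inverse power_inverse mult.commute
        intro!: eventually_mono[OF eventually_at_right_less[of "0::real"]])
  moreover have "(flat_exp n \<longlongrightarrow> 0) (at_left 0)"
    by (rule Lim_transform_eventually[OF tendsto_const])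
      (auto simp: flat_exp_def eventually_at_left_field intro!: exI[of _ "-1"])
  ultimately show ?thesis by (simp add: filterlim_split_at)
qed

lemma flat_exp_deriv: "DERIV (flat_exp n) x :> flat_exp (n + 2) x + (- real n) * flat_exp (n + 1) x"
proof -
  consider "x < 0" | "x = 0" | "x > 0" by linarith
  then show ?thesis
  proof cases
    case 1
    have "DERIV (flat_exp n) x :> 0"
      by (rule has_field_derivative_transform_within_open[of "\<lambda>_. 0" _ _ "{..<0}"]) (use 1 in \<open>auto simp: flat_exp_def\<close>)
    then show ?thesis using 1 by (simp add: flat_exp_def)
  next
    case 2
    \<comment> \<open>The difference quotient of \<open>flat_exp n\<close> at 0 is exactly
      \<open>flat_exp (Suc n)\<close>.\<close>
    have "(flat_exp (Suc n) \<longlongrightarrow> 0) (at 0)" by (rule flat_exp_tendsto)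
    moreover have "flat_exp (Suc n) = (\<lambda>h. (flat_exp n (0 + h) - flat_exp n 0) / h)"
      by (simp add: flat_exp_def fun_eq_iff)
    ultimately have "DERIV (flat_exp n) 0 :> 0" by (simp only: DERIV_def)
    then show ?thesis using 2 by (simp add: flat_exp_def)
  next
    case 3
    have "DERIV (\<lambda>x. exp (- 1 / x) / x ^ n) x :> exp (- 1 / x) / x ^ (n + 2) + (- real n) * (exp (- 1 / x) / x ^ (n + 1))"
    proof -
      have "DERIV (\<lambda>x. exp (- 1 / x) / x ^ n) x :>
        (exp (- 1 / x) * (1 / x\<^sup>2) * x ^ n - exp (- 1 / x) * (real n * x ^ (n - 1))) / (x ^ n * x ^ n)"
        using 3 by (auto intro!: derivative_eq_intros simp: power2_eq_square mult_ac)
      moreover have "(exp (- 1 / x) * (1 / x\<^sup>2) * x ^ n - exp (- 1 / x) * (real n * x ^ (n - 1))) / (x ^ n * x ^ n)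
        = exp (- 1 / x) / x ^ (n + 2) + (- real n) * (exp (- 1 / x) / x ^ (n + 1))"
        using 3 by (cases n) (auto simp: field_simps power2_eq_square)
      ultimately show ?thesis by simp
    qed
    then have "DERIV (\<lambda>x. exp (- 1 / x) / x ^ n) x :> flat_exp (n + 2) x + (- real n) * flat_exp (n + 1) x"
      using 3 by (simp add: flat_exp_def)
    then show ?thesis
      by (rule has_field_derivative_transform_within_open[of _ _ _ "{0<..}"]) (use 3 in \<open>auto simp: flat_exp_def\<close>)
  qed
qed

lemma smooth_flat_exp: "smooth_line (flat_exp n)"
proof -
  have "C_k_line k (flat_exp n)" for k
  proof (induction k arbitrary: n)
    case (Suc k)
    have "C_k_line k (\<lambda>x. flat_exp (n + 2) x + (- real n) * flat_exp (n + 1) x)"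
      by (intro C_k_line_add C_k_line_mult C_k_line_const Suc.IH)
    with flat_exp_deriv show ?case by (rule C_k_line_SucI)
  qed simp
  then show ?thesis by (simp add: smooth_line_def)
qed

lemma antiderivative_line:
  fixes f :: "real \<Rightarrow> real"
  assumes "continuous_on UNIV f"
  obtains P where "\<And>x. DERIV P x :> f x" "P a = 0"
proof -
  have "\<exists>F. \<forall>x::real. -\<infinity> < ereal x \<longrightarrow> ereal x < \<infinity> \<longrightarrow> (F has_vector_derivative f x) (at x)"
    by (rule einterval_antiderivative) (use assms in \<open>auto simp: continuous_on_eq_continuous_at\<close>)
  then obtain F where F: "\<And>x. DERIV F x :> f x"
    by (auto simp: has_real_derivative_iff_has_vector_derivative)
  have "DERIV (\<lambda>x. F x - F a) x :> f x" for x
    using DERIV_diff[OF F DERIV_const[of "F a"], of x] by simp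
  then show ?thesis by (intro that[of "\<lambda>x. F x - F a"]) auto
qed

lemma deriv_zero_constant:
  fixes P :: "real \<Rightarrow> real"
  assumes "convex S" "\<And>x. x \<in> S \<Longrightarrow> DERIV P x :> 0" "x \<in> S" "y \<in> S"
  shows "P x = P y"
proof -
  have "\<exists>c. \<forall>x\<in>S. P x = c"
    by (rule has_field_derivative_zero_constant[OF assms(1)])
      (use assms(2) has_field_derivative_at_within in blast)
  with assms show ?thesis by auto
qed

section \<open>Radial functions on the plane\<close>

lemma has_derivative_norm_power2:
  "((\<lambda>z::real^2. (norm z)\<^sup>2) has_derivative (\<lambda>h. \<Sum>i\<in>UNIV. h$i * (2 * x$i))) (at x)"
proof -
  have "((\<lambda>z::real^2. z \<bullet> z) has_derivative (\<lambda>h. x \<bullet> h + h \<bullet> x)) (at x)"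
    by (auto intro!: derivative_eq_intros)
  moreover have "(\<lambda>h. x \<bullet> h + h \<bullet> x) = (\<lambda>h. \<Sum>i\<in>UNIV. h$i * (2 * x$i))"
    by (simp add: inner_vec_def sum_2 algebra_simps fun_eq_iff)
  ultimately show ?thesis by (simp add: power2_norm_eq_inner)
qed

text \<open>Profiles are taken in the squared norm, a polynomial in the coordinates, so a smooth
  profile gives a function that is smooth at the origin too.\<close>

lemma radial_has_derivative:
  assumes "\<And>s. DERIV E s :> E1 s"
  shows "((\<lambda>z::real^2. E ((norm z)\<^sup>2)) has_derivative (\<lambda>h. \<Sum>i\<in>UNIV. h$i * (2 * x$i * E1 ((norm x)\<^sup>2)))) (at x)"
proof -
  have "(E has_derivative (\<lambda>t. E1 ((norm x)\<^sup>2) * t)) (at ((norm x)\<^sup>2))"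
    using assms by (simp add: has_field_derivative_def)
  from has_derivative_compose[OF has_derivative_norm_power2 this]
  show ?thesis by (rule has_derivative_eq_rhs) (simp add: sum_2 algebra_simps)
qed

lemma partial_radial:
  assumes "\<And>s. DERIV E s :> E1 s"
  shows "partial i (\<lambda>z. E ((norm z)\<^sup>2)) = (\<lambda>x. 2 * x$i * E1 ((norm x)\<^sup>2))"
  by (rule partial_eqI[OF radial_has_derivative[OF assms]])

lemma C_k_radial: "smooth_line E \<Longrightarrow> C_k k (\<lambda>z. E ((norm z)\<^sup>2))"
proof (induction k arbitrary: E)
  case 0
  then show ?case
    by (auto intro!: continuous_on_compose2[OF smooth_line_continuous[of E UNIV]] continuous_intros)
next
  case (Suc k)
  obtain E1 where E1: "\<And>s. DERIV E s :> E1 s" "smooth_line E1" using smooth_line_obtain[OF Suc.prems] by metis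
  show ?case
    by (rule C_k_SucI[OF radial_has_derivative[OF E1(1)]])
      (intro C_k_mult C_k_const C_k_component Suc.IH E1)
qed

text \<open>Its trace is 4 s E2 + 4 E1 with s = |x|^2. The mixed entry and the difference of the
  diagonal entries are radial multiples of x1 x2 and x1^2 - x2^2, that is, pure angular modes of
  order two.\<close>

lemma partial_partial_radial:
  assumes "smooth_line E" "\<And>s. DERIV E s :> E1 s" "\<And>s. DERIV E1 s :> E2 s"
  shows "partial j (partial i (\<lambda>z. E ((norm z)\<^sup>2))) =
    (\<lambda>x. 4 * x$i * x$j * E2 ((norm x)\<^sup>2) + (if i = j then 2 * E1 ((norm x)\<^sup>2) else 0))"
proof
  fix x
  have s: "smooth_line E1" using smooth_line_deriv[OF assms(1,2)] .
  have 1: "C_k (Suc 0) (\<lambda>x. 2 * x$i)" by (intro C_k_cmult C_k_component)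
  have 2: "C_k (Suc 0) (\<lambda>z. E1 ((norm z)\<^sup>2))" using C_k_radial[OF s] .
  have 3: "partial j (\<lambda>x. 2 * x$i) x = (if i = j then 2 else 0)"
    using partial_mult[OF C_k_const[of "Suc 0" 2] C_k_component[of "Suc 0" i], of j x]
      partial_component[of j i] partial_eqI[of "\<lambda>_. 2" "\<lambda>_ _. 0" j] by auto
  have "partial j (partial i (\<lambda>z. E ((norm z)\<^sup>2))) x = partial j (\<lambda>x. (2 * x$i) * E1 ((norm x)\<^sup>2)) x"
    by (simp add: partial_radial[OF assms(2)])
  also have "\<dots> = 2 * x$i * partial j (\<lambda>z. E1 ((norm z)\<^sup>2)) x + partial j (\<lambda>x. 2 * x$i) x * E1 ((norm x)\<^sup>2)"
    by (rule partial_mult[OF 1 2])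
  finally show "partial j (partial i (\<lambda>z. E ((norm z)\<^sup>2))) x =
    4 * x$i * x$j * E2 ((norm x)\<^sup>2) + (if i = j then 2 * E1 ((norm x)\<^sup>2) else 0)"
    by (simp add: 3 partial_radial[OF assms(3)])
qed

lemma test_function_radial:
  assumes "smooth_line E" "\<And>s. s > 16 \<Longrightarrow> E s = 0"
  shows "test_function (\<lambda>z. E ((norm z)\<^sup>2))"
proof (rule test_functionI[of _ 4])
  show "C_k k (\<lambda>z. E ((norm z)\<^sup>2))" for k by (rule C_k_radial[OF assms(1)])
  show "E ((norm x)\<^sup>2) = 0" if "norm x > 4" for x :: "real^2"
  proof (rule assms(2))
    have "4\<^sup>2 < (norm x)\<^sup>2" using that by (intro power_strict_mono) auto
    then show "16 < (norm x)\<^sup>2" by simp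
  qed
qed

text \<open>With \<open>b\<close> a bump on \<open>[1, 4]\<close> and \<open>P\<close> its primitive, the profile
  \<open>E1 s = (P (s/4) - P s) / (4 s)\<close> solves the radial Poisson equation \<open>4 (s E1)' = b (s/4) / 4 - b s\<close>.\<close>

lemma radial_kernels_unnormalized:
  obtains E E1 E2 b :: "real \<Rightarrow> real" where
    "smooth_line E" "smooth_line b" "\<And>s. DERIV E s :> E1 s" "\<And>s. DERIV E1 s :> E2 s"
    "\<And>s. s \<ge> 16 \<Longrightarrow> E s = 0" "\<And>s. s \<ge> 16 \<Longrightarrow> b s = 0"
    "\<And>s. 4 * s * E2 s + 4 * E1 s = b (s / 4) / 4 - b s"
    "\<And>s. b s \<ge> 0" "\<And>s. 1 < s \<Longrightarrow> s < 4 \<Longrightarrow> b s > 0"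
proof -
  define b where "b s = flat_exp 0 (1 * s + (-1)) * flat_exp 0 ((-1) * s + 4)" for s
  have b: "smooth_line b" unfolding b_def[abs_def] by (intro smooth_line_mult smooth_line_affine smooth_flat_exp)
  have b0: "b s = 0" if "s \<le> 1 \<or> s \<ge> 4" for s using that by (auto simp: b_def flat_exp_def)
  obtain P where P: "\<And>s. DERIV P s :> b s" "P 0 = 0" using antiderivative_line[OF smooth_line_continuous[OF b], of 0] by metis
  have sP: "smooth_line P" by (rule smooth_lineI[OF P(1) b])
  have P1: "P s = 0" if "s \<le> 1" for s
  proof -
    have "P s = P 0"
      by (rule deriv_zero_constant[of "{..1}"]) (use P(1) b0 that in \<open>auto simp: convex_real_interval\<close>, metis P(1) b0)
    with P(2) show ?thesis by simp
  qed
  have P4: "P s = P 4" if "s \<ge> 4" for s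
    by (rule deriv_zero_constant[of "{4..}"]) (use P(1) b0 that in \<open>auto simp: convex_real_interval\<close>, metis P(1) b0)
  define D where "D s = (1/4) * (P ((1/4) * s + 0) + (-1) * P s)" for s
  have sD: "smooth_line D" unfolding D_def[abs_def] by (intro smooth_line_cmult smooth_line_add smooth_line_affine sP)
  have D0: "D s = 0" if "s < 1" for s using that P1[of s] P1[of "s/4"] by (simp add: D_def)
  \<comment> \<open>Past 16 both primitives have reached their final value \<open>P 4\<close> and
    cancel, because b(s/4)/4 and b have equal integrals over s. This makes the kernel compactly
    supported.\<close>
  have D16: "D s = 0" if "s \<ge> 16" for s using that P4[of s] P4[of "s/4"] by (simp add: D_def)
  have dD: "DERIV D s :> (b (s / 4) / 4 - b s) / 4" for s
  proof -
    have "DERIV (\<lambda>s. P ((1/4) * s + 0)) s :> b ((1/4) * s + 0) * (1/4)"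
      by (rule DERIV_chain2[OF P(1)]) (auto intro!: derivative_eq_intros)
    from DERIV_cmult[OF DERIV_add[OF this DERIV_cmult[OF P(1), of "-1"]], of "1/4"]
    have "DERIV D s :> 1/4 * (b (1/4 * s + 0) * (1/4) + -1 * b s)" unfolding D_def[abs_def] .
    then show ?thesis by (rule DERIV_cong) (simp add: field_simps)
  qed
  define E1 where "E1 s = D s / s ^ 1" for s
  have sE1: "smooth_line E1" unfolding E1_def[abs_def] by (rule smooth_line_divide_power[OF sD D0])
  have E16: "E1 s = 0" if "s \<ge> 16" for s using D16[OF that] by (simp add: E1_def)
  have sD_eq: "D s = s * E1 s" for s using D0[of 0] by (cases "s = 0") (auto simp: E1_def)
  obtain E2 where E2: "\<And>s. DERIV E1 s :> E2 s" using smooth_line_obtain[OF sE1] by metis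
  \<comment> \<open>The primitive is anchored at 16 and not at 0, so that it vanishes on the
    outside.\<close>
  obtain E where E: "\<And>s. DERIV E s :> E1 s" "E 16 = 0" using antiderivative_line[OF smooth_line_continuous[OF sE1], of 16] by metis
  have E0: "E s = 0" if "s \<ge> 16" for s
  proof -
    have "E s = E 16"
      by (rule deriv_zero_constant[of "{16..}"]) (use E16 that in \<open>auto simp: convex_real_interval\<close>, metis E(1) E16)
    with E(2) show ?thesis by simp
  qed
  have eq: "4 * s * E2 s + 4 * E1 s = b (s / 4) / 4 - b s" for s
  proof -
    have "DERIV (\<lambda>s. s * E1 s) s :> 1 * E1 s + E2 s * s"
      by (rule DERIV_mult[OF DERIV_ident E2])
    moreover have "D = (\<lambda>s. s * E1 s)" using sD_eq by blast
    ultimately have "DERIV D s :> 1 * E1 s + E2 s * s" by (simp only:)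
    from DERIV_unique[OF this dD] show ?thesis by (simp add: field_simps)
  qed
  show ?thesis
  proof (rule that[of E b E1 E2])
    show "smooth_line E" by (rule smooth_lineI[OF E(1) sE1])
    show "b s \<ge> 0" for s by (simp add: b_def flat_exp_def)
    show "b s > 0" if "1 < s" "s < 4" for s using that by (simp add: b_def flat_exp_def)
    show "b s = 0" if "s \<ge> 16" for s using that b0 by simp
  qed (use b E E2 E0 eq in auto)
qed

text \<open>The bump is positive on the open annulus 1 < |z| < 2, so its mass is not zero. The
  Poisson relation is linear, and dividing all four profiles by the mass preserves it.\<close>

lemma radial_kernels:
  obtains E E1 E2 G :: "real \<Rightarrow> real" where
    "smooth_line E" "smooth_line G" "\<And>s. DERIV E s :> E1 s" "\<And>s. DERIV E1 s :> E2 s"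
    "\<And>s. s \<ge> 16 \<Longrightarrow> E s = 0" "\<And>s. s \<ge> 16 \<Longrightarrow> G s = 0"
    "\<And>s. 4 * s * E2 s + 4 * E1 s = G (s / 4) / 4 - G s"
    "(LINT z::real^2|lborel. G ((norm z)\<^sup>2)) = 1"
proof -
  obtain E E1 E2 b :: "real \<Rightarrow> real" where *:
    "smooth_line E" "smooth_line b" "\<And>s. DERIV E s :> E1 s" "\<And>s. DERIV E1 s :> E2 s"
    "\<And>s. s \<ge> 16 \<Longrightarrow> E s = 0" "\<And>s. s \<ge> 16 \<Longrightarrow> b s = 0"
    "\<And>s. 4 * s * E2 s + 4 * E1 s = b (s / 4) / 4 - b s"
    "\<And>s. b s \<ge> 0" "\<And>s. 1 < s \<Longrightarrow> s < 4 \<Longrightarrow> b s > 0"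
    by (rule radial_kernels_unnormalized) (rule that)
  define c where "c = (LINT z::real^2|lborel. b ((norm z)\<^sup>2))"
  have int: "integrable lborel (\<lambda>z::real^2. b ((norm z)\<^sup>2))"
    by (intro test_function_integrable test_function_radial *) simp
  have "c \<noteq> 0"
  proof
    assume "c = 0"
    then have ae: "AE z::real^2 in lborel. b ((norm z)\<^sup>2) = 0"
      using integral_nonneg_eq_0_iff_AE[OF int] *(8) by (simp add: c_def)
    define U where "U = {z::real^2. 1 < norm z \<and> norm z < 2}"
    have "open U" unfolding U_def by (intro open_Collect_conj open_Collect_less continuous_intros)
    moreover have "axis 1 (3/2) \<in> U" by (simp add: U_def norm_eq_sqrt_2 axis_def)
    ultimately have "\<not> negligible U" using open_not_negligible[of U] by auto
    moreover have "AE z in lborel. z \<notin> U"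
      using ae
    proof (rule AE_mp, intro AE_I2 impI notI)
      fix z :: "real^2" assume "b ((norm z)\<^sup>2) = 0" "z \<in> U"
      then have "1 < (norm z)\<^sup>2" "(norm z)\<^sup>2 < 2\<^sup>2"
        using power_strict_mono[of 1 "norm z" 2] power_strict_mono[of "norm z" 2 2] by (auto simp: U_def)
      then show False using *(9)[of "(norm z)\<^sup>2"] \<open>b _ = 0\<close> by simp
    qed
    then have "U \<in> null_sets lborel"
      using \<open>open U\<close> by (simp add: AE_iff_null_sets)
    then have "negligible U"
      by (simp add: negligible_iff_null_sets null_sets_completionI)
    ultimately show False by simp
  qed
  define d where "d = 1 / c"
  show ?thesis
  proof (rule that[of "\<lambda>s. d * E s" "\<lambda>s. d * b s" "\<lambda>s. d * E1 s" "\<lambda>s. d * E2 s"])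
    show "4 * s * (d * E2 s) + 4 * (d * E1 s) = d * b (s / 4) / 4 - d * b s" for s
      using arg_cong[OF *(7)[of s], of "\<lambda>t. d * t"] by (simp add: algebra_simps)
    show "(LINT z::real^2|lborel. d * b ((norm z)\<^sup>2)) = 1"
      using \<open>c \<noteq> 0\<close> by (simp add: d_def flip: c_def)
  qed (use * in \<open>auto intro!: smooth_line_cmult DERIV_cmult\<close>)
qed

section \<open>Weighted Hoelder functions and dyadic series\<close>

text \<open>Subadditivity of the power a at most 1, which rests on t being at most t^a for t in
  [0, 1].\<close>

lemma powr_diff_le:
  fixes x y :: real
  assumes "0 \<le> x" "0 \<le> y" "0 < a" "a \<le> 1"
  shows "\<bar>x powr a - y powr a\<bar> \<le> \<bar>x - y\<bar> powr a"
proof -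
  have sub: "(u + v) powr a \<le> u powr a + v powr a" if "0 \<le> u" "0 \<le> v" for u v :: real
  proof (cases "u + v = 0")
    case True
    then show ?thesis using that by auto
  next
    case False
    then have uv: "u + v > 0" using that by linarith
    have le: "t \<le> t powr a" if "0 \<le> t" "t \<le> 1" for t :: real
      using powr_mono'[of a 1 t] that assms by (cases "t = 0") auto
    have "1 = u / (u + v) + v / (u + v)" using uv by (simp flip: add_divide_distrib)
    also have "\<dots> \<le> (u / (u + v)) powr a + (v / (u + v)) powr a"
      using that uv by (intro add_mono le) auto
    also have "\<dots> = (u powr a + v powr a) / (u + v) powr a"
      using that uv by (simp add: powr_divide add_divide_distrib)
    finally show ?thesis using uv by (simp add: field_simps)
  qed
  show ?thesis
  proof (cases "x \<le> y")
    case True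
    with sub[of x "y - x"] assms powr_mono2[of a x y] show ?thesis by simp
  next
    case False
    with sub[of y "x - y"] assms powr_mono2[of a y x] show ?thesis by simp
  qed
qed

text \<open>The pointwise working form of membership in \<open>cring\<close>, equivalent up to
  constants for 0 < \<alpha> and \<alpha> at most 1. The weight at one point multiplies an
  unweighted difference, which is the shape in which averages of f - f(x) can use it.\<close>

definition weighted_holder :: "real \<Rightarrow> real \<Rightarrow> (real^2 \<Rightarrow> real) \<Rightarrow> bool" where
  "weighted_holder \<alpha> B f \<longleftrightarrow> f \<in> borel_measurable borel \<and> (\<forall>x. \<bar>f x\<bar> \<le> B) \<and>
     (\<forall>x y. norm x powr \<alpha> * \<bar>f x - f y\<bar> \<le> B * norm (x - y) powr \<alpha>)"

lemma norm_powr_diff_le: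
  assumes "0 < \<alpha>" "\<alpha> \<le> 1"
  shows "\<bar>norm x powr \<alpha> - norm y powr \<alpha>\<bar> \<le> norm (x - y) powr \<alpha>"
proof -
  have "\<bar>norm x powr \<alpha> - norm y powr \<alpha>\<bar> \<le> \<bar>norm x - norm y\<bar> powr \<alpha>"
    by (rule powr_diff_le) (use assms in auto)
  also have "\<dots> \<le> norm (x - y) powr \<alpha>"
    using assms by (intro powr_mono2 norm_triangle_ineq3) auto
  finally show ?thesis .
qed

lemma weighted_holder_cring:
  assumes "weighted_holder \<alpha> B f" "0 < \<alpha>" "\<alpha> \<le> 1"
  shows "f \<in> cring \<alpha>"
proof -
  have m: "f \<in> borel_measurable borel" and b: "\<And>x. \<bar>f x\<bar> \<le> B"
    and h: "\<And>x y. norm x powr \<alpha> * \<bar>f x - f y\<bar> \<le> B * norm (x - y) powr \<alpha>"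
    using assms(1) by (auto simp: weighted_holder_def)
  have "cring_seminorm \<alpha> f \<le> ereal (2 * B)"
    unfolding cring_seminorm_def
  proof (rule SUP_least, clarify)
    fix x y :: "real^2" assume "x \<noteq> y"
    have "norm x powr \<alpha> * f x - norm y powr \<alpha> * f y = norm x powr \<alpha> * (f x - f y) + (norm x powr \<alpha> - norm y powr \<alpha>) * f y"
      by (simp add: algebra_simps)
    also have "\<bar>\<dots>\<bar> \<le> norm x powr \<alpha> * \<bar>f x - f y\<bar> + \<bar>norm x powr \<alpha> - norm y powr \<alpha>\<bar> * \<bar>f y\<bar>"
      by (rule order_trans[OF abs_triangle_ineq]) (simp add: abs_mult)
    also have "\<dots> \<le> B * norm (x - y) powr \<alpha> + norm (x - y) powr \<alpha> * B"
      by (intro add_mono h mult_mono norm_powr_diff_le assms b) auto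
    finally show "ereal (\<bar>norm x powr \<alpha> * f x - norm y powr \<alpha> * f y\<bar> / norm (x - y) powr \<alpha>) \<le> ereal (2 * B)"
      using \<open>x \<noteq> y\<close> by (simp add: pos_divide_le_eq)
  qed
  moreover have "esssup lborel (\<lambda>x. ereal \<bar>f x\<bar>) \<le> ereal B"
    using m b by (intro esssup_I) auto
  ultimately have "cring_norm \<alpha> f \<le> ereal B + ereal (2 * B)"
    unfolding cring_norm_def by (intro add_mono)
  then have "cring_norm \<alpha> f < \<infinity>" by (auto intro: order_le_less_trans)
  with m show ?thesis by (simp add: cring_def)
qed

lemma cring_weighted_holder:
  assumes "f \<in> cring \<alpha>" "0 < \<alpha>" "\<alpha> \<le> 1"
  obtains B where "B > 0" "weighted_holder \<alpha> B f"
proof -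
  have m: "f \<in> borel_measurable borel" using assms(1) by (simp add: cring_def)
  have "cring_seminorm \<alpha> f \<noteq> \<infinity>"
    using assms(1) by (auto simp: cring_def cring_norm_def)
  then obtain n where n: "cring_seminorm \<alpha> f < ereal (real n)"
    using less_PInf_Ex_of_nat by blast
  define M where "M = real n"
  have M: "\<bar>norm x powr \<alpha> * f x - norm y powr \<alpha> * f y\<bar> \<le> M * norm (x - y) powr \<alpha>" for x y
  proof (cases "x = y")
    case False
    have "ereal (\<bar>norm x powr \<alpha> * f x - norm y powr \<alpha> * f y\<bar> / norm (x - y) powr \<alpha>) \<le> cring_seminorm \<alpha> f"
      unfolding cring_seminorm_def using False by (intro SUP_upper2[of "(x, y)"]) auto
    from order_trans[OF this less_imp_le[OF n]]
    have "ereal (\<bar>norm x powr \<alpha> * f x - norm y powr \<alpha> * f y\<bar> / norm (x - y) powr \<alpha>) \<le> ereal M"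
      by (simp only: M_def)
    with False show ?thesis by (simp add: pos_divide_le_eq)
  qed simp
  \<comment> \<open>Comparing x with the origin, where the weight vanishes, bounds |f| by
    \<open>M\<close> elsewhere. The value at 0 is invisible to the norm and is added by
    hand.\<close>
  define B where "B = M + \<bar>f 0\<bar> + 1"
  have B: "B > 0" "M \<le> B" by (simp_all add: B_def M_def)
  have b: "\<bar>f x\<bar> \<le> B" for x
  proof (cases "x = 0")
    case False
    have "norm x powr \<alpha> * \<bar>f x\<bar> \<le> norm x powr \<alpha> * M"
      using M[of x 0] assms by (simp add: abs_mult mult.commute)
    then have "\<bar>f x\<bar> \<le> M" using False by simp
    with B show ?thesis by simp
  qed (simp add: B_def M_def)
  have "weighted_holder \<alpha> (2 * B) f"
    unfolding weighted_holder_def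
  proof (intro conjI allI)
    fix x y :: "real^2"
    show "\<bar>f x\<bar> \<le> 2 * B" using b[of x] B by simp
    have "norm x powr \<alpha> * (f x - f y) = (norm x powr \<alpha> * f x - norm y powr \<alpha> * f y) - (norm x powr \<alpha> - norm y powr \<alpha>) * f y"
      by (simp add: algebra_simps)
    also have "\<bar>\<dots>\<bar> \<le> \<bar>norm x powr \<alpha> * f x - norm y powr \<alpha> * f y\<bar> + \<bar>norm x powr \<alpha> - norm y powr \<alpha>\<bar> * \<bar>f y\<bar>"
      by (rule order_trans[OF abs_triangle_ineq4]) (simp add: abs_mult)
    also have "\<dots> \<le> M * norm (x - y) powr \<alpha> + norm (x - y) powr \<alpha> * B"
      by (intro add_mono M mult_mono norm_powr_diff_le assms b) auto
    also have "\<dots> \<le> 2 * B * norm (x - y) powr \<alpha>"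
      using mult_right_mono[OF B(2), of "norm (x - y) powr \<alpha>"] by (simp add: algebra_simps)
    finally show "norm x powr \<alpha> * \<bar>f x - f y\<bar> \<le> 2 * B * norm (x - y) powr \<alpha>" by (simp add: abs_mult)
  qed (rule m)
  with B that[of "2 * B"] show ?thesis by simp
qed

section \<open>Summation over dyadic scales\<close>

abbreviation dyadic :: "int \<Rightarrow> real" where
  "dyadic k \<equiv> 2 powr real_of_int k"

text \<open>Measured from the largest scale in S, the terms lie below a geometric series of ratio
  2^(-a). The bound depends neither on S nor on r.\<close>

lemma sum_dyadic_low:
  assumes "0 < a" "0 < r" "finite S" "\<And>k. k \<in> S \<Longrightarrow> dyadic k \<le> r"
  shows "(\<Sum>k\<in>S. (dyadic k / r) powr a) \<le> 1 / (1 - 2 powr (- a))"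
proof (cases "S = {}")
  case True
  have "2 powr (-a) < (1::real)" using assms(1) powr_less_mono[of "-a" 0 2] by simp
  with True show ?thesis by simp
next
  case False
  define j where "j = Max S"
  have j: "j \<in> S" "\<And>k. k \<in> S \<Longrightarrow> k \<le> j" using False assms(3) by (auto simp: j_def)
  define \<theta> :: real where "\<theta> = 2 powr (-a)"
  have \<theta>: "0 < \<theta>" "\<theta> < 1" using assms(1) powr_less_mono[of "-a" 0 2] by (simp_all add: \<theta>_def)
  have "(\<Sum>k\<in>S. (dyadic k / r) powr a) \<le> (\<Sum>k\<in>S. \<theta> ^ nat (j - k))"
  proof (rule sum_mono)
    fix k assume k: "k \<in> S"
    have "(dyadic k / r) powr a \<le> (dyadic k / dyadic j) powr a"
      using assms(1,2) assms(4)[OF j(1)] by (intro powr_mono2 divide_left_mono) auto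
    also have "\<dots> = 2 powr ((real_of_int k - real_of_int j) * a)"
      by (simp add: powr_powr flip: powr_diff)
    also have "\<dots> = \<theta> powr (real (nat (j - k)))"
      using j(2)[OF k] by (simp add: \<theta>_def powr_powr algebra_simps)
    also have "\<dots> = \<theta> ^ nat (j - k)" using \<theta> by (simp add: powr_realpow)
    finally show "(dyadic k / r) powr a \<le> \<theta> ^ nat (j - k)" .
  qed
  also have "\<dots> = (\<Sum>n\<in>(\<lambda>k. nat (j - k)) ` S. \<theta> ^ n)"
  proof -
    have "inj_on (\<lambda>k. nat (j - k)) S"
    proof (rule inj_onI)
      fix x y assume "x \<in> S" "y \<in> S" "nat (j - x) = nat (j - y)"
      then show "x = y" using j(2)[of x] j(2)[of y] by simp
    qed
    then show ?thesis by (simp add: sum.reindex)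
  qed
  also have "\<dots> \<le> (\<Sum>n. \<theta> ^ n)"
    using \<theta> assms(3) by (intro sum_le_suminf summable_geometric) auto
  also have "\<dots> = 1 / (1 - \<theta>)" using \<theta> by (intro suminf_geometric) auto
  finally show ?thesis by (simp add: \<theta>_def)
qed

lemma sum_dyadic_high:
  assumes "0 < a" "0 < r" "finite S" "\<And>k. k \<in> S \<Longrightarrow> r \<le> dyadic k"
  shows "(\<Sum>k\<in>S. (r / dyadic k) powr a) \<le> 1 / (1 - 2 powr (- a))"
proof -
  have "(\<Sum>k\<in>S. (r / dyadic k) powr a) = (\<Sum>k\<in>uminus ` S. (dyadic k / (1 / r)) powr a)"
    by (subst sum.reindex) (auto simp: powr_minus field_simps intro!: sum.cong)
  also have "\<dots> \<le> 1 / (1 - 2 powr (- a))"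
    using assms by (intro sum_dyadic_low) (auto simp: powr_minus field_simps)
  finally show ?thesis .
qed

text \<open>Geometric decay in both directions from a critical scale r makes the whole sum
  comparable to a single term.\<close>

lemma sum_dyadic_split:
  assumes "finite S" "0 < a" "0 < b" "0 < r" "0 \<le> c"
    and "\<And>k. k \<in> S \<Longrightarrow> dyadic k \<le> r \<Longrightarrow> q k \<le> c * (dyadic k / r) powr a"
    and "\<And>k. k \<in> S \<Longrightarrow> r \<le> dyadic k \<Longrightarrow> q k \<le> c * (r / dyadic k) powr b"
  shows "(\<Sum>k\<in>S. q k) \<le> c * (1 / (1 - 2 powr (- a)) + 1 / (1 - 2 powr (- b)))"
proof -
  define S1 S2 where "S1 = {k\<in>S. dyadic k \<le> r}" and "S2 = {k\<in>S. \<not> dyadic k \<le> r}"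
  have S: "S = S1 \<union> S2" "S1 \<inter> S2 = {}" "finite S1" "finite S2" using assms(1) by (auto simp: S1_def S2_def)
  have "(\<Sum>k\<in>S. q k) = (\<Sum>k\<in>S1. q k) + (\<Sum>k\<in>S2. q k)"
    unfolding S(1) by (rule sum.union_disjoint) (use S in auto)
  also have "(\<Sum>k\<in>S1. q k) \<le> c * (\<Sum>k\<in>S1. (dyadic k / r) powr a)"
    unfolding sum_distrib_left by (intro sum_mono assms) (auto simp: S1_def)
  also have "\<dots> \<le> c * (1 / (1 - 2 powr (- a)))"
    by (intro mult_left_mono[OF _ assms(5)] sum_dyadic_low assms(2,4) S(3)) (simp add: S1_def)
  also have "(\<Sum>k\<in>S2. q k) \<le> c * (\<Sum>k\<in>S2. (r / dyadic k) powr b)"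
    unfolding sum_distrib_left by (intro sum_mono assms) (auto simp: S2_def)
  also have "\<dots> \<le> c * (1 / (1 - 2 powr (- b)))"
    by (intro mult_left_mono[OF _ assms(5)] sum_dyadic_high assms(3,4) S(4)) (simp add: S2_def)
  finally show ?thesis by (simp add: distrib_left)
qed

text \<open>Raising N by one adds the scales N and -N - 1. Pairing them turns a sum over all
  integers into an ordinary series.\<close>

lemma sum_symmetric_int:
  fixes q :: "int \<Rightarrow> 'a::ab_group_add"
  shows "(\<Sum>k\<in>{- int N..<int N}. q k) = (\<Sum>n<N. q (int n) + q (- int n - 1))"
proof (induction N)
  case (Suc N)
  have "{- int (Suc N)..<int (Suc N)} = insert (int N) (insert (- int N - 1) {- int N..<int N})" by auto
  with Suc show ?case by (simp add: algebra_simps)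
qed simp

text \<open>Two applications of \<open>sum_dyadic_split\<close>. For the size of T the critical
  scale is |x|, between \<open>small\<close> and \<open>large\<close>. For its oscillation the scale
  is |x - y|: below it the two terms are bounded separately by \<open>small\<close>, above it
  \<open>diff\<close> decays with exponent 1 - \<alpha>.\<close>

lemma dyadic_series:
  fixes p :: "int \<Rightarrow> real^2 \<Rightarrow> real"
  assumes \<alpha>: "0 < \<alpha>" "\<alpha> < 1" and C: "C > 0"
    and small: "\<And>k x. norm x powr \<alpha> * \<bar>p k x\<bar> \<le> C * dyadic k powr \<alpha>"
    and large: "\<And>k x. norm x \<le> dyadic k \<Longrightarrow> \<bar>p k x\<bar> \<le> C * (norm x / dyadic k)"
    and diff: "\<And>k x y. norm (x - y) \<le> dyadic k \<Longrightarrow>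
      norm x powr \<alpha> * \<bar>p k x - p k y\<bar> \<le> C * dyadic k powr \<alpha> * (norm (x - y) / dyadic k)"
    and cont: "\<And>k. continuous_on UNIV (p k)"
  obtains T D where "\<And>x. (\<lambda>N. \<Sum>k\<in>{- int N..<int N}. p k x) \<longlonglongrightarrow> T x"
    "\<And>N x. \<bar>\<Sum>k\<in>{- int N..<int N}. p k x\<bar> \<le> D" "weighted_holder \<alpha> D T"
proof -
  define A where "A = 1 / (1 - 2 powr (- \<alpha>)) + 1 / (1 - 2 powr (- 1 :: real))"
  define A' where "A' = 1 / (1 - 2 powr (- \<alpha>)) + 1 / (1 - 2 powr (- (1 - \<alpha>)))"
  have p0: "p k 0 = 0" for k using large[of 0 k] by simp
  have "2 powr (- \<alpha>) < (1::real)" using \<alpha> powr_less_mono[of "- \<alpha>" 0 2] by simp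
  then have A0: "A > 0" unfolding A_def by (intro add_pos_pos) (auto simp: powr_minus_divide)
  have abs: "(\<Sum>k\<in>S. \<bar>p k x\<bar>) \<le> C * A" if "finite S" for S x
  proof (cases "x = 0")
    case True
    then show ?thesis using p0 C A0 by simp
  next
    case False
    then have x: "norm x > 0" by simp
    show ?thesis unfolding A_def
    proof (rule sum_dyadic_split[OF that _ _ x])
      fix k
      show "\<bar>p k x\<bar> \<le> C * (dyadic k / norm x) powr \<alpha>"
        using small[of x k] x by (simp add: powr_divide field_simps)
      show "\<bar>p k x\<bar> \<le> C * (norm x / dyadic k) powr 1" if "norm x \<le> dyadic k"
        using large[OF that] by simp
    qed (use \<alpha> C in auto)
  qed
  define T where "T x = (\<Sum>n. p (int n) x + p (- int n - 1) x)" for x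
  have summ: "summable (\<lambda>n. p (int n) x + p (- int n - 1) x)" for x
  proof (rule summable_comparison_test'[where N = 0])
    show "summable (\<lambda>n. \<bar>p (int n) x\<bar> + \<bar>p (- int n - 1) x\<bar>)"
      by (rule summableI_nonneg_bounded[where x = "C * A"])
        (use abs[of "{- int n..<int n}" x for n] in \<open>auto simp: sum_symmetric_int\<close>)
  qed auto
  have lim: "(\<lambda>N. \<Sum>k\<in>{- int N..<int N}. p k x) \<longlonglongrightarrow> T x" for x
    using summable_LIMSEQ[OF summ[of x]] by (simp add: sum_symmetric_int T_def)
  have bound: "\<bar>\<Sum>k\<in>{- int N..<int N}. p k x\<bar> \<le> C * A" for N x
    by (rule order_trans[OF sum_abs abs]) simp
  have Tb: "\<bar>T x\<bar> \<le> C * A" for x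
    by (rule LIMSEQ_le_const2[OF tendsto_rabs[OF lim]]) (use bound in auto)
  \<comment> \<open>With x the point nearer to the origin, its weight is at most the weight at y, so
    \<open>small\<close> also controls the term at y.\<close>
  have hold: "norm x powr \<alpha> * \<bar>T x - T y\<bar> \<le> 2 * C * A' * norm (x - y) powr \<alpha>" if xy: "norm x \<le> norm y" for x y
  proof (cases "x = y")
    case False
    then have d: "norm (x - y) > 0" by simp
    have part: "norm x powr \<alpha> * \<bar>(\<Sum>k\<in>S. p k x) - (\<Sum>k\<in>S. p k y)\<bar> \<le> 2 * C * A' * norm (x - y) powr \<alpha>"
      if "finite S" for S
    proof -
      have "norm x powr \<alpha> * \<bar>(\<Sum>k\<in>S. p k x) - (\<Sum>k\<in>S. p k y)\<bar> \<le> (\<Sum>k\<in>S. norm x powr \<alpha> * \<bar>p k x - p k y\<bar>)"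
        unfolding sum_subtractf[symmetric] sum_distrib_left[symmetric] by (intro mult_left_mono sum_abs) simp
      also have "\<dots> \<le> (2 * C * norm (x - y) powr \<alpha>) * A'"
        unfolding A'_def
      proof (rule sum_dyadic_split[OF that _ _ d])
        fix k
        show "norm x powr \<alpha> * \<bar>p k x - p k y\<bar> \<le> 2 * C * norm (x - y) powr \<alpha> * (dyadic k / norm (x - y)) powr \<alpha>"
        proof -
          have "norm x powr \<alpha> * \<bar>p k x - p k y\<bar> \<le> norm x powr \<alpha> * (\<bar>p k x\<bar> + \<bar>p k y\<bar>)"
            by (intro mult_left_mono abs_triangle_ineq4) simp
          also have "\<dots> \<le> norm x powr \<alpha> * \<bar>p k x\<bar> + norm y powr \<alpha> * \<bar>p k y\<bar>"
            using xy \<alpha> by (simp add: distrib_left mult_right_mono powr_mono2)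
          also have "\<dots> \<le> 2 * C * dyadic k powr \<alpha>" using small[of x k] small[of y k] by simp
          also have "\<dots> = 2 * C * norm (x - y) powr \<alpha> * (dyadic k / norm (x - y)) powr \<alpha>"
            using d by (simp add: powr_divide)
          finally show ?thesis .
        qed
        assume k: "norm (x - y) \<le> dyadic k"
        have "C * dyadic k powr \<alpha> * (norm (x - y) / dyadic k) = C * norm (x - y) powr \<alpha> * (norm (x - y) / dyadic k) powr (1 - \<alpha>)"
        proof -
          have "(norm (x - y) / dyadic k) powr (1 - \<alpha>) = (norm (x - y) / dyadic k) powr 1 / (norm (x - y) / dyadic k) powr \<alpha>"
            by (rule powr_diff)
          also have "\<dots> = (norm (x - y) / dyadic k) * dyadic k powr \<alpha> / norm (x - y) powr \<alpha>"
            using d by (simp add: powr_divide)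
          finally show ?thesis using d by simp
        qed
        with diff[OF k] have "norm x powr \<alpha> * \<bar>p k x - p k y\<bar> \<le> C * norm (x - y) powr \<alpha> * (norm (x - y) / dyadic k) powr (1 - \<alpha>)"
          by simp
        also have "\<dots> \<le> 2 * C * norm (x - y) powr \<alpha> * (norm (x - y) / dyadic k) powr (1 - \<alpha>)"
          using C by (intro mult_right_mono) auto
        finally show "norm x powr \<alpha> * \<bar>p k x - p k y\<bar> \<le> 2 * C * norm (x - y) powr \<alpha> * (norm (x - y) / dyadic k) powr (1 - \<alpha>)" .
      qed (use \<alpha> C in auto)
      finally show ?thesis by (simp add: mult_ac)
    qed
    show ?thesis
      by (rule LIMSEQ_le_const2[OF tendsto_mult_left[OF tendsto_rabs[OF tendsto_diff[OF lim lim]]]]) (use part in auto)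
  qed simp
  define D where "D = 2 * C * A' + 2 * (C * A)"
  have "2 powr (- (1 - \<alpha>)) < (1::real)" using \<alpha> powr_less_mono[of "- (1 - \<alpha>)" 0 2] by simp
  with \<open>2 powr (- \<alpha>) < 1\<close> have A'0: "A' > 0" unfolding A'_def by (intro add_pos_pos) auto
  have D: "C * A \<le> D" using C A0 A'0 by (simp add: D_def)
  have "weighted_holder \<alpha> D T"
    unfolding weighted_holder_def
  proof (intro conjI allI)
    show "T \<in> borel_measurable borel"
      by (rule borel_measurable_LIMSEQ_real[OF lim]) (intro borel_measurable_continuous_onI continuous_on_sum cont)
    fix x y
    show "\<bar>T x\<bar> \<le> D" using Tb[of x] D by simp
    show "norm x powr \<alpha> * \<bar>T x - T y\<bar> \<le> D * norm (x - y) powr \<alpha>"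
    proof (cases "norm x \<le> norm y")
      case True
      have "2 * C * A' * norm (x - y) powr \<alpha> \<le> D * norm (x - y) powr \<alpha>"
        using C A0 by (intro mult_right_mono) (auto simp: D_def)
      with hold[OF True] show ?thesis by simp
    next
      case False
      \<comment> \<open>Moving the weight to the nearer point costs the difference of the weights,
        which is at most |x - y|^\<alpha>, times twice the bound on T.\<close>
      have "norm x powr \<alpha> * \<bar>T x - T y\<bar> = norm y powr \<alpha> * \<bar>T y - T x\<bar> + (norm x powr \<alpha> - norm y powr \<alpha>) * \<bar>T x - T y\<bar>"
        by (simp add: algebra_simps abs_minus_commute)
      also have "\<dots> \<le> 2 * C * A' * norm (x - y) powr \<alpha> + norm (x - y) powr \<alpha> * (2 * (C * A))"
      proof (rule add_mono)
        show "norm y powr \<alpha> * \<bar>T y - T x\<bar> \<le> 2 * C * A' * norm (x - y) powr \<alpha>"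
          using hold[of y x] False by (simp add: norm_minus_commute)
        show "(norm x powr \<alpha> - norm y powr \<alpha>) * \<bar>T x - T y\<bar> \<le> norm (x - y) powr \<alpha> * (2 * (C * A))"
        proof (rule mult_mono)
        show "norm x powr \<alpha> - norm y powr \<alpha> \<le> norm (x - y) powr \<alpha>"
          using norm_powr_diff_le[of \<alpha> x y] \<alpha> by simp
        show "\<bar>T x - T y\<bar> \<le> 2 * (C * A)" using Tb[of x] Tb[of y] by simp
        qed auto
      qed
      also have "\<dots> = D * norm (x - y) powr \<alpha>" by (simp add: D_def algebra_simps)
      finally show ?thesis .
    qed
  qed
  moreover have "\<bar>\<Sum>k\<in>{- int N..<int N}. p k x\<bar> \<le> D" for N x by (rule order_trans[OF bound D])
  ultimately show ?thesis using that lim by blast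
qed

text \<open>First derivatives of a radial kernel are coordinates times a radial function, and second
  derivatives are quadratic monomials times one, plus a radial term common to both diagonal entries.
  Absorbing l into F reduces everything to \<open>first_mode_zero\<close> and
  \<open>second_mode_zero\<close>.\<close>

lemma radial_modes:
  assumes E: "smooth_line E" "\<And>s. DERIV E s :> E1 s" "\<And>s. DERIV E1 s :> E2 s" "\<And>s. s > 16 \<Longrightarrow> E s = 0"
    and F: "locally_bounded F" "rot_symmetric m F" and m: "m \<ge> 3"
  defines "K \<equiv> \<lambda>z::real^2. E ((norm z)\<^sup>2)"
  shows "average F (partial i K) l 0 = 0"
    "average F (partial 1 (partial 2 K)) l 0 = 0" "average F (partial 2 (partial 1 K)) l 0 = 0"
    "average F (partial 1 (partial 1 K)) l 0 = average F (partial 2 (partial 2 K)) l 0"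
proof -
  have E1z: "E1 s = 0" if "s > 16" for s
  proof -
    have "DERIV E s :> 0"
      by (rule has_field_derivative_transform_within_open[of "\<lambda>_. 0" _ _ "{16<..}"]) (use that E(4) in auto)
    then show ?thesis using E(2) DERIV_unique by blast
  qed
  have E2z: "E2 s = 0" if "s > 16" for s
  proof -
    have "DERIV E1 s :> 0"
      by (rule has_field_derivative_transform_within_open[of "\<lambda>_. 0" _ _ "{16<..}"]) (use that E1z in auto)
    then show ?thesis using E(3) DERIV_unique by blast
  qed
  have s1: "smooth_line E1" by (rule smooth_line_deriv[OF E(1,2)])
  have s2: "smooth_line E2" by (rule smooth_line_deriv[OF s1 E(3)])
  have t1: "test_function (\<lambda>z. E1 ((norm z)\<^sup>2))" by (rule test_function_radial[OF s1 E1z])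
  have t2: "test_function (\<lambda>z. E2 ((norm z)\<^sup>2))" by (rule test_function_radial[OF s2 E2z])
  define F' where "F' v = F (l *\<^sub>R v)" for v
  have lF: "locally_bounded F'" using locally_bounded_affine[OF F(1), of 0 l] by (simp add: F'_def[abs_def])
  have sF: "rot_symmetric m F'" using rot_symmetric_scale[OF F(2)] by (simp add: F'_def[abs_def])
  note r1 = first_mode_zero[OF lF sF m t1] and r2 = second_mode_zero[OF lF sF m t2]
  note pp = partial_partial_radial[OF E(1-3)]
  have "average F (partial i K) l 0 = (LINT v|lborel. -2 * (F' v * (v$i * E1 ((norm v)\<^sup>2))))"
    unfolding average_at_0 K_def partial_radial[OF E(2)] F'_def[symmetric]
    by (rule Bochner_Integration.integral_cong) auto
  also have "\<dots> = 0" using r1 by (simp add: norm_rotation del: mult_minus_left)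
  finally show "average F (partial i K) l 0 = 0" .
  have "average F (partial 1 (partial 2 K)) l 0 = (LINT v|lborel. 4 * (F' v * (v$1 * (v$2 * E2 ((norm v)\<^sup>2)))))"
    unfolding average_at_0 K_def pp F'_def[symmetric]
    by (rule Bochner_Integration.integral_cong) auto
  also have "\<dots> = 0" using r2(2) by (simp add: norm_rotation)
  finally show "average F (partial 1 (partial 2 K)) l 0 = 0" .
  have "average F (partial 2 (partial 1 K)) l 0 = (LINT v|lborel. 4 * (F' v * (v$1 * (v$2 * E2 ((norm v)\<^sup>2)))))"
    unfolding average_at_0 K_def pp F'_def[symmetric]
    by (rule Bochner_Integration.integral_cong) auto
  also have "\<dots> = 0" using r2(2) by (simp add: norm_rotation)
  finally show "average F (partial 2 (partial 1 K)) l 0 = 0" .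
  have pure: "average F (partial i (partial i K)) l 0 =
    4 * (LINT v|lborel. F' v * (v$i * (v$i * E2 ((norm v)\<^sup>2)))) + 2 * (LINT v|lborel. F' v * E1 ((norm v)\<^sup>2))" for i
  proof -
    have "average F (partial i (partial i K)) l 0 =
      (LINT v|lborel. 4 * (F' v * (v$i * (v$i * E2 ((norm v)\<^sup>2)))) + 2 * (F' v * E1 ((norm v)\<^sup>2)))"
      unfolding average_at_0 K_def pp F'_def[symmetric]
      by (rule Bochner_Integration.integral_cong) (auto simp: algebra_simps)
    also have "\<dots> = 4 * (LINT v|lborel. F' v * (v$i * (v$i * E2 ((norm v)\<^sup>2)))) + 2 * (LINT v|lborel. F' v * E1 ((norm v)\<^sup>2))"
    proof (subst Bochner_Integration.integral_add)
      show "integrable lborel (\<lambda>v. 4 * (F' v * (v$i * (v$i * E2 ((norm v)\<^sup>2)))))"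
        by (intro integrable_mult_right integrable_locally_bounded_test test_function_mult C_k_component lF t2)
      show "integrable lborel (\<lambda>v. 2 * (F' v * E1 ((norm v)\<^sup>2)))"
        by (intro integrable_mult_right integrable_locally_bounded_test lF t1)
    qed simp
    finally show ?thesis .
  qed
  show "average F (partial 1 (partial 1 K)) l 0 = average F (partial 2 (partial 2 K)) l 0"
    using r2(1) by (simp add: pure norm_rotation)
qed

section \<open>Averages of weighted Hoelder functions\<close>

lemma weighted_holder_locally_bounded: "weighted_holder \<alpha> B f \<Longrightarrow> locally_bounded f"
  by (auto simp: weighted_holder_def locally_bounded_def)

text \<open>The weighted bounds apply \<open>average_bounds\<close> to f - f(x): on the ball of
  radius R l around x this is at most B (R l)^\<alpha> / |x|^\<alpha>. For a kernel of mean zero the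
  subtracted constant leaves no trace.\<close>

lemma weighted_holder_average:
  assumes f: "weighted_holder \<alpha> B f" and \<alpha>: "0 < \<alpha>" and K: "test_function K"
  obtains C where "C > 0"
    "\<And>l x. l > 0 \<Longrightarrow> \<bar>average f K l x\<bar> \<le> C"
    "\<And>l x y. l > 0 \<Longrightarrow> norm (x - y) \<le> l \<Longrightarrow> \<bar>average f K l x - average f K l y\<bar> \<le> C * (norm (x - y) / l)"
    "\<And>l x. l > 0 \<Longrightarrow> norm x powr \<alpha> * \<bar>average f K l x - f x * (LINT z|lborel. K z)\<bar> \<le> C * l powr \<alpha>"
    "\<And>l x y. \<lbrakk>(LINT z|lborel. K z) = 0; l > 0; norm (x - y) \<le> l\<rbrakk> \<Longrightarrow>
       norm x powr \<alpha> * \<bar>average f K l x - average f K l y\<bar> \<le> C * l powr \<alpha> * (norm (x - y) / l)"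
proof -
  have fb: "\<bar>f x\<bar> \<le> B" and fh: "norm x powr \<alpha> * \<bar>f x - f y\<bar> \<le> B * norm (x - y) powr \<alpha>" for x y
    using f by (auto simp: weighted_holder_def)
  have B: "B \<ge> 0" using fb[of 0] by linarith
  have lf: "locally_bounded f" by (rule weighted_holder_locally_bounded[OF f])
  have lfc: "locally_bounded (\<lambda>v. f v - c)" for c
  proof -
    have "\<bar>f v - c\<bar> \<le> B + \<bar>c\<bar>" for v using fb[of v] by linarith
    moreover have "(\<lambda>v. f v - c) \<in> borel_measurable borel" using locally_bounded_measurable[OF lf] by simp
    ultimately show ?thesis unfolding locally_bounded_def by blast
  qed
  obtain C R where C: "C > 0" and R: "R > 0"
    and size: "\<And>F c l x. \<lbrakk>l > 0; c \<ge> 0; \<And>w. norm (w - x) \<le> R * l \<Longrightarrow> \<bar>F w\<bar> \<le> c\<rbrakk> \<Longrightarrow> \<bar>average F K l x\<bar> \<le> C * c"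
    and diff: "\<And>F c l x y. \<lbrakk>locally_bounded F; l > 0; c \<ge> 0; norm (x - y) \<le> l; \<And>w. norm (w - x) \<le> R * l \<Longrightarrow> \<bar>F w\<bar> \<le> c\<rbrakk>
      \<Longrightarrow> \<bar>average F K l x - average F K l y\<bar> \<le> C * c * (norm (x - y) / l)"
    apply (rule average_bounds[OF K])
    subgoal premises p for C R by (rule p(1)[OF p(2-)])
    done
  \<comment> \<open>One constant above both C B, for the plain bounds, and C B R^\<alpha>, for the
    weighted ones.\<close>
  define D where "D = C * (B + 1) * (1 + R powr \<alpha>)"
  have CB: "C * B \<le> D" "C * B * R powr \<alpha> \<le> D" "D > 0"
  proof -
    have "B + 1 > 0" "1 + R powr \<alpha> > 0" using B by (simp_all add: add_pos_nonneg)
    then show "D > 0" unfolding D_def using C by simp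
    have "C * B \<le> C * (B + 1)" using C by simp
    also have "\<dots> \<le> D" using C B by (simp add: D_def distrib_left)
    finally show "C * B \<le> D" .
    have "C * B * R powr \<alpha> \<le> C * (B + 1) * (1 + R powr \<alpha>)"
      using C B by (intro mult_mono) auto
    then show "C * B * R powr \<alpha> \<le> D" by (simp add: D_def)
  qed
  have near: "\<bar>f w - f x\<bar> \<le> B * (R * l) powr \<alpha> / norm x powr \<alpha>" if "x \<noteq> 0" "norm (w - x) \<le> R * l" for w x l
  proof -
    have "norm x powr \<alpha> * \<bar>f w - f x\<bar> \<le> B * norm (x - w) powr \<alpha>" using fh[of x w] by (simp add: abs_minus_commute)
    also have "\<dots> \<le> B * (R * l) powr \<alpha>"
      using that B \<alpha> by (intro mult_left_mono powr_mono2) (auto simp: norm_minus_commute)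
    finally show ?thesis using that by (simp add: pos_le_divide_eq mult.commute)
  qed
  show ?thesis
  proof (rule that[of D])
    show "D > 0" by (rule CB)
    fix l :: real and x y :: "real^2" assume l: "l > 0"
    show "\<bar>average f K l x\<bar> \<le> D"
      using size[of l B x f] l B fb CB(1) by fastforce
    show "norm x powr \<alpha> * \<bar>average f K l x - f x * (LINT z|lborel. K z)\<bar> \<le> D * l powr \<alpha>"
    proof (cases "x = 0")
      case False
      have "\<bar>average (\<lambda>v. f v - f x) K l x\<bar> \<le> C * (B * (R * l) powr \<alpha> / norm x powr \<alpha>)"
        using l B by (intro size near[OF False]) auto
      then have "norm x powr \<alpha> * \<bar>average f K l x - f x * (LINT z|lborel. K z)\<bar> \<le> norm x powr \<alpha> * (C * (B * (R * l) powr \<alpha> / norm x powr \<alpha>))"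
        unfolding average_shift[OF lf K l] by (rule mult_left_mono) simp
      also have "\<dots> = C * B * R powr \<alpha> * l powr \<alpha>"
        using False R l by (simp add: powr_mult)
      also have "\<dots> \<le> D * l powr \<alpha>" by (intro mult_right_mono CB) simp
      finally show ?thesis .
    qed (use CB in simp)
    assume xy: "norm (x - y) \<le> l"
    have "\<bar>average f K l x - average f K l y\<bar> \<le> C * B * (norm (x - y) / l)"
      by (rule diff[OF lf l B xy]) (rule fb)
    also have "\<dots> \<le> D * (norm (x - y) / l)" using l by (intro mult_right_mono CB) simp
    finally show "\<bar>average f K l x - average f K l y\<bar> \<le> D * (norm (x - y) / l)" .
    assume zero: "(LINT z|lborel. K z) = 0"
    show "norm x powr \<alpha> * \<bar>average f K l x - average f K l y\<bar> \<le> D * l powr \<alpha> * (norm (x - y) / l)"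
    proof (cases "x = 0")
      case False
      have "\<bar>average (\<lambda>v. f v - f x) K l x - average (\<lambda>v. f v - f x) K l y\<bar>
        \<le> C * (B * (R * l) powr \<alpha> / norm x powr \<alpha>) * (norm (x - y) / l)"
        using l B by (intro diff lfc xy near[OF False]) auto
      then have "norm x powr \<alpha> * \<bar>average f K l x - average f K l y\<bar> \<le>
        norm x powr \<alpha> * (C * (B * (R * l) powr \<alpha> / norm x powr \<alpha>) * (norm (x - y) / l))"
        unfolding average_shift[OF lf K l] zero by (intro mult_left_mono) simp_all
      also have "\<dots> = C * B * R powr \<alpha> * (l powr \<alpha> * (norm (x - y) / l))"
        using False R l by (simp add: powr_mult)
      also have "\<dots> \<le> D * (l powr \<alpha> * (norm (x - y) / l))" using l by (intro mult_right_mono CB) simp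
      finally show ?thesis by (simp add: mult.assoc)
    qed (use CB l in simp)
  qed
qed

text \<open>Mean zero of the kernel supplies \<open>small\<close> and \<open>diff\<close>. Vanishing
  at the origin supplies \<open>large\<close>, by the Lipschitz bound between x and 0.\<close>

lemma average_dyadic_series:
  assumes f: "weighted_holder \<alpha> B f" and \<alpha>: "0 < \<alpha>" "\<alpha> < 1" and K: "test_function K"
    and zero: "(LINT z|lborel. K z) = 0" "\<And>l. l > 0 \<Longrightarrow> average f K l 0 = 0"
  obtains T D where "\<And>x. (\<lambda>N. \<Sum>k\<in>{- int N..<int N}. average f K (dyadic k) x) \<longlonglongrightarrow> T x"
    "\<And>N x. \<bar>\<Sum>k\<in>{- int N..<int N}. average f K (dyadic k) x\<bar> \<le> D" "weighted_holder \<alpha> D T"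
proof -
  obtain C where C: "C > 0"
    "\<And>l x. l > 0 \<Longrightarrow> \<bar>average f K l x\<bar> \<le> C"
    "\<And>l x y. l > 0 \<Longrightarrow> norm (x - y) \<le> l \<Longrightarrow> \<bar>average f K l x - average f K l y\<bar> \<le> C * (norm (x - y) / l)"
    "\<And>l x. l > 0 \<Longrightarrow> norm x powr \<alpha> * \<bar>average f K l x - f x * (LINT z|lborel. K z)\<bar> \<le> C * l powr \<alpha>"
    "\<And>l x y. \<lbrakk>(LINT z|lborel. K z) = 0; l > 0; norm (x - y) \<le> l\<rbrakk> \<Longrightarrow>
       norm x powr \<alpha> * \<bar>average f K l x - average f K l y\<bar> \<le> C * l powr \<alpha> * (norm (x - y) / l)"
    by (rule weighted_holder_average[OF f \<alpha>(1) K]) (rule that)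
  show ?thesis
  proof (rule dyadic_series[OF \<alpha> C(1), of "\<lambda>k. average f K (dyadic k)"])
    fix k :: int and x y :: "real^2"
    show "norm x powr \<alpha> * \<bar>average f K (dyadic k) x\<bar> \<le> C * dyadic k powr \<alpha>"
      using C(4)[of "dyadic k" x] zero(1) by simp
    show "\<bar>average f K (dyadic k) x\<bar> \<le> C * (norm x / dyadic k)" if "norm x \<le> dyadic k"
      using C(3)[of "dyadic k" x 0] that zero(2) by simp
    show "norm x powr \<alpha> * \<bar>average f K (dyadic k) x - average f K (dyadic k) y\<bar>
      \<le> C * dyadic k powr \<alpha> * (norm (x - y) / dyadic k)" if "norm (x - y) \<le> dyadic k"
      using C(5)[OF zero(1) _ that] by simp
    show "continuous_on UNIV (average f K (dyadic k))"
      by (rule average_continuous[OF weighted_holder_locally_bounded[OF f] K]) simp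
  qed (rule that)
qed

lemma average_rotation:
  assumes "locally_bounded F" "rot_symmetric m F" "test_function K" "\<And>\<theta> v. K (rotation \<theta> v) = K v"
  shows "average F K l (rotation (2 * pi / real m) x) = average F K l x"
proof -
  let ?R = "rotation (2 * pi / real m)"
  have "(\<lambda>v. F (l *\<^sub>R v) * K ((1/l) *\<^sub>R ?R x - v)) \<in> borel_measurable borel"
    using average_integrable[OF assms(1,3)] by auto
  from integral_rotation[OF this, of "2 * pi / real m"]
  have "average F K l (?R x) = (LINT v|lborel. F (l *\<^sub>R ?R v) * K ((1/l) *\<^sub>R ?R x - ?R v))"
    by (simp add: average_def)
  also have "\<dots> = (LINT v|lborel. F (?R (l *\<^sub>R v)) * K (?R ((1/l) *\<^sub>R x - v)))"
    by (simp only: linear_cmul[OF rotation_linear] linear_diff[OF rotation_linear])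
  also have "\<dots> = average F K l x"
    using assms(2) by (simp add: average_def assms(4) rot_symmetric_def)
  finally show ?thesis .
qed

section \<open>Existence\<close>

lemma weighted_holder_lincomb:
  assumes "weighted_holder \<alpha> B f" "weighted_holder \<alpha> D h"
  shows "weighted_holder \<alpha> (\<bar>a\<bar> * B + \<bar>b\<bar> * D) (\<lambda>x. a * f x + b * h x)"
  unfolding weighted_holder_def
proof (intro conjI allI)
  have "f \<in> borel_measurable borel" "h \<in> borel_measurable borel"
    using assms by (simp_all add: weighted_holder_def)
  then show "(\<lambda>x. a * f x + b * h x) \<in> borel_measurable borel" by simp
  fix x y
  have f: "\<bar>f x\<bar> \<le> B" "norm x powr \<alpha> * \<bar>f x - f y\<bar> \<le> B * norm (x - y) powr \<alpha>"
    and h: "\<bar>h x\<bar> \<le> D" "norm x powr \<alpha> * \<bar>h x - h y\<bar> \<le> D * norm (x - y) powr \<alpha>"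
    using assms by (auto simp: weighted_holder_def)
  have "\<bar>a * f x + b * h x\<bar> \<le> \<bar>a\<bar> * \<bar>f x\<bar> + \<bar>b\<bar> * \<bar>h x\<bar>"
    by (rule order_trans[OF abs_triangle_ineq]) (simp add: abs_mult)
  also have "\<dots> \<le> \<bar>a\<bar> * B + \<bar>b\<bar> * D" by (intro add_mono mult_left_mono f h) auto
  finally show "\<bar>a * f x + b * h x\<bar> \<le> \<bar>a\<bar> * B + \<bar>b\<bar> * D" .
  have "a * f x + b * h x - (a * f y + b * h y) = a * (f x - f y) + b * (h x - h y)" by (simp add: algebra_simps)
  also have "\<bar>\<dots>\<bar> \<le> \<bar>a\<bar> * \<bar>f x - f y\<bar> + \<bar>b\<bar> * \<bar>h x - h y\<bar>"
    by (rule order_trans[OF abs_triangle_ineq]) (simp add: abs_mult)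
  finally have "norm x powr \<alpha> * \<bar>a * f x + b * h x - (a * f y + b * h y)\<bar>
    \<le> norm x powr \<alpha> * (\<bar>a\<bar> * \<bar>f x - f y\<bar> + \<bar>b\<bar> * \<bar>h x - h y\<bar>)"
    by (rule mult_left_mono) simp
  also have "\<dots> = \<bar>a\<bar> * (norm x powr \<alpha> * \<bar>f x - f y\<bar>) + \<bar>b\<bar> * (norm x powr \<alpha> * \<bar>h x - h y\<bar>)"
    by (simp add: algebra_simps)
  also have "\<dots> \<le> \<bar>a\<bar> * (B * norm (x - y) powr \<alpha>) + \<bar>b\<bar> * (D * norm (x - y) powr \<alpha>)"
    by (intro add_mono mult_left_mono f h) auto
  finally show "norm x powr \<alpha> * \<bar>a * f x + b * h x - (a * f y + b * h y)\<bar> \<le> (\<bar>a\<bar> * B + \<bar>b\<bar> * D) * norm (x - y) powr \<alpha>"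
    by (simp add: algebra_simps)
qed

lemma locally_bounded_locally_integrable:
  assumes "locally_bounded F"
  shows "locally_integrable F"
  unfolding locally_integrable_def set_integrable_def
proof (intro allI impI)
  fix K :: "(real^2) set" assume K: "compact K"
  then obtain r where r: "\<And>x. x \<in> K \<Longrightarrow> norm x \<le> r"
    using compact_imp_bounded bounded_iff by metis
  obtain c where c: "c > 0" "\<And>x. norm x \<le> r \<Longrightarrow> \<bar>F x\<bar> \<le> c" using locally_boundedE[OF assms] by metis
  show "integrable lborel (\<lambda>x. indicator K x *\<^sub>R F x)"
  proof (rule integrable_bounded_support[of _ 0 r c])
    show "(\<lambda>x. indicator K x *\<^sub>R F x) \<in> borel_measurable borel"
      using locally_bounded_measurable[OF assms] compact_imp_closed[OF K] by (simp add: borel_closed)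
    show "\<bar>indicator K v *\<^sub>R F v\<bar> \<le> c" if "v \<in> cball 0 r" for v
      using that c by (cases "v \<in> K") (auto simp: dist_norm)
    show "indicator K v *\<^sub>R F v = 0" if "v \<notin> cball 0 r" for v
      using that r[of v] by (cases "v \<in> K") (auto simp: dist_norm)
  qed
qed

lemma sum_telescope_int:
  fixes h :: "int \<Rightarrow> real"
  assumes "a \<le> b"
  shows "(\<Sum>k\<in>{a..<b}. h (k + 1) - h k) = h b - h a"
  using assms
proof (induction b rule: int_ge_induct)
  case (step b)
  then have "{a..<b + 1} = insert b {a..<b}" by auto
  with step show ?case by simp
qed simp

lemma smooth_line_ident: "smooth_line (\<lambda>s. s)"
proof (rule smooth_lineI)
  show "DERIV (\<lambda>s. s) x :> 1" for x :: real by (rule DERIV_ident)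
  show "smooth_line (\<lambda>_. 1)" by (simp add: smooth_line_def C_k_line_const)
qed

text \<open>The correction term of the potential has this weak Hessian, twice the identity; its
  factor 1/4 becomes the 1/2 on the diagonal of the approximating Hessians.\<close>

lemma integral_hessian_norm_power2:
  assumes "test_function \<phi>"
  shows "(LINT x|lborel. (norm x)\<^sup>2 * partial i (partial j \<phi>) x) = (if i = j then 2 * (LINT x|lborel. \<phi> x) else 0)"
proof -
  have C: "C_k k (\<lambda>z. (norm z)\<^sup>2)" for k using C_k_radial[OF smooth_line_ident] by simp
  have p: "partial i (\<lambda>z. (norm z)\<^sup>2) = (\<lambda>x. 2 * x$i)"
    using partial_radial[of "\<lambda>s. s" "\<lambda>_. 1" i] DERIV_ident by simp
  have "(LINT x|lborel. (norm x)\<^sup>2 * partial i (partial j \<phi>) x) = - (LINT x|lborel. 2 * (x$i * partial j \<phi> x))"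
    using integral_by_parts_test_function[OF test_function_partial[OF assms] C, of i j] by (simp add: p mult.assoc)
  also have "\<dots> = 2 * (LINT x|lborel. partial j (\<lambda>x. x$i) x * \<phi> x)"
    using integral_by_parts_test_function[OF assms C_k_component[of _ i], of j] by simp
  also have "\<dots> = (if i = j then 2 * (LINT x|lborel. \<phi> x) else 0)"
    by (simp add: partial_component)
  finally show ?thesis .
qed

text \<open>\<open>E\<close> and \<open>G\<close> are the profiles of the kernels Gamma and g. They
  are fixed together with f because existence and uniqueness work with the same pair.\<close>

locale potential =
  fixes E E1 E2 G :: "real \<Rightarrow> real" and f :: "real^2 \<Rightarrow> real" and m :: nat and \<alpha> B :: real
  assumes sE: "smooth_line E" and dE: "\<And>s. DERIV E s :> E1 s" and dE1: "\<And>s. DERIV E1 s :> E2 s"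
    and E0: "\<And>s. s \<ge> 16 \<Longrightarrow> E s = 0" and sG: "smooth_line G" and G0: "\<And>s. s \<ge> 16 \<Longrightarrow> G s = 0"
    and radial_laplacian: "\<And>s. 4 * s * E2 s + 4 * E1 s = G (s / 4) / 4 - G s"
    and mass: "(LINT z::real^2|lborel. G ((norm z)\<^sup>2)) = 1"
    and f_weighted_holder: "weighted_holder \<alpha> B f" and sym: "rot_symmetric m f" and m: "m \<ge> 3"
    and \<alpha>: "0 < \<alpha>" "\<alpha> < 1"
begin

definition bump :: "real^2 \<Rightarrow> real" where "bump z = G ((norm z)\<^sup>2)"
definition block :: "real^2 \<Rightarrow> real" where "block z = E ((norm z)\<^sup>2)"
definition u :: "int \<Rightarrow> real^2 \<Rightarrow> real" where "u k x = average f bump (dyadic k) x"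
definition w :: "int \<Rightarrow> real^2 \<Rightarrow> real" where "w k x = (dyadic k)\<^sup>2 * average f block (dyadic k) x"
text \<open>A block without its second-order Taylor polynomial at 0. The difference of the
  \<open>u\<close> is the Laplacian of \<open>w k\<close> at the origin, and a radial quadratic c
  |x|^2 has Laplacian 4 c, whence the factor 1/4.\<close>

definition t :: "int \<Rightarrow> real^2 \<Rightarrow> real" where
  "t k x = w k x - w k 0 - (norm x)\<^sup>2 / 4 * (u (k + 1) 0 - u k 0)"
definition pot :: "nat \<Rightarrow> real^2 \<Rightarrow> real" where
  "pot N x = (\<Sum>k\<in>{- int N..<int N}. w k x - w k 0) - (norm x)\<^sup>2 / 4 * u (int N) 0"

lemma test_bump: "test_function bump"
  unfolding bump_def[abs_def] by (rule test_function_radial[OF sG]) (simp add: G0)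

lemma test_block: "test_function block"
  unfolding block_def[abs_def] by (rule test_function_radial[OF sE]) (simp add: E0)

lemmas test_hess = test_function_partial[OF test_function_partial[OF test_block]]

lemma f_locally_bounded: "locally_bounded f" by (rule weighted_holder_locally_bounded[OF f_weighted_holder])

lemma hess_block: "partial j (partial i block) =
    (\<lambda>x. 4 * x$i * x$j * E2 ((norm x)\<^sup>2) + (if i = j then 2 * E1 ((norm x)\<^sup>2) else 0))"
  unfolding block_def[abs_def] by (rule partial_partial_radial[OF sE dE dE1])

lemma hess_block_commute: "partial j (partial i block) = partial i (partial j block)"
  by (auto simp: hess_block fun_eq_iff)

lemma laplacian_block: "partial 1 (partial 1 block) z + partial 2 (partial 2 block) z = bump ((1/2) *\<^sub>R z) / 4 - bump z"
proof -
  have "partial 1 (partial 1 block) z + partial 2 (partial 2 block) z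
    = 4 * ((z$1)\<^sup>2 + (z$2)\<^sup>2) * E2 ((norm z)\<^sup>2) + 4 * E1 ((norm z)\<^sup>2)"
    by (simp add: hess_block power2_eq_square algebra_simps)
  also have "\<dots> = G ((norm z)\<^sup>2 / 4) / 4 - G ((norm z)\<^sup>2)"
    using radial_laplacian[of "(norm z)\<^sup>2"] by (simp flip: norm_power2_eq)
  finally show ?thesis by (simp add: bump_def power_divide)
qed

text \<open>Stated for general F: with f it makes the Laplacians of the blocks telescope, with a
  harmonic function it makes the averages independent of the scale.\<close>

lemma average_laplacian_block:
  assumes F: "locally_bounded F" and l: "l > 0"
  shows "average F (partial 1 (partial 1 block)) l x + average F (partial 2 (partial 2 block)) l x
    = average F bump (2 * l) x - average F bump l x"
proof -
  have t1: "test_function (\<lambda>z. bump ((1/2) *\<^sub>R z) / 4)"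
    using test_function_cmult[OF test_function_affine[OF test_bump, of "1/2" 0], of "1/4"] by simp
  have "average F (partial 1 (partial 1 block)) l x + average F (partial 2 (partial 2 block)) l x
    = average F (\<lambda>z. partial 1 (partial 1 block) z + partial 2 (partial 2 block) z) l x"
    by (rule average_add[OF F test_hess test_hess, symmetric])
  also have "\<dots> = average F (\<lambda>z. bump ((1/2) *\<^sub>R z) / 4 + (-1) * bump z) l x"
    by (simp add: laplacian_block)
  also have "\<dots> = average F (\<lambda>z. bump ((1/2) *\<^sub>R z) / 4) l x + (-1) * average F bump l x"
    unfolding average_add[OF F t1 test_function_cmult[OF test_bump]] average_cmult ..
  finally show ?thesis by (simp add: average_dilate[OF F test_bump l])
qed

lemma average_laplacian:
  "average f (partial 1 (partial 1 block)) (dyadic k) x + average f (partial 2 (partial 2 block)) (dyadic k) x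
    = u (k + 1) x - u k x"
  using average_laplacian_block[OF f_locally_bounded, of "dyadic k" x] by (simp add: u_def powr_add mult.commute)

lemma block_modes:
  "average f (partial i block) l 0 = 0"
  "average f (partial 1 (partial 2 block)) l 0 = 0" "average f (partial 2 (partial 1 block)) l 0 = 0"
  "average f (partial 1 (partial 1 block)) l 0 = average f (partial 2 (partial 2 block)) l 0"
proof -
  have "E s = 0" if "s > 16" for s using E0 that by simp
  note r = radial_modes[OF sE dE dE1 this f_locally_bounded sym m, folded block_def[abs_def]]
  show "average f (partial i block) l 0 = 0" by (rule r(1))
  show "average f (partial 1 (partial 2 block)) l 0 = 0" by (rule r(2))
  show "average f (partial 2 (partial 1 block)) l 0 = 0" by (rule r(3))
  show "average f (partial 1 (partial 1 block)) l 0 = average f (partial 2 (partial 2 block)) l 0" by (rule r(4))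
qed

lemma w_continuous: "continuous_on UNIV (w k)"
  unfolding w_def[abs_def] by (intro continuous_intros average_continuous[OF f_locally_bounded test_block]) simp

lemma pot_continuous: "continuous_on UNIV (pot N)"
  unfolding pot_def[abs_def] by (intro continuous_intros w_continuous) simp

lemma f_bound: "\<bar>f x\<bar> \<le> B" using f_weighted_holder by (simp add: weighted_holder_def)

lemma B_nonneg: "B \<ge> 0" using f_bound[of 0] by linarith

lemma w_bound:
  obtains C where "C > 0" "\<And>k x. \<bar>w k x\<bar> \<le> C * (dyadic k)\<^sup>2"
proof -
  obtain C where C: "C > 0" "\<And>l x. l > 0 \<Longrightarrow> \<bar>average f block l x\<bar> \<le> C"
    using weighted_holder_average[OF f_weighted_holder \<alpha>(1) test_block] by metis
  have "\<bar>w k x\<bar> \<le> C * (dyadic k)\<^sup>2" for k x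
    using mult_left_mono[OF C(2)[of "dyadic k" x], of "(dyadic k)\<^sup>2"] by (simp add: w_def abs_mult mult.commute)
  with C that show ?thesis by blast
qed

lemma u_bounds:
  obtains C where "C > 0" "\<And>k x. \<bar>u k x\<bar> \<le> C"
    "\<And>k x. norm x \<le> dyadic k \<Longrightarrow> \<bar>u k x - u k 0\<bar> \<le> C * (norm x / dyadic k)"
    "\<And>k x. norm x powr \<alpha> * \<bar>u k x - f x\<bar> \<le> C * dyadic k powr \<alpha>"
proof -
  have mass': "(LINT z|lborel. bump z) = 1" using mass by (simp add: bump_def)
  obtain C where C: "C > 0"
    "\<And>l x. l > 0 \<Longrightarrow> \<bar>average f bump l x\<bar> \<le> C"
    "\<And>l x y. l > 0 \<Longrightarrow> norm (x - y) \<le> l \<Longrightarrow> \<bar>average f bump l x - average f bump l y\<bar> \<le> C * (norm (x - y) / l)"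
    "\<And>l x. l > 0 \<Longrightarrow> norm x powr \<alpha> * \<bar>average f bump l x - f x * (LINT z|lborel. bump z)\<bar> \<le> C * l powr \<alpha>"
    "\<And>l x y. \<lbrakk>(LINT z|lborel. bump z) = 0; l > 0; norm (x - y) \<le> l\<rbrakk> \<Longrightarrow>
       norm x powr \<alpha> * \<bar>average f bump l x - average f bump l y\<bar> \<le> C * l powr \<alpha> * (norm (x - y) / l)"
    by (rule weighted_holder_average[OF f_weighted_holder \<alpha>(1) test_bump]) (rule that)
  show ?thesis
  proof (rule that[of C])
    show "\<bar>u k x - u k 0\<bar> \<le> C * (norm x / dyadic k)" if "norm x \<le> dyadic k" for k x
      using C(3)[of "dyadic k" x 0] that by (simp add: u_def)
    show "norm x powr \<alpha> * \<bar>u k x - f x\<bar> \<le> C * dyadic k powr \<alpha>" for k x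
      using C(4)[of "dyadic k" x] mass' by (simp add: u_def)
  qed (use C in \<open>auto simp: u_def\<close>)
qed

text \<open>The cubic Taylor remainder (|x|/l)^3 times the normalization l^2 leaves |x|^3 / l, which
  is summable over the scales above |x|.\<close>

lemma t_bound:
  obtains C where "C > 0" "\<And>k x. norm x \<le> dyadic k \<Longrightarrow> \<bar>t k x\<bar> \<le> C * (norm x)^3 / dyadic k"
proof -
  obtain C R where C: "C > 0" and T: "\<And>F c l x. \<lbrakk>locally_bounded F; l > 0; c \<ge> 0; norm x \<le> l; \<And>w. norm w \<le> R * l \<Longrightarrow> \<bar>F w\<bar> \<le> c;
       \<And>i. average F (partial i block) l 0 = 0;
       average F (partial 1 (partial 2 block)) l 0 = 0; average F (partial 2 (partial 1 block)) l 0 = 0;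
       average F (partial 1 (partial 1 block)) l 0 = average F (partial 2 (partial 2 block)) l 0\<rbrakk>
     \<Longrightarrow> \<bar>average F block l x - average F block l 0 - (norm x / l)\<^sup>2 / 2 * average F (partial 1 (partial 1 block)) l 0\<bar>
        \<le> C * c * (norm x / l) ^ 3"
    apply (rule average_Taylor[OF test_block])
    subgoal premises p for C R by (rule p(1)[OF p(2,4)])
    done
  have "\<bar>t k x\<bar> \<le> C * (B + 1) * (norm x)^3 / dyadic k" if x: "norm x \<le> dyadic k" for k x
  proof -
    let ?l = "dyadic k"
    let ?d = "average f block ?l x - average f block ?l 0 - (norm x / ?l)\<^sup>2 / 2 * average f (partial 1 (partial 1 block)) ?l 0"
    have "t k x = ?l\<^sup>2 * ?d"
    proof -
      \<comment> \<open>By symmetry the two pure second averages agree at the origin, so the trace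
        is twice either one.\<close>
      have "u (k + 1) 0 - u k 0 = 2 * average f (partial 1 (partial 1 block)) ?l 0"
        using average_laplacian[of k 0] block_modes(4)[of ?l] by simp
      then show ?thesis by (simp add: t_def w_def field_simps power2_eq_square)
    qed
    moreover have "\<bar>?d\<bar> \<le> C * B * (norm x / ?l) ^ 3"
      by (rule T[OF f_locally_bounded _ B_nonneg x]) (auto simp: f_bound block_modes)
    ultimately have "\<bar>t k x\<bar> \<le> ?l\<^sup>2 * (C * B * (norm x / ?l) ^ 3)"
      by (simp add: abs_mult mult_left_mono)
    also have "\<dots> = C * B * ((norm x)^3 / ?l)"
      by (simp add: field_simps power2_eq_square power3_eq_cube)
    also have "\<dots> \<le> C * (B + 1) * ((norm x)^3 / ?l)" using C by (intro mult_right_mono) auto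
    finally show ?thesis by simp
  qed
  moreover have "C * (B + 1) > 0" using C B_nonneg by simp
  ultimately show ?thesis using that by blast
qed

text \<open>Removing the quadratic part helps only at scales above |x|; below, the raw blocks are
  already small. Cutting at j telescopes the removed coefficients and replaces
  \<open>u (int N) 0\<close> by \<open>u j 0\<close>.\<close>

lemma pot_split:
  assumes "- int N \<le> j" "j \<le> int N"
  shows "pot N x = (\<Sum>k\<in>{- int N..<j}. w k x - w k 0) + (\<Sum>k\<in>{j..<int N}. t k x) - (norm x)\<^sup>2 / 4 * u j 0"
proof -
  have "(\<Sum>k\<in>{- int N..<int N}. w k x - w k 0) = (\<Sum>k\<in>{- int N..<j}. w k x - w k 0) + (\<Sum>k\<in>{j..<int N}. w k x - w k 0)"
    using assms by (subst sum.union_disjoint[symmetric]) (auto simp: ivl_disj_un)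
  moreover have "(\<Sum>k\<in>{j..<int N}. t k x) = (\<Sum>k\<in>{j..<int N}. w k x - w k 0) - (norm x)\<^sup>2 / 4 * (u (int N) 0 - u j 0)"
    unfolding t_def sum_subtractf[of "\<lambda>k. w k x - w k 0"] sum_distrib_left[symmetric]
      sum_telescope_int[OF assms(2), of "\<lambda>k. u k 0"] ..
  ultimately show ?thesis by (simp add: pot_def algebra_simps)
qed

lemma pot_quadratic:
  obtains C where "\<And>N x. \<bar>pot N x\<bar> \<le> C * (norm x)\<^sup>2"
proof -
  obtain Cw where Cw: "Cw > 0" "\<And>k x. \<bar>w k x\<bar> \<le> Cw * (dyadic k)\<^sup>2" by (rule w_bound) (rule that)
  obtain Ct where Ct: "Ct > 0" "\<And>k x. norm x \<le> dyadic k \<Longrightarrow> \<bar>t k x\<bar> \<le> Ct * (norm x)^3 / dyadic k" by (rule t_bound) (rule that)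
  obtain Cu where Cu: "Cu > 0" "\<And>k x. \<bar>u k x\<bar> \<le> Cu" using u_bounds by metis
  define A where "A = 1 / (1 - 2 powr (- (2::real)))"
  define A' where "A' = 1 / (1 - 2 powr (- (1::real)))"
  define C where "C = 2 * Cw * A + Ct * A' + Cu / 4"
  have "\<bar>pot N x\<bar> \<le> C * (norm x)\<^sup>2" for N x
  proof (cases "x = 0")
    case True
    then show ?thesis by (simp add: pot_def)
  next
    case False
    then have x: "norm x > 0" by simp
    \<comment> \<open>The scale of |x|, clamped to the available range so that
      \<open>pot_split\<close> applies even when |x| lies outside it. Raw blocks then sum to order
      |x|^2 from l^2, corrected ones from |x|^3 / l.\<close>
    define j where "j = max (- int N) (min (int N) \<lceil>log 2 (norm x)\<rceil>)"
    have j: "- int N \<le> j" "j \<le> int N" by (auto simp: j_def)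
    have low: "dyadic k \<le> norm x" if "k \<in> {- int N..<j}" for k
    proof -
      have "k < \<lceil>log 2 (norm x)\<rceil>" using that by (auto simp: j_def)
      then have "real_of_int k \<le> log 2 (norm x)" by linarith
      then show ?thesis using x by (simp add: le_log_iff)
    qed
    have high: "norm x \<le> dyadic k" if "k \<in> {j..<int N}" for k
    proof -
      have "\<lceil>log 2 (norm x)\<rceil> \<le> k" using that by (auto simp: j_def)
      then have "log 2 (norm x) \<le> real_of_int k" by linarith
      then show ?thesis using x by (simp add: log_le_iff)
    qed
    have "\<bar>\<Sum>k\<in>{- int N..<j}. w k x - w k 0\<bar> \<le> (\<Sum>k\<in>{- int N..<j}. 2 * Cw * (norm x)\<^sup>2 * (dyadic k / norm x) powr 2)"
    proof (rule order_trans[OF sum_abs], rule sum_mono)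
      fix k
      have "\<bar>w k x - w k 0\<bar> \<le> 2 * Cw * (dyadic k)\<^sup>2" using Cw(2)[of k x] Cw(2)[of k 0] by simp
      also have "\<dots> = 2 * Cw * (norm x)\<^sup>2 * (dyadic k / norm x) powr 2"
        using x by (simp add: powr_numeral power_divide)
      finally show "\<bar>w k x - w k 0\<bar> \<le> 2 * Cw * (norm x)\<^sup>2 * (dyadic k / norm x) powr 2" .
    qed
    also have "\<dots> \<le> 2 * Cw * (norm x)\<^sup>2 * A"
      unfolding sum_distrib_left[symmetric] A_def
      using Cw(1) x low by (intro mult_left_mono sum_dyadic_low) auto
    finally have 1: "\<bar>\<Sum>k\<in>{- int N..<j}. w k x - w k 0\<bar> \<le> 2 * Cw * (norm x)\<^sup>2 * A" .
    have "\<bar>\<Sum>k\<in>{j..<int N}. t k x\<bar> \<le> (\<Sum>k\<in>{j..<int N}. Ct * (norm x)\<^sup>2 * (norm x / dyadic k) powr 1)"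
    proof (rule order_trans[OF sum_abs], rule sum_mono)
      fix k assume "k \<in> {j..<int N}"
      from Ct(2)[OF high[OF this]] show "\<bar>t k x\<bar> \<le> Ct * (norm x)\<^sup>2 * (norm x / dyadic k) powr 1"
        by (simp add: power2_eq_square power3_eq_cube mult.assoc)
    qed
    also have "\<dots> \<le> Ct * (norm x)\<^sup>2 * A'"
      unfolding sum_distrib_left[symmetric] A'_def
      using Ct(1) x high by (intro mult_left_mono sum_dyadic_high) auto
    finally have 2: "\<bar>\<Sum>k\<in>{j..<int N}. t k x\<bar> \<le> Ct * (norm x)\<^sup>2 * A'" .
    have 3: "\<bar>(norm x)\<^sup>2 / 4 * u j 0\<bar> \<le> (norm x)\<^sup>2 / 4 * Cu"
      unfolding abs_mult using Cu(2)[of j 0] by (intro mult_mono) auto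
    show ?thesis unfolding pot_split[OF j] C_def
      using 1 2 3 by (simp add: algebra_simps)
  qed
  with that show ?thesis by blast
qed

lemma pot_uniform_limit:
  obtains \<Psi> where "\<And>r. uniform_limit (cball 0 r) pot \<Psi> sequentially"
proof -
  obtain Cw where Cw: "Cw > 0" "\<And>k x. \<bar>w k x\<bar> \<le> Cw * (dyadic k)\<^sup>2" by (rule w_bound) (rule that)
  obtain Ct where Ct: "Ct > 0" "\<And>k x. norm x \<le> dyadic k \<Longrightarrow> \<bar>t k x\<bar> \<le> Ct * (norm x)^3 / dyadic k" by (rule t_bound) (rule that)
  \<comment> \<open>The increment of \<open>pot\<close> from n to n + 1: a raw block at the new
    smallest scale and a corrected block at the new largest one.\<close>
  define d where "d n x = w (- int n - 1) x - w (- int n - 1) 0 + t (int n) x" for n x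
  have pot: "pot n x = pot 0 x + (\<Sum>i<n. d i x)" for n x
  proof -
    have "(\<Sum>i<n. u (int i + 1) 0 - u (int i) 0) = u (int n) 0 - u 0 0"
      using sum_lessThan_telescope[of "\<lambda>i. u (int i) 0" n] by (simp add: add.commute)
    then have "(\<Sum>i<n. t (int i) x) = (\<Sum>i<n. w (int i) x - w (int i) 0) - (norm x)\<^sup>2 / 4 * (u (int n) 0 - u 0 0)"
      unfolding t_def sum_subtractf[of "\<lambda>i. w (int i) x - w (int i) 0"] sum_distrib_left[symmetric] by simp
    then show ?thesis
      unfolding pot_def d_def sum_symmetric_int sum.distrib by (simp add: algebra_simps)
  qed
  have dyn: "dyadic (int n) = 2 ^ n" for n by (simp add: powr_realpow)
  have "uniform_limit (cball 0 r) pot (\<lambda>x. pot 0 x + (\<Sum>i. d i x)) sequentially" for r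
  proof -
    \<comment> \<open>On a bounded set the corrected block at scale 2^n is of size 2^(-n). The raw
      block at scale 2^(-n-1) is of the order of its squared scale, which is smaller still.\<close>
    define M where "M n = (2 * Cw + Ct * \<bar>r\<bar> ^ 3) * (1/2) ^ n" for n :: nat
    obtain n0 :: nat where n0: "r < 2 ^ n0" using real_arch_pow[of 2 r] by auto
    have "\<bar>d n x\<bar> \<le> M n" if "n \<ge> n0" "x \<in> cball 0 r" for n x
    proof -
      have x: "norm x \<le> r" using that by simp
      have "2 ^ n0 \<le> (2::real) ^ n" using that by simp
      then have "norm x \<le> dyadic (int n)" using x n0 dyn[of n] by linarith
      from Ct(2)[OF this] have "\<bar>t (int n) x\<bar> \<le> Ct * (norm x)^3 * (1/2) ^ n"
        by (simp add: powr_realpow power_divide)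
      also have "\<dots> \<le> Ct * \<bar>r\<bar> ^ 3 * (1/2) ^ n"
        using x Ct(1) by (intro mult_right_mono mult_left_mono power_mono) auto
      finally have t: "\<bar>t (int n) x\<bar> \<le> Ct * \<bar>r\<bar> ^ 3 * (1/2) ^ n" .
      have "(dyadic (- int n - 1))\<^sup>2 \<le> (1/2) ^ n"
      proof -
        have "dyadic (- int n - 1) = (1/2) ^ Suc n"
          by (simp add: powr_diff powr_minus powr_realpow power_divide field_simps)
        then have "(dyadic (- int n - 1))\<^sup>2 = (1/2) ^ (Suc n * 2)" by (simp only: power_mult)
        also have "\<dots> \<le> (1/2) ^ n" by (rule power_decreasing) auto
        finally show ?thesis .
      qed
      with Cw(1) have "Cw * (dyadic (- int n - 1))\<^sup>2 \<le> Cw * (1/2) ^ n" by (intro mult_left_mono) auto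
      with t Cw(2)[of "- int n - 1" x] Cw(2)[of "- int n - 1" 0]
      show ?thesis unfolding d_def M_def by (simp add: algebra_simps)
    qed
    then have "eventually (\<lambda>n. \<forall>x\<in>cball 0 r. norm (d n x) \<le> M n) sequentially"
      by (auto simp: eventually_sequentially intro!: exI[of _ n0])
    moreover have "summable M" unfolding M_def by (intro summable_mult summable_geometric) simp
    ultimately have "uniform_limit (cball 0 r) (\<lambda>n x. \<Sum>i<n. d i x) (\<lambda>x. \<Sum>i. d i x) sequentially"
      by (rule Weierstrass_m_test_ev)
    from uniform_limit_add[OF uniform_limit_const this, of "\<lambda>x. pot 0 x"]
    show ?thesis by (simp only: pot[symmetric])
  qed
  with that show ?thesis by blast
qed

lemma pot_weak_hessian:
  assumes \<phi>: "test_function \<phi>"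
  shows "(LINT x|lborel. pot N x * partial i (partial j \<phi>) x) =
    (LINT x|lborel. ((\<Sum>k\<in>{- int N..<int N}. average f (partial i (partial j block)) (dyadic k) x)
      - (if i = j then u (int N) 0 / 2 else 0)) * \<phi> x)"
proof -
  let ?h = "partial i (partial j \<phi>)"
  let ?K = "partial i (partial j block)"
  let ?S = "{- int N..<int N}"
  have h: "test_function ?h" by (intro test_function_partial \<phi>)
  note int = integrable_locally_bounded_test[OF continuous_locally_bounded]
  have iw: "integrable lborel (\<lambda>x. w k x * ?h x)" for k by (rule int[OF w_continuous h])
  have ih: "integrable lborel ?h" by (rule test_function_integrable[OF h])
  have i\<phi>: "integrable lborel \<phi>" by (rule test_function_integrable[OF \<phi>])
  have in2: "integrable lborel (\<lambda>x. (norm x)\<^sup>2 * ?h x)" by (rule int[OF _ h]) (intro continuous_intros)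
  have ia: "integrable lborel (\<lambda>x. average f ?K (dyadic k) x * \<phi> x)" for k
    by (rule int[OF average_continuous[OF f_locally_bounded test_hess] \<phi>]) simp
  have one: "(LINT x|lborel. w k x * ?h x) = (LINT x|lborel. average f ?K (dyadic k) x * \<phi> x)" for k
  proof -
    have d: "dyadic k > 0" by simp
    \<comment> \<open>Two integrations by parts produce 1/l^2, which the factor in \<open>w\<close>
      cancels. The outer derivative of \<phi> moves first, so the indices arrive on the kernel in
      reverse order.\<close>
    have "(LINT x|lborel. w k x * ?h x) = (dyadic k)\<^sup>2 * (LINT x|lborel. average f block (dyadic k) x * ?h x)"
      by (simp add: w_def mult.assoc)
    also have "\<dots> = (LINT x|lborel. average f (partial j (partial i block)) (dyadic k) x * \<phi> x)"
      using integral_average_partial[OF f_locally_bounded test_block test_function_partial[OF \<phi>] d, of i j]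
        integral_average_partial[OF f_locally_bounded test_function_partial[OF test_block] \<phi> d, of i j]
      by (simp add: power2_eq_square)
    finally show ?thesis by (simp only: hess_block_commute[of j i])
  qed
  have "(LINT x|lborel. pot N x * ?h x) =
     (LINT x|lborel. (\<Sum>k\<in>?S. w k x * ?h x - w k 0 * ?h x) - u (int N) 0 / 4 * ((norm x)\<^sup>2 * ?h x))"
    unfolding pot_def by (rule Bochner_Integration.integral_cong) (auto simp: algebra_simps sum_distrib_left)
  also have "\<dots> = (\<Sum>k\<in>?S. (LINT x|lborel. w k x * ?h x) - w k 0 * (LINT x|lborel. ?h x))
      - u (int N) 0 / 4 * (LINT x|lborel. (norm x)\<^sup>2 * ?h x)"
    using iw ih in2 by simp
  also have "\<dots> = (\<Sum>k\<in>?S. LINT x|lborel. average f ?K (dyadic k) x * \<phi> x)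
      - (if i = j then u (int N) 0 / 2 else 0) * (LINT x|lborel. \<phi> x)"
    using integral_partial_test_function[OF test_function_partial[OF \<phi>]]
    by (simp add: one integral_hessian_norm_power2[OF \<phi>])
  also have "\<dots> = (LINT x|lborel. (\<Sum>k\<in>?S. average f ?K (dyadic k) x * \<phi> x)
      - (if i = j then u (int N) 0 / 2 else 0) * \<phi> x)"
    using ia i\<phi> by simp
  also have "\<dots> = (LINT x|lborel. ((\<Sum>k\<in>?S. average f ?K (dyadic k) x)
      - (if i = j then u (int N) 0 / 2 else 0)) * \<phi> x)"
    by (simp add: left_diff_distrib sum_distrib_right)
  finally show ?thesis .
qed

lemma pot_rotation: "pot N (rotation (2 * pi / real m) x) = pot N x"
proof -
  have "w k (rotation (2 * pi / real m) x) = w k x" for k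
    unfolding w_def by (subst average_rotation[OF f_locally_bounded sym test_block]) (simp_all add: block_def norm_rotation)
  then show ?thesis by (simp add: pot_def norm_rotation)
qed

text \<open>Large-scale averages lose their dependence on x at rate |x| / 2^N. Small-scale ones
  recover f at rate 2^(-\<alpha> N) / |x|^\<alpha>, which degenerates at the origin, where f may
  jump.\<close>

lemma u_tendsto:
  "(\<lambda>N. u (int N) x - u (int N) 0) \<longlonglongrightarrow> 0"
  "x \<noteq> 0 \<Longrightarrow> (\<lambda>N. u (- int N) x) \<longlonglongrightarrow> f x"
proof -
  obtain C where C: "C > 0" "\<And>k x. norm x \<le> dyadic k \<Longrightarrow> \<bar>u k x - u k 0\<bar> \<le> C * (norm x / dyadic k)"
    "\<And>k x. norm x powr \<alpha> * \<bar>u k x - f x\<bar> \<le> C * dyadic k powr \<alpha>"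
    using u_bounds by metis
  have dyn: "dyadic (int n) = 2 ^ n" for n by (simp add: powr_realpow)
  obtain n0 :: nat where n0: "norm x < 2 ^ n0" using real_arch_pow[of 2 "norm x"] by auto
  show "(\<lambda>N. u (int N) x - u (int N) 0) \<longlonglongrightarrow> 0"
  proof (rule Lim_null_comparison)
    show "\<forall>\<^sub>F N in sequentially. norm (u (int N) x - u (int N) 0) \<le> C * (norm x / 2 ^ N)"
      unfolding eventually_sequentially
    proof (intro exI allI impI)
      fix N assume "n0 \<le> N"
      then have "(2::real) ^ n0 \<le> 2 ^ N" by simp
      then have "norm x \<le> dyadic (int N)" using n0 dyn[of N] by linarith
      from C(2)[OF this] show "norm (u (int N) x - u (int N) 0) \<le> C * (norm x / 2 ^ N)"
        by (simp add: powr_realpow)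
    qed
    have "(\<lambda>N. C * (norm x / 2 ^ N)) \<longlonglongrightarrow> C * 0"
      by (intro tendsto_mult_left LIMSEQ_divide_realpow_zero) simp
    then show "(\<lambda>N. C * (norm x / 2 ^ N)) \<longlonglongrightarrow> 0" by simp
  qed
  assume x: "x \<noteq> 0"
  have "(\<lambda>N. u (- int N) x - f x) \<longlonglongrightarrow> 0"
  proof (rule Lim_null_comparison)
    show "\<forall>\<^sub>F N in sequentially. norm (u (- int N) x - f x) \<le> C / norm x powr \<alpha> * (2 powr (-\<alpha>)) ^ N"
    proof (rule always_eventually, rule allI)
      fix N
      have "dyadic (- int N) powr \<alpha> = (2 powr (-\<alpha>)) ^ N"
        by (simp add: powr_powr mult.commute flip: powr_realpow)
      with C(3)[of x "- int N"] x show "norm (u (- int N) x - f x) \<le> C / norm x powr \<alpha> * (2 powr (-\<alpha>)) ^ N"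
        by (simp add: field_simps)
    qed
    have "2 powr (-\<alpha>) < (1::real)" using \<alpha> powr_less_mono[of "-\<alpha>" 0 2] by simp
    then have "(\<lambda>N. C / norm x powr \<alpha> * (2 powr (-\<alpha>)) ^ N) \<longlonglongrightarrow> C / norm x powr \<alpha> * 0"
      by (intro tendsto_mult_left LIMSEQ_realpow_zero) auto
    then show "(\<lambda>N. C / norm x powr \<alpha> * (2 powr (-\<alpha>)) ^ N) \<longlonglongrightarrow> 0" by simp
  qed
  then show "(\<lambda>N. u (- int N) x) \<longlonglongrightarrow> f x" by (rule LIM_zero_cancel)
qed

definition hess_sum :: "2 \<Rightarrow> 2 \<Rightarrow> nat \<Rightarrow> real^2 \<Rightarrow> real" where
  "hess_sum i j N x = (\<Sum>k\<in>{- int N..<int N}. average f (partial i (partial j block)) (dyadic k) x)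
      - (if i = j then u (int N) 0 / 2 else 0)"

text \<open>The mixed entry and the difference of the diagonal entries fall under
  \<open>average_dyadic_series\<close>, the sum of the diagonal entries telescopes to
  \<open>U\<close>. The diagonal entries follow as half sums and half differences.\<close>

lemma hessian_limits:
  "\<exists>H. (\<forall>i j x. x \<noteq> 0 \<longrightarrow> (\<lambda>N. hess_sum i j N x) \<longlonglongrightarrow> H i j x) \<and>
    (\<forall>i j. \<exists>D. \<forall>N x. \<bar>hess_sum i j N x\<bar> \<le> D) \<and>
    (\<forall>i j. \<exists>D. weighted_holder \<alpha> D (H i j)) \<and> (\<forall>x. H 1 1 x + H 2 2 x = - f x)"
proof -
  define J where "J z = partial 1 (partial 1 block) z + (-1) * partial 2 (partial 2 block) z" for z
  have tJ: "test_function J" unfolding J_def[abs_def] by (intro test_function_add test_function_cmult test_hess)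
  have hess0: "(LINT z|lborel. partial i (partial j block) z) = 0" for i j
    by (rule integral_partial_test_function[OF test_function_partial[OF test_block]])
  have aJ: "average f J l x = average f (partial 1 (partial 1 block)) l x - average f (partial 2 (partial 2 block)) l x" for l x
    unfolding J_def[abs_def] average_add[OF f_locally_bounded test_hess test_function_cmult[OF test_hess]] average_cmult by simp
  have J0: "(LINT z|lborel. J z) = 0"
    unfolding J_def using hess0 test_function_integrable[OF test_hess] by simp
  obtain T D where T: "\<And>x. (\<lambda>N. \<Sum>k\<in>{- int N..<int N}. average f (partial 1 (partial 2 block)) (dyadic k) x) \<longlonglongrightarrow> T x"
    "\<And>N x. \<bar>\<Sum>k\<in>{- int N..<int N}. average f (partial 1 (partial 2 block)) (dyadic k) x\<bar> \<le> D" "weighted_holder \<alpha> D T"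
    by (rule average_dyadic_series[OF f_weighted_holder \<alpha> test_hess hess0 block_modes(2)]) (rule that)
  obtain S D' where S: "\<And>x. (\<lambda>N. \<Sum>k\<in>{- int N..<int N}. average f J (dyadic k) x) \<longlonglongrightarrow> S x"
    "\<And>N x. \<bar>\<Sum>k\<in>{- int N..<int N}. average f J (dyadic k) x\<bar> \<le> D'" "weighted_holder \<alpha> D' S"
    by (rule average_dyadic_series[OF f_weighted_holder \<alpha> tJ J0]) (use block_modes(4) aJ that in auto)
  obtain C where C: "C > 0" "\<And>k x. \<bar>u k x\<bar> \<le> C" using u_bounds by metis
  define U where "U N x = u (int N) x - u (- int N) x - u (int N) 0" for N x
  have U: "\<bar>U N x\<bar> \<le> 3 * C" for N x
    unfolding U_def using C(2)[of "int N" x] C(2)[of "- int N" x] C(2)[of "int N" 0] by linarith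
  have Ulim: "(\<lambda>N. U N x) \<longlonglongrightarrow> - f x" if "x \<noteq> 0" for x
    using tendsto_diff[OF u_tendsto(1)[of x] u_tendsto(2)[OF that]] by (simp add: U_def algebra_simps)
  let ?a = "\<lambda>i N x. \<Sum>k\<in>{- int N..<int N}. average f (partial i (partial i block)) (dyadic k) x"
  have plus: "?a 1 N x + ?a 2 N x = u (int N) x - u (- int N) x" for N x
    unfolding sum.distrib[symmetric] average_laplacian by (rule sum_telescope_int) simp
  have minus: "?a 1 N x - ?a 2 N x = (\<Sum>k\<in>{- int N..<int N}. average f J (dyadic k) x)" for N x
    unfolding sum_subtractf[symmetric] aJ ..
  have half_sum: "a - c / 2 = 1/2 * s + 1/2 * (d - e - c)" "b - c / 2 = - 1/2 * s + 1/2 * (d - e - c)"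
    if "a + b = d - e" "a - b = s" for a b c d e s :: real
    using that by (simp_all add: field_simps)
  have 11: "hess_sum 1 1 N x = 1/2 * (\<Sum>k\<in>{- int N..<int N}. average f J (dyadic k) x) + 1/2 * U N x" for N x
    unfolding hess_sum_def U_def if_P[OF refl] by (rule half_sum[OF plus minus])
  have 22: "hess_sum 2 2 N x = - 1/2 * (\<Sum>k\<in>{- int N..<int N}. average f J (dyadic k) x) + 1/2 * U N x" for N x
    unfolding hess_sum_def U_def if_P[OF refl] by (rule half_sum[OF plus minus])
  have 12: "hess_sum 1 2 N x = (\<Sum>k\<in>{- int N..<int N}. average f (partial 1 (partial 2 block)) (dyadic k) x)" 
    "hess_sum 2 1 N x = (\<Sum>k\<in>{- int N..<int N}. average f (partial 1 (partial 2 block)) (dyadic k) x)" for N x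
    by (simp_all add: hess_sum_def hess_block_commute[of 2 1])
  \<comment> \<open>The same formulas are used at the origin, where no convergence is claimed; hence
    the trace identity and the weighted Hoelder bounds hold at every point.\<close>
  define H :: "2 \<Rightarrow> 2 \<Rightarrow> real^2 \<Rightarrow> real" where
    "H i j = (if i \<noteq> j then T else if i = 1 then (\<lambda>x. 1/2 * S x + (-1/2) * f x) else (\<lambda>x. -1/2 * S x + (-1/2) * f x))" for i j
  have "\<forall>i j x. x \<noteq> 0 \<longrightarrow> (\<lambda>N. hess_sum i j N x) \<longlonglongrightarrow> H i j x"
  proof -
    have "(\<lambda>N. hess_sum 1 1 N x) \<longlonglongrightarrow> H 1 1 x" "(\<lambda>N. hess_sum 2 2 N x) \<longlonglongrightarrow> H 2 2 x" if "x \<noteq> 0" for x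
      using tendsto_add[OF tendsto_mult_left[OF S(1)[of x], of "1/2"] tendsto_mult_left[OF Ulim[OF that], of "1/2"]]
        tendsto_add[OF tendsto_mult_left[OF S(1)[of x], of "-1/2"] tendsto_mult_left[OF Ulim[OF that], of "1/2"]]
      unfolding 11 22 H_def by simp_all
    moreover have "(\<lambda>N. hess_sum 1 2 N x) \<longlonglongrightarrow> H 1 2 x" "(\<lambda>N. hess_sum 2 1 N x) \<longlonglongrightarrow> H 2 1 x" for x
      using T(1)[of x] unfolding 12 H_def by simp_all
    ultimately show ?thesis by (simp add: forall_2)
  qed
  moreover have "\<forall>i j. \<exists>D. \<forall>N x. \<bar>hess_sum i j N x\<bar> \<le> D"
  proof -
    have "\<bar>hess_sum 1 1 N x\<bar> \<le> D' + 3 * C" "\<bar>hess_sum 2 2 N x\<bar> \<le> D' + 3 * C" for N x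
      unfolding 11 22 using S(2)[of x N] U[of N x] by linarith+
    moreover have "\<bar>hess_sum 1 2 N x\<bar> \<le> D" "\<bar>hess_sum 2 1 N x\<bar> \<le> D" for N x
      unfolding 12 by (rule T(2))+
    ultimately show ?thesis unfolding forall_2 by blast
  qed
  moreover have "\<forall>i j. \<exists>D. weighted_holder \<alpha> D (H i j)"
    using T(3) weighted_holder_lincomb[OF S(3) f_weighted_holder, of "1/2" "-1/2"] weighted_holder_lincomb[OF S(3) f_weighted_holder, of "-1/2" "-1/2"]
    unfolding H_def by (auto intro: exI)
  moreover have "\<forall>x. H 1 1 x + H 2 2 x = - f x" by (simp add: H_def)
  ultimately show ?thesis by blast
qed

text \<open>No classical second derivative of the limit is taken. The weak identity for each
  \<open>pot N\<close> passes to the limit by dominated convergence on both sides, with majorants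
  from the quadratic growth and from the uniform bound on \<open>hess_sum\<close>.\<close>

lemma poisson_solution_exists:
  "\<exists>\<Psi> H. poisson_solution m f \<Psi> \<and> weak_hessian \<Psi> H \<and> (\<forall>i j. (\<lambda>x. H x $ i $ j) \<in> cring \<alpha>)"
proof -
  obtain \<Psi> where \<Psi>: "\<And>r. uniform_limit (cball 0 r) pot \<Psi> sequentially" by (rule pot_uniform_limit) (rule that)
  obtain C where C: "\<And>N x. \<bar>pot N x\<bar> \<le> C * (norm x)\<^sup>2" by (rule pot_quadratic) (rule that)
  have lim: "(\<lambda>N. pot N x) \<longlonglongrightarrow> \<Psi> x" for x
    by (rule tendsto_uniform_limitI[OF \<Psi>[of "norm x"]]) simp
  have cont: "continuous_on UNIV \<Psi>"
  proof (rule continuous_at_imp_continuous_on, rule ballI)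
    fix x :: "real^2"
    have "continuous_on (cball 0 (norm x + 1)) \<Psi>"
      by (rule uniform_limit_theorem[OF _ \<Psi>])
        (simp_all add: continuous_on_subset[OF pot_continuous])
    then show "isCont \<Psi> x"
      by (rule continuous_on_interior) (simp add: interior_cball)
  qed
  have growth: "\<bar>\<Psi> x\<bar> \<le> C * (norm x)\<^sup>2" for x
    by (rule LIMSEQ_le_const2[OF tendsto_rabs[OF lim]]) (use C in auto)
  have rot: "rot_symmetric m \<Psi>"
    unfolding rot_symmetric_def
  proof
    fix x
    have "(\<lambda>N. pot N x) \<longlonglongrightarrow> \<Psi> (rotation (2 * pi / real m) x)"
      using lim[of "rotation (2 * pi / real m) x"] by (simp add: pot_rotation)
    then show "\<Psi> (rotation (2 * pi / real m) x) = \<Psi> x" using lim[of x] by (rule LIMSEQ_unique)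
  qed
  obtain h where h: "\<And>i j x. x \<noteq> 0 \<Longrightarrow> (\<lambda>N. hess_sum i j N x) \<longlonglongrightarrow> h i j x"
    "\<And>i j. \<exists>D. \<forall>N x. \<bar>hess_sum i j N x\<bar> \<le> D"
    "\<And>i j. \<exists>D. weighted_holder \<alpha> D (h i j)" "\<And>x. h 1 1 x + h 2 2 x = - f x"
    using hessian_limits by blast
  have lh: "locally_bounded (h i j)" for i j using h(3) weighted_holder_locally_bounded by blast
  have l\<Psi>: "locally_bounded \<Psi>" by (rule continuous_locally_bounded[OF cont])
  have weak: "(LINT x|lborel. \<Psi> x * partial i (partial j \<phi>) x) = (LINT x|lborel. h i j x * \<phi> x)"
    if \<phi>: "test_function \<phi>" for i j \<phi>
  proof -
    have hp: "test_function (partial i (partial j \<phi>))" by (intro test_function_partial \<phi>)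
    note [measurable] = test_function_measurable[OF \<phi>] test_function_measurable[OF hp]
    have [measurable]: "pot N \<in> borel_measurable borel" for N by (rule borel_measurable_continuous_onI[OF pot_continuous])
    have [measurable]: "\<Psi> \<in> borel_measurable borel" by (rule borel_measurable_continuous_onI[OF cont])
    have [measurable]: "h i j \<in> borel_measurable borel" by (rule locally_bounded_measurable[OF lh])
    have [measurable]: "average f (partial i (partial j block)) (dyadic k) \<in> borel_measurable borel" for k
      by (intro borel_measurable_continuous_onI average_continuous[OF f_locally_bounded test_hess]) simp
    have [measurable]: "hess_sum i j N \<in> borel_measurable borel" for N
      unfolding hess_sum_def[abs_def] by measurable
    have "(\<lambda>N. LINT x|lborel. pot N x * partial i (partial j \<phi>) x) \<longlonglongrightarrow> (LINT x|lborel. \<Psi> x * partial i (partial j \<phi>) x)"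
    proof (rule integral_dominated_convergence[where w = "\<lambda>x. \<bar>C * (norm x)\<^sup>2 * partial i (partial j \<phi>) x\<bar>"])
      show "integrable lborel (\<lambda>x. \<bar>C * (norm x)\<^sup>2 * partial i (partial j \<phi>) x\<bar>)"
        by (intro integrable_abs integrable_locally_bounded_test[OF continuous_locally_bounded hp] continuous_intros)
      show "AE x in lborel. (\<lambda>N. pot N x * partial i (partial j \<phi>) x) \<longlonglongrightarrow> \<Psi> x * partial i (partial j \<phi>) x"
        by (intro AE_I2 tendsto_mult_right lim)
      show "AE x in lborel. norm (pot N x * partial i (partial j \<phi>) x) \<le> \<bar>C * (norm x)\<^sup>2 * partial i (partial j \<phi>) x\<bar>" for N
      proof (rule AE_I2)
        fix x
        have "\<bar>pot N x\<bar> \<le> \<bar>C * (norm x)\<^sup>2\<bar>" using C[of N x] by linarith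
        then show "norm (pot N x * partial i (partial j \<phi>) x) \<le> \<bar>C * (norm x)\<^sup>2 * partial i (partial j \<phi>) x\<bar>"
          unfolding real_norm_def abs_mult[of _ "partial i (partial j \<phi>) x"] by (rule mult_right_mono) simp
      qed
    qed measurable
    moreover have "(\<lambda>N. LINT x|lborel. hess_sum i j N x * \<phi> x) \<longlonglongrightarrow> (LINT x|lborel. h i j x * \<phi> x)"
    proof -
      obtain D where D: "\<And>N x. \<bar>hess_sum i j N x\<bar> \<le> D" using h(2)[of i j] by blast
      show ?thesis
      proof (rule integral_dominated_convergence[where w = "\<lambda>x. D * \<bar>\<phi> x\<bar>"])
        show "integrable lborel (\<lambda>x. D * \<bar>\<phi> x\<bar>)"
          by (intro integrable_mult_right integrable_abs test_function_integrable \<phi>)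
        show "AE x in lborel. (\<lambda>N. hess_sum i j N x * \<phi> x) \<longlonglongrightarrow> h i j x * \<phi> x"
          \<comment> \<open>Convergence fails at most at the origin, a null set.\<close>
          using AE_lborel_singleton[of 0] by eventually_elim (intro tendsto_mult_right h)
        show "AE x in lborel. norm (hess_sum i j N x * \<phi> x) \<le> D * \<bar>\<phi> x\<bar>" for N
          unfolding real_norm_def abs_mult by (intro AE_I2 mult_right_mono D) simp
      qed measurable
    qed
    moreover have "(LINT x|lborel. pot N x * partial i (partial j \<phi>) x) = (LINT x|lborel. hess_sum i j N x * \<phi> x)" for N
      unfolding hess_sum_def by (rule pot_weak_hessian[OF \<phi>])
    ultimately show ?thesis by (auto intro: LIMSEQ_unique)
  qed
  define H :: "real^2 \<Rightarrow> real^2^2" where "H x = (\<chi> i j. h i j x)" for x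
  have "weak_hessian \<Psi> H"
    unfolding weak_hessian_def H_def
    using weak lh l\<Psi> by (simp add: locally_bounded_locally_integrable)
  moreover have "(\<lambda>x. H x $ i $ j) \<in> cring \<alpha>" for i j
    using h(3)[of i j] weighted_holder_cring \<alpha> by (auto simp: H_def)
  moreover have "weak_neg_laplacian \<Psi> f"
    unfolding weak_neg_laplacian_def
  proof (intro conjI allI impI)
    fix \<phi> assume \<phi>: "test_function \<phi>"
    have i1: "integrable lborel (\<lambda>x. \<Psi> x * partial i (partial i \<phi>) x)" for i
      by (intro integrable_locally_bounded_test l\<Psi> test_function_partial \<phi>)
    have i2: "integrable lborel (\<lambda>x. h i i x * \<phi> x)" for i
      by (intro integrable_locally_bounded_test lh \<phi>)
    have "(LINT x|lborel. \<Psi> x * - (\<Sum>i\<in>UNIV. partial i (partial i \<phi>) x))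
      = - ((LINT x|lborel. \<Psi> x * partial 1 (partial 1 \<phi>) x) + (LINT x|lborel. \<Psi> x * partial 2 (partial 2 \<phi>) x))"
      using i1 by (simp add: sum_2 right_diff_distrib)
    also have "\<dots> = - (LINT x|lborel. h 1 1 x * \<phi> x + h 2 2 x * \<phi> x)"
      using i2 by (simp add: weak[OF \<phi>])
    also have "\<dots> = (LINT x|lborel. f x * \<phi> x)"
      using h(4) by (simp flip: distrib_right)
    finally show "(LINT x|lborel. \<Psi> x * - (\<Sum>i\<in>UNIV. partial i (partial i \<phi>) x)) = (LINT x|lborel. f x * \<phi> x)" .
  qed (simp_all add: locally_bounded_locally_integrable f_locally_bounded l\<Psi>)
  moreover have "\<Psi> 0 = 0" using growth[of 0] by simp
  ultimately show ?thesis
    unfolding poisson_solution_def using cont rot growth by blast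
qed

end

section \<open>Uniqueness\<close>

definition weakly_harmonic :: "(real^2 \<Rightarrow> real) \<Rightarrow> bool" where
  "weakly_harmonic h \<longleftrightarrow>
    (\<forall>\<phi>. test_function \<phi> \<longrightarrow> (LINT x|lborel. h x * (partial 1 (partial 1 \<phi>) x + partial 2 (partial 2 \<phi>) x)) = 0)"

text \<open>Harmonicity is tested on y -> K((x - y)/l). Its second derivatives are those of K times
  the nonzero constant 1/l^2.\<close>

lemma weakly_harmonic_average_laplacian:
  assumes h: "weakly_harmonic h" "locally_bounded h" and K: "test_function K" and l: "l > 0"
  shows "average h (partial 1 (partial 1 K)) l x + average h (partial 2 (partial 2 K)) l x = 0"
proof -
  define c where "c = - (1/l)"
  define b where "b = (1/l) *\<^sub>R x"
  define L where "L z = partial 1 (partial 1 K) z + partial 2 (partial 2 K) z" for z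
  have c: "c \<noteq> 0" using l by (simp add: c_def)
  have tL: "test_function L" unfolding L_def[abs_def] by (intro test_function_add test_function_partial K)
  have pp: "partial i (partial i (\<lambda>y. K (c *\<^sub>R y + b))) = (\<lambda>y. c * (c * partial i (partial i K) (c *\<^sub>R y + b)))" for i
  proof -
    have t: "C_k (Suc 0) (\<lambda>z. c * partial i K z)"
      by (intro C_k_cmult test_function_C_k test_function_partial K)
    have "partial i (partial i (\<lambda>y. K (c *\<^sub>R y + b))) = partial i (\<lambda>y. (\<lambda>z. c * partial i K z) (c *\<^sub>R y + b))"
      by (simp only: partial_affine[OF test_function_C_k[OF K]])
    also have "\<dots> = (\<lambda>y. c * partial i (\<lambda>z. c * partial i K z) (c *\<^sub>R y + b))"
      by (rule partial_affine[OF t])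
    also have "partial i (\<lambda>z. c * partial i K z) = (\<lambda>z. c * partial i (partial i K) z)"
    proof (rule partial_eqI[where D = "\<lambda>j z. c * partial j (partial i K) z"])
      show "((\<lambda>z. c * partial i K z) has_derivative (\<lambda>h. \<Sum>j\<in>UNIV. h$j * (c * partial j (partial i K) x))) (at x)" for x
        by (rule has_derivative_eq_rhs[OF has_derivative_mult_right[OF test_function_deriv[OF test_function_partial[OF K]]]])
          (simp add: algebra_simps sum_distrib_left)
    qed
    finally show ?thesis .
  qed
  have "0 = (LINT y|lborel. h y * (c * (c * L (c *\<^sub>R y + b))))"
    using h(1)[unfolded weakly_harmonic_def, rule_format, OF test_function_affine[OF K c, of b]]
    by (simp only: pp L_def distrib_left)
  also have "\<dots> = c * c * (LINT y|lborel. h y * L (c *\<^sub>R y + b))"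
    by (simp add: mult.left_commute[of "h _"])
  finally have zero: "(LINT y|lborel. h y * L (c *\<^sub>R y + b)) = 0" using c by simp
  have "(\<lambda>y. h y * L (c *\<^sub>R y + b)) \<in> borel_measurable borel"
    using integrable_locally_bounded_test[OF h(2) test_function_affine[OF tL c, of b]] by auto
  from integral_affine[OF this, of l 0] have "average h L l x = 0"
    using l zero by (simp add: average_def c_def b_def)
  then show ?thesis
    unfolding L_def[abs_def] by (subst (asm) average_add) (intro h test_function_partial K)+
qed

context potential
begin

lemma weakly_harmonic_zero:
  assumes h: "weakly_harmonic h" "continuous_on UNIV h" "rot_symmetric m h" "h 0 = 0" "\<And>x. \<bar>h x\<bar> \<le> C * (norm x)\<^sup>2"
  shows "h x = 0"
proof -
  have lh: "locally_bounded h" by (rule continuous_locally_bounded[OF h(2)])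
  have mass': "(LINT z|lborel. bump z) = 1" using mass by (simp add: bump_def)
  have step: "average h bump (dyadic (k + 1)) x = average h bump (dyadic k) x" for k x
    using average_laplacian_block[OF lh, of "dyadic k" x] weakly_harmonic_average_laplacian[OF h(1) lh test_block, of "dyadic k" x]
    by (simp add: powr_add mult.commute)
  have const: "average h bump (dyadic k) x = average h bump 1 x" for k x
  proof (induction k rule: int_induct[where k = 0])
    case (step1 i) then show ?case using step[of i x] by simp
  next
    case (step2 i) then show ?case using step[of "i - 1" x] by simp
  qed simp
  obtain A R where A: "A > 0" and R: "R > 0"
    and size: "\<And>F c l x. \<lbrakk>l > 0; c \<ge> 0; \<And>w. norm (w - x) \<le> R * l \<Longrightarrow> \<bar>F w\<bar> \<le> c\<rbrakk> \<Longrightarrow> \<bar>average F bump l x\<bar> \<le> A * c"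
    apply (rule average_bounds[OF test_bump])
    subgoal premises p for A R by (rule p(1)[OF p(2,3,4)])
    done
  have mean: "average h bump (dyadic k) x = h x" for k x
  proof -
    \<comment> \<open>The average has the same value at all dyadic scales. At small scales it lies
      within A e of h x by continuity, since \<open>bump\<close> has mass one.\<close>
    have "\<bar>average h bump 1 x - h x\<bar> \<le> A * e" if e: "e > 0" for e
    proof -
      have "isCont h x" using h(2) by (simp add: continuous_on_eq_continuous_at)
      then obtain d where d: "d > 0" "\<And>w. norm (w - x) < d \<Longrightarrow> \<bar>h w - h x\<bar> < e"
        using e unfolding isCont_def LIM_def by (metis continuous_at_eps_delta dist_norm \<open>isCont h x\<close> real_norm_def)
      obtain n where n: "(1/2) ^ n < d / R" using real_arch_pow_inv[of "d / R" "1/2"] d R by auto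
      have dyn: "dyadic (- int n) = (1/2) ^ n" by (simp add: powr_minus powr_realpow power_divide field_simps)
      have Rl: "R * dyadic (- int n) < d" unfolding dyn using n R by (simp only: pos_less_divide_eq mult.commute)
      have "\<bar>average (\<lambda>v. h v - h x) bump (dyadic (- int n)) x\<bar> \<le> A * e"
      proof (rule size)
        fix w assume "norm (w - x) \<le> R * dyadic (- int n)"
        then show "\<bar>h w - h x\<bar> \<le> e" using d(2)[of w] Rl by simp
      qed (use e in auto)
      then show ?thesis
        unfolding average_shift[OF lh test_bump powr_gt_zero[THEN iffD2, OF zero_neq_numeral[symmetric]]]
        by (simp add: mass' const[of "- int n"] del: of_int_minus)
    qed
    then have small: "\<bar>average h bump 1 x - h x\<bar> \<le> e" if "e > 0" for e
    proof -
      have "e / A > 0" using that A by simp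
      from \<open>\<And>e. e > 0 \<Longrightarrow> \<bar>average h bump 1 x - h x\<bar> \<le> A * e\<close>[OF this] show ?thesis using A by simp
    qed
    have "\<bar>average h bump 1 x - h x\<bar> \<le> 0" by (rule field_le_epsilon) (use small in simp)
    then show ?thesis using const[of k x] by simp
  qed
  have G0': "G s = 0" if "s > 16" for s using G0 that by simp
  obtain G1 where G1: "\<And>s. DERIV G s :> G1 s" "smooth_line G1" using smooth_line_obtain[OF sG] by metis
  obtain G2 where G2: "\<And>s. DERIV G1 s :> G2 s" using smooth_line_obtain[OF G1(2)] by metis
  note modes = radial_modes[OF sG G1(1) G2 G0' lh h(3) m, folded bump_def[abs_def]]
  obtain T S where T: "T > 0" and S: "S > 0" and taylor: "\<And>F c l x. \<lbrakk>locally_bounded F; l > 0; c \<ge> 0; norm x \<le> l; \<And>w. norm w \<le> S * l \<Longrightarrow> \<bar>F w\<bar> \<le> c;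
       \<And>i. average F (partial i bump) l 0 = 0;
       average F (partial 1 (partial 2 bump)) l 0 = 0; average F (partial 2 (partial 1 bump)) l 0 = 0;
       average F (partial 1 (partial 1 bump)) l 0 = average F (partial 2 (partial 2 bump)) l 0\<rbrakk>
     \<Longrightarrow> \<bar>average F bump l x - average F bump l 0 - (norm x / l)\<^sup>2 / 2 * average F (partial 1 (partial 1 bump)) l 0\<bar>
        \<le> T * c * (norm x / l) ^ 3"
    apply (rule average_Taylor[OF test_bump])
    subgoal premises p for T S by (rule p(1)[OF p(2,3,4)])
    done
  have C: "C \<ge> 0" using h(5)[of "axis 1 1"] abs_ge_zero[of "h (axis 1 1)"] by (simp add: norm_axis_1)
  define D where "D = T * C * S\<^sup>2 * (norm x) ^ 3"
  obtain n0 :: nat where n0: "norm x < 2 ^ n0" using real_arch_pow[of 2 "norm x"] by auto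
  have "\<bar>h x\<bar> \<le> D / 2 ^ n" if "n \<ge> n0" for n
  proof -
    let ?l = "dyadic (int n)"
    have dyn: "?l = 2 ^ n" by (simp add: powr_realpow)
    have "(2::real) ^ n0 \<le> 2 ^ n" using that by simp
    then have x: "norm x \<le> ?l" using n0 dyn by linarith
    \<comment> \<open>Harmonicity makes the two pure second averages opposite, symmetry makes them
      equal.\<close>
    have lap: "average h (partial 1 (partial 1 bump)) ?l 0 = 0"
      using weakly_harmonic_average_laplacian[OF h(1) lh test_bump, of ?l 0] modes(4)[of ?l] by simp
    have "\<bar>average h bump ?l x - average h bump ?l 0 - (norm x / ?l)\<^sup>2 / 2 * average h (partial 1 (partial 1 bump)) ?l 0\<bar>
        \<le> T * (C * (S * ?l)\<^sup>2) * (norm x / ?l) ^ 3"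
    proof (rule taylor[OF lh _ _ x])
      \<comment> \<open>Quadratic growth contributes l^2 against the cubic gain (|x|/l)^3, so a
        factor 1/l survives.\<close>
      show "\<bar>h w\<bar> \<le> C * (S * ?l)\<^sup>2" if "norm w \<le> S * ?l" for w
        using h(5)[of w] power_mono[OF that, of 2] mult_left_mono[OF _ C] by (meson norm_ge_zero order_trans)
      show "average h (partial i bump) ?l 0 = 0" for i by (rule modes(1))
      show "average h (partial 1 (partial 2 bump)) ?l 0 = 0" by (rule modes(2))
      show "average h (partial 2 (partial 1 bump)) ?l 0 = 0" by (rule modes(3))
      show "average h (partial 1 (partial 1 bump)) ?l 0 = average h (partial 2 (partial 2 bump)) ?l 0" by (rule modes(4))
    qed (use C in auto)
    then have "\<bar>h x\<bar> \<le> T * (C * (S * ?l)\<^sup>2) * (norm x / ?l) ^ 3"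
      by (simp only: mean lap h(4) mult_zero_right diff_zero)
    also have "\<dots> = D / ?l" by (simp add: D_def field_simps power2_eq_square power3_eq_cube)
    finally show ?thesis by (simp only: dyn)
  qed
  moreover have "(\<lambda>n. D / 2 ^ n) \<longlonglongrightarrow> 0" by (rule LIMSEQ_divide_realpow_zero) simp
  ultimately have "\<bar>h x\<bar> \<le> 0"
    by (intro LIMSEQ_le_const[of "\<lambda>n. D / 2 ^ n"]) auto
  then show ?thesis by simp
qed

lemma poisson_solution_unique:
  assumes P: "poisson_solution m f P" and Q: "poisson_solution m f Q"
  shows "P = Q"
proof
  fix x
  have cont: "continuous_on UNIV P" "continuous_on UNIV Q"
    using P Q by (auto simp: poisson_solution_def)
  obtain C D where CD: "\<And>x. \<bar>P x\<bar> \<le> C * (norm x)\<^sup>2" "\<And>x. \<bar>Q x\<bar> \<le> D * (norm x)\<^sup>2"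
    using P Q unfolding poisson_solution_def by metis
  have "weakly_harmonic (\<lambda>x. P x - Q x)"
    unfolding weakly_harmonic_def
  proof (intro allI impI)
    fix \<phi> assume \<phi>: "test_function \<phi>"
    let ?L = "\<lambda>x. partial 1 (partial 1 \<phi>) x + partial 2 (partial 2 \<phi>) x"
    have tL: "test_function ?L" by (intro test_function_add test_function_partial \<phi>)
    have int: "integrable lborel (\<lambda>x. P x * ?L x)" "integrable lborel (\<lambda>x. Q x * ?L x)"
      by (rule integrable_locally_bounded_test[OF continuous_locally_bounded[OF cont(1)] tL],
          rule integrable_locally_bounded_test[OF continuous_locally_bounded[OF cont(2)] tL])
    have eq: "(LINT x|lborel. F x * - (\<Sum>i\<in>UNIV. partial i (partial i \<phi>) x)) = - (LINT x|lborel. F x * ?L x)" for F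
      by (simp only: sum_2 mult_minus_right Bochner_Integration.integral_minus)
    have "(LINT x|lborel. P x * ?L x) = (LINT x|lborel. Q x * ?L x)"
      using P Q \<phi> eq[of P] eq[of Q] unfolding poisson_solution_def weak_neg_laplacian_def by simp
    moreover have "(LINT x|lborel. (P x - Q x) * ?L x) = (LINT x|lborel. P x * ?L x) - (LINT x|lborel. Q x * ?L x)"
      unfolding left_diff_distrib by (rule Bochner_Integration.integral_diff[OF int])
    ultimately show "(LINT x|lborel. (P x - Q x) * ?L x) = 0" by simp
  qed
  moreover have "rot_symmetric m (\<lambda>x. P x - Q x)" "P 0 - Q 0 = 0"
    using P Q by (auto simp: poisson_solution_def rot_symmetric_def)
  moreover have "\<bar>P x - Q x\<bar> \<le> (C + D) * (norm x)\<^sup>2" for x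
    using CD(1)[of x] CD(2)[of x] by (simp add: distrib_right)
  moreover have "continuous_on UNIV (\<lambda>x. P x - Q x)" by (intro continuous_intros cont)
  ultimately have "P x - Q x = 0" using weakly_harmonic_zero[of "\<lambda>x. P x - Q x" "C + D" x] by blast
  then show "P x = Q x" by simp
qed

end

theorem theoremB:
  fixes \<alpha> :: real and m :: nat and f :: "real^2 \<Rightarrow> real"
  assumes "0 < \<alpha>" and "\<alpha> < 1"
    and "m \<ge> 3"
    and "f \<in> cring \<alpha>"
    and "rot_symmetric m f"
  shows "\<exists>H. weak_hessian (inv_neg_laplacian m f) H \<and> (\<forall>i j. (\<lambda>x. H x $ i $ j) \<in> cring \<alpha>)"
proof -
  have "\<alpha> \<le> 1" using assms(2) by simp
  then obtain B where "weighted_holder \<alpha> B f" using cring_weighted_holder[OF assms(4,1)] by metis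
  obtain E E1 E2 G :: "real \<Rightarrow> real" where "smooth_line E" "smooth_line G"
    "\<And>s. DERIV E s :> E1 s" "\<And>s. DERIV E1 s :> E2 s"
    "\<And>s. s \<ge> 16 \<Longrightarrow> E s = 0" "\<And>s. s \<ge> 16 \<Longrightarrow> G s = 0"
    "\<And>s. 4 * s * E2 s + 4 * E1 s = G (s / 4) / 4 - G s"
    "(LINT z::real^2|lborel. G ((norm z)\<^sup>2)) = 1"
    by (rule radial_kernels) (rule that)
  interpret potential E E1 E2 G f m \<alpha> B
    by unfold_locales (fact | use assms in simp)+
  obtain \<Psi> H where \<Psi>: "poisson_solution m f \<Psi>" and H: "weak_hessian \<Psi> H" "\<forall>i j. (\<lambda>x. H x $ i $ j) \<in> cring \<alpha>"
    using poisson_solution_exists by blast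
  \<comment> \<open>Only with uniqueness does the definite description denote the constructed
    solution.\<close>
  have "inv_neg_laplacian m f = \<Psi>"
    unfolding inv_neg_laplacian_def using \<Psi> poisson_solution_unique by (intro the_equality)
  with H show ?thesis by blast
qed

end
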